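(* Let $(R,\mu)$ and $(S,\nu)$ be two (possibly different) nonatomic probability measure spaces. Let $p\in(0,\infty)$ and $0\le\alpha<\frac1p$. Set $\beta=\frac1p-\alpha$, $\ell(t)=1-\log t$ for $t\in(0,1)$, $b_1=\ell^\alpha$ and $b_2=\ell^{-\beta}$. Let $X(R,\mu)$ and $Y(S,\nu)$ be rearrangement-invariant quasi-Banach function spaces that are $p$-convex. The following four statements are equivalent. (i) Every $(p,b_1,b_2)$-gaussible operator $T$ is bounded from $X(R,\mu)$ to $Y(S,\nu)$. (ii) Every operator $T$ defined on $L^p(R,\mu)$ having values in $\mathcal M(S,\nu)$ that satisfies $$K(Tf,t;L^{p,\ell^\alpha},L^{\infty,\ell^{-\beta}})\lesssim K(f,t;L^p,L^\infty)\quad\text{for every } f\in L^p(R,\mu)\text{ and } t\in(0,1)$$ (with a multiplicative constant independent of $f$ and $t$) is bounded from $X(R,\mu)$ to $Y(S,\nu)$. (iii) The operator $U_{\ell^\alpha,\ell^{-\beta},p}$ is bounded from $X(0,1)$ to $Y(0,1)$. (iv) The operator $T_{\ell^\alpha,\ell^{-\beta},p}$ is bounded from $\big(Y^{\frac1p}\big)'(0,1)$ to $\big(X^{\frac1p}\big)'(0,1)$.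
   Context: Functions and rearrangements. $\mathcal M(R,\mu)$ is the set of $\mu$-measurable complex-valued functions on $R$ (identified when equal a.e.); $\mathcal M_+(R,\mu)$ its nonnegative members; $(0,1)$ carries Lebesgue measure. For $f\in\mathcal M(R,\mu)$, $f^*(t)=\inf\{\lambda\in(0,\infty):\mu(\{x\in R:|f(x)|>\lambda\})\le t\}$, $t\in(0,1)$; similarly on other measure spaces. $P\lesssim Q$ means $P\le cQ$ with a constant $c>0$ independent of the appropriate quantities (here functions and $t$). R.i. spaces. A functional $\|\cdot\|_{X(0,1)}\colon\mathcal M_+(0,1)\to[0,\infty]$ is a rearrangement-invariant (r.i.) Banach function norm if for all $f,g,f_k\in\mathcal M_+(0,1)$ and $\lambda\ge0$: (P1) $\|f\|=0$ iff $f=0$ a.e., $\|\lambda f\|=\lambda\|f\|$, $\|f+g\|\le\|f\|+\|g\|$; (P2) $f\le g$ a.e. implies $\|f\|\le\|g\|$; (P3) $f_k\nearrow f$ a.e. implies $\|f_k\|\nearrow\|f\|$; (P4) $\|1\|<\infty$; (P5) $\int_0^1 f\le C_X\|f\|$ with $C_X$ independent of $f$; (P6) $f^*=g^*$ implies $\|f\|=\|g\|$. It is an r.i. quasi-Banach function norm if it satisfies (P2), (P3), (P4), (P6) and (P1) with the triangle inequality replaced by $\|f+g\|\le C(\|f\|+\|g\|)$ for some constant $C\ge1$ ((P5) not required). Given such a functional, $\|f\|_{X(R,\mu)}=\|f^*\|_{X(0,1)}$ for $f\in\mathcal M(R,\mu)$, and $X(R,\mu)=\{f\in\mathcal M(R,\mu):\|f\|_{X(R,\mu)}<\infty\}$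 is the corresponding r.i. (quasi-)Banach function space; $X(0,1)$ is its representation space. "Let $X(R,\mu)$ be an r.i. quasi-Banach function space" means: let $\|\cdot\|_{X(0,1)}$ be an r.i. quasi-Banach function norm and $X(R,\mu)$ the corresponding space. The associate norm is $\|f\|_{X'(0,1)}=\sup\{\int_0^1 fg: g\in\mathcal M_+(0,1),\ \|g\|_{X(0,1)}\le1\}$, with corresponding space $X'(0,1)$. $X$ is $p$-convex if $\|f\|_{X^{1/p}(0,1)}=\|f^{1/p}\|_{X(0,1)}^p$, $f\in\mathcal M_+(0,1)$, is an r.i. Banach function norm; $X^{1/p}$ denotes the corresponding space, and $(X^{1/p})'$ its associate space. For $q\in(0,\infty]$ and $b=\ell^\gamma$, $\gamma\in\mathbb R$, $\|g\|_{L^{q,b}(S,\nu)}=\|b(t)g^*(t)\|_{L^q(0,1)}$ and $L^{q,b}(S,\nu)$ is the set of $g\in\mathcal M(S,\nu)$ where this is finite. (For $p\ge1$, $L^{p,\ell^\alpha}$ is the Orlicz space $L^p(\log L)^{\alpha p}$, and $L^{\infty,\ell^{-\beta}}$ is the Orlicz space $\exp L^{1/\beta}$.) With $b_1=\ell^\alpha$, $b_2=\ell^{-\beta}$, $\sigma\colon[0,1]\to[0,1]$ is the increasing bijection satisfying $t^p=\frac1{C_0}\int_0^{\sigma(t)^p}[b_1(s)b_2(s)^{-1}]^p\,ds$ for every $t\in[0,1]$, where $C_0=\int_0^1[b_1(s)b_2(s)^{-1}]^p\,ds$; $\sigma^{-1}$ is its inverse, $\sigma(s^{1/p})^p=(\sigma(s^{1/p}))^p$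 and $\sigma^{-1}(s^{1/p})^p=(\sigma^{-1}(s^{1/p}))^p$. Operators are arbitrary maps (not necessarily linear). An operator $T$ defined on $L^p(R,\mu)$ with values in $\mathcal M(S,\nu)$ is $(p,b_1,b_2)$-gaussible if $\int_0^t[(Tf)^*(s)b_1(s)]^p\,ds\lesssim\int_0^t\big[f^*(\sigma^{-1}(s^{1/p})^p)\,b_1(s)b_2(s)^{-1}\big]^p\,ds$ for every $f\in L^p(R,\mu)$ and $t\in(0,1)$, with a constant independent of $f$ and $t$. An operator $T$ is bounded from a space $A$ to a space $B$ if there is a constant $C$ with $\|Tf\|_B\le C\|f\|_A$ for all $f\in A$. For $f\in\mathcal M(0,1)$ and $t\in(0,1)$: $U_{b_1,b_2,p}f(t)=f^*(\sigma^{-1}(t^{1/p})^p)\,b_2(t)^{-1}$; $T_{b_1,b_2,p}f(t)=\sup_{t\le s<1}\frac{f^*(\sigma(s^{1/p})^p)}{b_1(\sigma(s^{1/p})^p)^p}$. The $K$-functional of a couple $(X_0,X_1)$ is $K(f,t;X_0,X_1)=\inf\{\|g\|_{X_0}+t\|h\|_{X_1}:f=g+h,\ g\in X_0,\ h\in X_1\}$ ($=\infty$ if no such decomposition exists). $K(Tf,t;L^{p,\ell^\alpha},L^{\infty,\ell^{-\beta}})$ is taken over $(S,\nu)$ and $K(f,t;L^p,L^\infty)$ over $(R,\mu)$. *)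

theory Defs
  imports "HOL-Probability.Probability"
begin

text \<open>Elements of a function space are represented by functions rather than by classes modulo
  equality almost everywhere; all norms below are invariant under such equality, and operators
  are required to respect it.\<close>

definition nonatomic :: "'a measure \<Rightarrow> bool" where
  "nonatomic M \<longleftrightarrow> (\<forall>A\<in>sets M. 0 < emeasure M A \<longrightarrow>
     (\<exists>B\<in>sets M. B \<subseteq> A \<and> 0 < emeasure M B \<and> emeasure M B < emeasure M A))"

abbreviation unit_measure :: "real measure" where
  "unit_measure \<equiv> lebesgue_on {0<..<1}"

text \<open>Only the values at \<open>t \<in> {0<..<1}\<close> are meaningful: there, over a probability space, the set
  below is nonempty for measurable \<open>f\<close>.\<close>

definition rearr :: "'a measure \<Rightarrow> ('a \<Rightarrow> 'b::real_normed_vector) \<Rightarrow> real \<Rightarrow> real" where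
  "rearr M f t = Inf {s. 0 < s \<and> emeasure M {x\<in>space M. s < norm (f x)} \<le> ennreal t}"

definition mplus :: "(real \<Rightarrow> real) set" where
  "mplus = {f\<in>borel_measurable unit_measure. \<forall>t\<in>{0<..<1}. 0 \<le> f t}"

text \<open>Function norms are constrained on \<^term>\<open>mplus\<close> only.\<close>

definition fn_positive_homogeneous :: "((real \<Rightarrow> real) \<Rightarrow> ennreal) \<Rightarrow> bool" where
  "fn_positive_homogeneous N \<longleftrightarrow>
     (\<forall>f\<in>mplus. (N f = 0 \<longleftrightarrow> (AE t in unit_measure. f t = 0))) \<and>
     (\<forall>f\<in>mplus. \<forall>c\<ge>0. N (\<lambda>t. c * f t) = ennreal c * N f)"

definition fn_lattice :: "((real \<Rightarrow> real) \<Rightarrow> ennreal) \<Rightarrow> bool" where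
  "fn_lattice N \<longleftrightarrow>
     (\<forall>f\<in>mplus. \<forall>g\<in>mplus. (AE t in unit_measure. f t \<le> g t) \<longrightarrow> N f \<le> N g)"

definition fn_fatou :: "((real \<Rightarrow> real) \<Rightarrow> ennreal) \<Rightarrow> bool" where
  "fn_fatou N \<longleftrightarrow>
     (\<forall>F f. (\<forall>k. F k \<in> mplus) \<longrightarrow> f \<in> mplus \<longrightarrow>
        (AE t in unit_measure. incseq (\<lambda>k::nat. F k t) \<and> (\<lambda>k. F k t) \<longlonglongrightarrow> f t) \<longrightarrow>
        incseq (\<lambda>k. N (F k)) \<and> (\<lambda>k. N (F k)) \<longlonglongrightarrow> N f)"

definition fn_rearrangement_invariant :: "((real \<Rightarrow> real) \<Rightarrow> ennreal) \<Rightarrow> bool" where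
  "fn_rearrangement_invariant N \<longleftrightarrow>
     (\<forall>f\<in>mplus. \<forall>g\<in>mplus.
        (\<forall>t\<in>{0<..<1}. rearr unit_measure f t = rearr unit_measure g t) \<longrightarrow> N f = N g)"

definition ri_banach_function_norm :: "((real \<Rightarrow> real) \<Rightarrow> ennreal) \<Rightarrow> bool" where
  "ri_banach_function_norm N \<longleftrightarrow>
     fn_positive_homogeneous N \<and>
     (\<forall>f\<in>mplus. \<forall>g\<in>mplus. N (\<lambda>t. f t + g t) \<le> N f + N g) \<and>
     fn_lattice N \<and>
     fn_fatou N \<and>
     N (\<lambda>_. 1) < \<infinity> \<and>
     (\<exists>C>0. \<forall>f\<in>mplus. (\<integral>\<^sup>+t. ennreal (f t) \<partial>unit_measure) \<le> ennreal C * N f) \<and>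
     fn_rearrangement_invariant N"

definition ri_quasi_banach_function_norm :: "((real \<Rightarrow> real) \<Rightarrow> ennreal) \<Rightarrow> bool" where
  "ri_quasi_banach_function_norm N \<longleftrightarrow>
     fn_positive_homogeneous N \<and>
     (\<exists>C\<ge>1. \<forall>f\<in>mplus. \<forall>g\<in>mplus. N (\<lambda>t. f t + g t) \<le> ennreal C * (N f + N g)) \<and>
     fn_lattice N \<and>
     fn_fatou N \<and>
     N (\<lambda>_. 1) < \<infinity> \<and>
     fn_rearrangement_invariant N"

definition ri_norm ::
    "((real \<Rightarrow> real) \<Rightarrow> ennreal) \<Rightarrow> 'a measure \<Rightarrow> ('a \<Rightarrow> complex) \<Rightarrow> ennreal" where
  "ri_norm N M f = N (rearr M f)"

definition fspace :: "'a measure \<Rightarrow> (('a \<Rightarrow> complex) \<Rightarrow> ennreal) \<Rightarrow> ('a \<Rightarrow> complex) set" where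
  "fspace M n = {f\<in>borel_measurable M. n f < \<infinity>}"

definition associate_norm :: "((real \<Rightarrow> real) \<Rightarrow> ennreal) \<Rightarrow> (real \<Rightarrow> real) \<Rightarrow> ennreal" where
  "associate_norm N f =
     (SUP g\<in>{g\<in>mplus. N g \<le> 1}. \<integral>\<^sup>+t. ennreal (f t * g t) \<partial>unit_measure)"

text \<open>Positive real powers on \<open>[0,\<infinity>]\<close>.\<close>

definition epowr :: "ennreal \<Rightarrow> real \<Rightarrow> ennreal" where
  "epowr x a = (if x = \<infinity> then \<infinity> else ennreal (enn2real x powr a))"

text \<open>The functional written \<open>X\<^sup>1\<^sup>/\<^sup>p\<close>.\<close>

definition root_norm :: "real \<Rightarrow> ((real \<Rightarrow> real) \<Rightarrow> ennreal) \<Rightarrow> (real \<Rightarrow> real) \<Rightarrow> ennreal" where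
  "root_norm p N f = epowr (N (\<lambda>t. f t powr (1 / p))) p"

definition p_convex :: "real \<Rightarrow> ((real \<Rightarrow> real) \<Rightarrow> ennreal) \<Rightarrow> bool" where
  "p_convex p N \<longleftrightarrow> ri_banach_function_norm (root_norm p N)"

definition Lq_norm :: "ennreal \<Rightarrow> 'a measure \<Rightarrow> ('a \<Rightarrow> 'b::real_normed_vector) \<Rightarrow> ennreal" where
  "Lq_norm q M f =
     (if q = \<infinity> then esssup M (\<lambda>x. ennreal (norm (f x)))
      else epowr (\<integral>\<^sup>+x. ennreal (norm (f x) powr enn2real q) \<partial>M) (1 / enn2real q))"

text \<open>The functional of \<open>L\<^sup>q\<^sup>,\<^sup>b\<close>.\<close>

definition weighted_norm ::
    "ennreal \<Rightarrow> (real \<Rightarrow> real) \<Rightarrow> 'a measure \<Rightarrow> ('a \<Rightarrow> complex) \<Rightarrow> ennreal" where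
  "weighted_norm q b M g = Lq_norm q unit_measure (\<lambda>t. b t * rearr M g t)"

definition ell :: "real \<Rightarrow> real" where
  "ell t = 1 - ln t"

definition K_functional ::
    "'a measure \<Rightarrow> (('a \<Rightarrow> complex) \<Rightarrow> ennreal) \<Rightarrow> (('a \<Rightarrow> complex) \<Rightarrow> ennreal)
      \<Rightarrow> ('a \<Rightarrow> complex) \<Rightarrow> real \<Rightarrow> ennreal" where
  "K_functional M n0 n1 f t =
     Inf {n0 g + ennreal t * n1 h | g h.
            g \<in> fspace M n0 \<and> h \<in> fspace M n1 \<and> (AE x in M. f x = g x + h x)}"

definition is_operator ::
    "'a measure \<Rightarrow> ('a \<Rightarrow> complex) set \<Rightarrow> 'b measure \<Rightarrow> (('a \<Rightarrow> complex) \<Rightarrow> 'b \<Rightarrow> complex) \<Rightarrow> bool" where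
  "is_operator M A M' T \<longleftrightarrow>
     (\<forall>f\<in>A. T f \<in> borel_measurable M') \<and>
     (\<forall>f\<in>A. \<forall>g\<in>A. (AE x in M. f x = g x) \<longrightarrow> (AE y in M'. T f y = T g y))"

definition bounded_operator ::
    "('a \<Rightarrow> complex) set \<Rightarrow> (('a \<Rightarrow> complex) \<Rightarrow> ennreal) \<Rightarrow> (('b \<Rightarrow> complex) \<Rightarrow> ennreal)
      \<Rightarrow> (('a \<Rightarrow> complex) \<Rightarrow> 'b \<Rightarrow> complex) \<Rightarrow> bool" where
  "bounded_operator A nA nB T \<longleftrightarrow> (\<exists>C>0. \<forall>f\<in>A. nB (T f) \<le> ennreal C * nA f)"

text \<open>The conditions determine \<open>\<sigma>\<close> on \<open>{0..1}\<close>; values elsewhere are never used.\<close>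

definition is_sigma ::
    "(real \<Rightarrow> real) \<Rightarrow> (real \<Rightarrow> real) \<Rightarrow> real \<Rightarrow> (real \<Rightarrow> real) \<Rightarrow> bool" where
  "is_sigma b1 b2 p \<sigma> \<longleftrightarrow>
     strict_mono_on {0..1} \<sigma> \<and> bij_betw \<sigma> {0..1} {0..1} \<and>
     (\<forall>t\<in>{0..1}. t powr p =
        1 / (LINT s:{0<..<1}|lebesgue. (b1 s / b2 s) powr p) *
        (LINT s:{0<..<\<sigma> t powr p}|lebesgue. (b1 s / b2 s) powr p))"

definition sigma :: "(real \<Rightarrow> real) \<Rightarrow> (real \<Rightarrow> real) \<Rightarrow> real \<Rightarrow> real \<Rightarrow> real" where
  "sigma b1 b2 p = (SOME \<sigma>. is_sigma b1 b2 p \<sigma>)"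

definition sigma_inv :: "(real \<Rightarrow> real) \<Rightarrow> (real \<Rightarrow> real) \<Rightarrow> real \<Rightarrow> real \<Rightarrow> real" where
  "sigma_inv b1 b2 p = inv_into {0..1} (sigma b1 b2 p)"

definition gaussible ::
    "real \<Rightarrow> (real \<Rightarrow> real) \<Rightarrow> (real \<Rightarrow> real) \<Rightarrow> 'a measure \<Rightarrow> 'b measure
      \<Rightarrow> (('a \<Rightarrow> complex) \<Rightarrow> 'b \<Rightarrow> complex) \<Rightarrow> bool" where
  "gaussible p b1 b2 M M' T \<longleftrightarrow>
     is_operator M (fspace M (Lq_norm (ennreal p) M)) M' T \<and>
     (\<exists>C>0. \<forall>f\<in>fspace M (Lq_norm (ennreal p) M). \<forall>t\<in>{0<..<1}.
        (\<integral>\<^sup>+s\<in>{0<..<t}. ennreal ((rearr M' (T f) s * b1 s) powr p) \<partial>lebesgue)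
        \<le> ennreal C *
          (\<integral>\<^sup>+s\<in>{0<..<t}.
             ennreal ((rearr M f (sigma_inv b1 b2 p (s powr (1 / p)) powr p) * (b1 s / b2 s)) powr p)
             \<partial>lebesgue))"

definition U_op ::
    "(real \<Rightarrow> real) \<Rightarrow> (real \<Rightarrow> real) \<Rightarrow> real \<Rightarrow> (real \<Rightarrow> complex) \<Rightarrow> real \<Rightarrow> complex" where
  "U_op b1 b2 p f t =
     complex_of_real (rearr unit_measure f (sigma_inv b1 b2 p (t powr (1 / p)) powr p) / b2 t)"

definition T_op ::
    "(real \<Rightarrow> real) \<Rightarrow> (real \<Rightarrow> real) \<Rightarrow> real \<Rightarrow> (real \<Rightarrow> complex) \<Rightarrow> real \<Rightarrow> complex" where
  "T_op b1 b2 p f t =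
     complex_of_real
       (SUP s\<in>{t..<1}.
          rearr unit_measure f (sigma b1 b2 p (s powr (1 / p)) powr p)
          / b1 (sigma b1 b2 p (s powr (1 / p)) powr p) powr p)"

end

theory Submission
  imports Defs
begin

text \<open>All four statements are statements about one operator on decreasing functions. For
  \<open>b1 = ell powr \<alpha>\<close> and \<open>b2 = ell powr (- \<beta>)\<close> the quotient \<open>b1 / b2\<close> has \<open>p\<close>-th power \<open>ell\<close>, so after the
  substitution \<open>t \<mapsto> t powr p\<close> the map \<open>\<sigma>\<inverse>\<close> becomes the explicit function
  \<open>Phi y = y (2 - ln y) / 2\<close>, and \<open>\<sigma>\<close> its inverse \<open>tau\<close>. With the factorization \<open>ell = w u\<close> into the \<open>p\<close>-th
  powers of \<open>b1\<close> and of \<open>1 / b2\<close>, the \<open>p\<close>-th power of \<open>U f\<close> is \<open>S_op\<close> applied to the \<open>p\<close>-th power of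
  \<open>f\<^sup>*\<close>, where \<open>S_op f t = f (Phi t) u t\<close>. By \<open>p\<close>-convexity boundedness of \<open>U\<close> therefore means
  boundedness of \<open>S_op\<close> on decreasing functions between two Banach function norms.

  (i) implies (ii) because a bound for the K-functionals forces gaussibility
  (\<open>K_bounded_imp_gaussible\<close>): truncation estimates the K-functional of \<open>f\<close> from above, and every
  decomposition of \<open>T f\<close> controls the weighted primitive that defines gaussibility.

  (ii) implies (iii) because \<open>U\<close> itself can be copied to a map between the two given spaces: on a
  nonatomic probability space there is a uniformly distributed variable, so every decreasing
  function on the unit interval is equimeasurable with a function on the space. The copy satisfies
  the K-functional bound (\<open>transplanted_operator_K_bounded\<close>), since cutting \<open>f\<^sup>*\<close> at a fixed height
  decomposes \<open>U f\<close> as well.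

  (iii) implies (i): gaussibility dominates \<open>G = (T f)\<^sup>* powr p\<close> only in a weighted mean. The smallest
  decreasing \<open>\<phi>\<close> with \<open>G \<le> S_op \<phi>\<close> is still dominated by \<open>f\<^sup>* powr p\<close> in the ordinary mean
  (\<open>majorant_integral_le\<close>, \<open>S_bounded_imp_dominated\<close>); the Hardy--Littlewood--Polya principle bounds its
  norm, and boundedness of \<open>S_op\<close> does the rest.

  (iii) and (iv) are dual to each other. The adjoint of \<open>S_op\<close> is, up to a factor, composition of
  \<open>k / w\<close> with \<open>tau\<close>, and \<open>T\<close> is its decreasing majorant \<open>Sup_op\<close>. From (iv) to (iii) the majorant does no
  harm. From (iii) to (iv) it is removed by averaging the test function over the blocks on which the
  majorant stays between consecutive powers of two (\<open>Sup_op_pairing_le\<close>); averaging does not increase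
  the norm. Both this duality and the Hardy--Littlewood--Polya principle rest on a separation theorem
  (\<open>separation\<close>): a decreasing function of norm greater than \<open>m\<close> is detected by a functional that is
  itself decreasing. It is obtained as the residual of a mean square projection onto the unit ball,
  which is decreasing because the norm is rearrangement-invariant.\<close>

section \<open>Decreasing rearrangements\<close>

lemma prob_space_unit_measure: "prob_space unit_measure"
  by (rule prob_spaceI) (simp add: emeasure_restrict_space)

interpretation unit: prob_space unit_measure
  by (rule prob_space_unit_measure)

lemma emeasure_unit_interval:
  "0 \<le> c \<Longrightarrow> c \<le> 1 \<Longrightarrow> emeasure unit_measure {0<..<c} = ennreal c"
  by (subst emeasure_restrict_space) auto

abbreviation unit_integral :: "(real \<Rightarrow> ennreal) \<Rightarrow> ennreal" (binder "\<integral>\<^sub>1" 10)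
  where "unit_integral f \<equiv> nn_integral unit_measure f"

definition dplus :: "(real \<Rightarrow> real) set" where
  "dplus = {f. antimono_on {0<..<1} f \<and> (\<forall>t\<in>{0<..<1}. 0 \<le> f t)}"

lemma dplusI:
  assumes "\<And>s t. 0 < s \<Longrightarrow> s \<le> t \<Longrightarrow> t < 1 \<Longrightarrow> f t \<le> f s"
    and "\<And>t. 0 < t \<Longrightarrow> t < 1 \<Longrightarrow> 0 \<le> f t"
  shows "f \<in> dplus"
  using assms by (auto simp: dplus_def monotone_on_def)

lemma dplus_antimono: "f \<in> dplus \<Longrightarrow> 0 < s \<Longrightarrow> s \<le> t \<Longrightarrow> t < 1 \<Longrightarrow> f t \<le> f s"
  by (auto simp: dplus_def monotone_on_def)

lemma dplus_nonneg: "f \<in> dplus \<Longrightarrow> 0 < t \<Longrightarrow> t < 1 \<Longrightarrow> 0 \<le> f t"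
  by (auto simp: dplus_def)

lemma dplus_borel:
  assumes "f \<in> dplus"
  shows "f \<in> borel_measurable (restrict_space borel {0<..<1})"
proof -
  have "mono_on {0<..<1} (\<lambda>t. - f t)"
    using assms by (auto simp: dplus_def monotone_on_def)
  from borel_measurable_mono_on_fnc[OF this] have "(\<lambda>t. - (- f t)) \<in> borel_measurable (restrict_space borel {0<..<1})"
    by (rule borel_measurable_uminus)
  then show ?thesis by simp
qed

lemma dplus_borel_indicator:
  assumes "f \<in> dplus"
  shows "(\<lambda>t. indicator {0<..<1} t * f t) \<in> borel_measurable borel"
  using dplus_borel[OF assms]
  by (subst (asm) borel_measurable_restrict_space_iff) (auto)

lemma borel_unit_measurable:
  fixes f :: "real \<Rightarrow> real"
  shows "f \<in> borel_measurable (restrict_space borel {0<..<1}) \<Longrightarrow> f \<in> borel_measurable unit_measure"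
  using measurable_completion[of "\<lambda>t. indicator {0<..<1} t *\<^sub>R f t" lborel borel]
  by (simp add: borel_measurable_restrict_space_iff)

lemma dplus_mplus: "f \<in> dplus \<Longrightarrow> f \<in> mplus"
  using borel_unit_measurable[OF dplus_borel] by (auto simp: mplus_def dplus_def)

text \<open>Over a probability space the set in the definition of the rearrangement is nonempty for
  every positive argument, so the infimum is a genuine one.\<close>

lemma (in prob_space) rearr_level_exists:
  fixes f :: "'a \<Rightarrow> 'b::{real_normed_vector}"
  assumes [measurable]: "(\<lambda>x. norm (f x)) \<in> borel_measurable M" and "0 < t"
  shows "\<exists>s>0. emeasure M {x\<in>space M. s < norm (f x)} \<le> ennreal t"
proof -
  let ?A = "\<lambda>n::nat. {x\<in>space M. real (Suc n) < norm (f x)}"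
  have "(\<lambda>n. emeasure M (?A n)) \<longlonglongrightarrow> emeasure M (\<Inter>n. ?A n)"
    by (intro Lim_emeasure_decseq) (auto simp: decseq_def)
  also have "(\<Inter>n. ?A n) = {}"
  proof (rule equals0I)
    fix x assume x: "x \<in> (\<Inter>n. ?A n)"
    obtain n where "norm (f x) < real n" using reals_Archimedean2 by blast
    moreover have "real (Suc n) < norm (f x)" using x by blast
    ultimately show False by simp
  qed
  finally have "(\<lambda>n. emeasure M (?A n)) \<longlonglongrightarrow> 0" by simp
  then have "\<forall>\<^sub>F n in sequentially. emeasure M (?A n) < ennreal t"
    using \<open>0 < t\<close> by (intro order_tendstoD) auto
  then obtain n where "emeasure M (?A n) < ennreal t"
    by (auto simp: eventually_sequentially)
  then show ?thesis by (intro exI[of _ "real (Suc n)"]) auto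
qed

text \<open>The Galois connection between rearrangement and distribution function.\<close>

lemma (in prob_space) less_rearr_iff:
  fixes f :: "'a \<Rightarrow> 'b::{real_normed_vector}"
  assumes [measurable]: "(\<lambda>x. norm (f x)) \<in> borel_measurable M" and t: "0 < t" and s: "0 \<le> s"
  shows "s < rearr M f t \<longleftrightarrow> ennreal t < emeasure M {x\<in>space M. s < norm (f x)}"
proof
  let ?S = "{s. 0 < s \<and> emeasure M {x\<in>space M. s < norm (f x)} \<le> ennreal t}"
  have ne: "?S \<noteq> {}" using rearr_level_exists[OF assms(1,2)] by auto
  have bdd: "bdd_below ?S" by (auto intro!: bdd_belowI[of _ 0])
  show "ennreal t < emeasure M {x\<in>space M. s < norm (f x)}" if less: "s < rearr M f t"
  proof (rule ccontr)
    assume "\<not> ennreal t < emeasure M {x\<in>space M. s < norm (f x)}"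
    then have le: "emeasure M {x\<in>space M. s < norm (f x)} \<le> ennreal t" by simp
    have "r \<in> ?S" if "s < r" for r
    proof -
      have "emeasure M {x\<in>space M. r < norm (f x)} \<le> emeasure M {x\<in>space M. s < norm (f x)}"
        using that by (intro emeasure_mono) auto
      then show ?thesis using le that s by auto
    qed
    then have "rearr M f t \<le> r" if "s < r" for r
      unfolding rearr_def using that bdd by (intro cInf_lower) auto
    then have "rearr M f t \<le> s" by (rule dense_ge)
    with less show False by simp
  qed
  show "s < rearr M f t" if less: "ennreal t < emeasure M {x\<in>space M. s < norm (f x)}"
  proof -
    let ?A = "\<lambda>n::nat. {x\<in>space M. s + 1 / real (Suc n) < norm (f x)}"
    have "?A m \<subseteq> ?A n" if "m \<le> n" for m n
    proof -
      have "1 / real (Suc n) \<le> 1 / real (Suc m)"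
        using that by (intro divide_left_mono) auto
      then show ?thesis by auto
    qed
    then have "(\<lambda>n. emeasure M (?A n)) \<longlonglongrightarrow> emeasure M (\<Union>n. ?A n)"
      by (intro Lim_emeasure_incseq) (auto simp: incseq_def simp del: of_nat_Suc)
    also have "(\<Union>n. ?A n) = {x\<in>space M. s < norm (f x)}"
    proof (intro equalityI subsetI)
      fix x assume "x \<in> {x\<in>space M. s < norm (f x)}"
      then have x: "x \<in> space M" "0 < norm (f x) - s" by auto
      then obtain n where "inverse (real (Suc n)) < norm (f x) - s" using reals_Archimedean by blast
      with x show "x \<in> (\<Union>n. ?A n)" by (auto simp: inverse_eq_divide intro!: exI[of _ n])
    next
      fix x assume "x \<in> (\<Union>n. ?A n)"
      then obtain n where x: "x \<in> space M" "s + 1 / real (Suc n) < norm (f x)" by auto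
      moreover have "0 < 1 / real (Suc n)" by simp
      ultimately have "s < norm (f x)" by linarith
      with x show "x \<in> {x\<in>space M. s < norm (f x)}" by simp
    qed
    finally have "\<forall>\<^sub>F n in sequentially. ennreal t < emeasure M (?A n)"
      using less by (intro order_tendstoD)
    then obtain n where n: "ennreal t < emeasure M (?A n)" by (auto simp: eventually_sequentially)
    have "s + 1 / real (Suc n) \<le> r" if r: "r \<in> ?S" for r
    proof (rule ccontr)
      assume "\<not> s + 1 / real (Suc n) \<le> r"
      then have "emeasure M (?A n) \<le> emeasure M {x\<in>space M. r < norm (f x)}"
        by (intro emeasure_mono) auto
      with r n show False by auto
    qed
    then have "s + 1 / real (Suc n) \<le> rearr M f t"
      unfolding rearr_def using ne by (intro cInf_greatest) auto
    moreover have "0 < 1 / real (Suc n)" by simp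
    ultimately show ?thesis by linarith
  qed
qed

lemma (in prob_space) rearr_nonneg:
  fixes f :: "'a \<Rightarrow> 'b::{real_normed_vector}"
  assumes "(\<lambda>x. norm (f x)) \<in> borel_measurable M" and "0 < t"
  shows "0 \<le> rearr M f t"
  unfolding rearr_def using rearr_level_exists[OF assms] by (intro cInf_greatest) auto

lemma (in prob_space) rearr_le_iff:
  fixes f :: "'a \<Rightarrow> 'b::{real_normed_vector}"
  assumes "(\<lambda>x. norm (f x)) \<in> borel_measurable M" and "0 < t" and "0 \<le> s"
  shows "rearr M f t \<le> s \<longleftrightarrow> emeasure M {x\<in>space M. s < norm (f x)} \<le> ennreal t"
  using less_rearr_iff[OF assms] by (auto simp: not_less[symmetric])

lemma (in prob_space) rearr_dplus:
  fixes f :: "'a \<Rightarrow> 'b::{real_normed_vector}"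
  assumes m: "(\<lambda>x. norm (f x)) \<in> borel_measurable M"
  shows "rearr M f \<in> dplus"
proof (rule dplusI)
  fix s t :: real assume st: "0 < s" "s \<le> t" "t < 1"
  have "emeasure M {x\<in>space M. rearr M f s < norm (f x)} \<le> ennreal s"
    using rearr_le_iff[OF m st(1), of "rearr M f s"] rearr_nonneg[OF m st(1)] by auto
  also have "\<dots> \<le> ennreal t" using st by (intro ennreal_leI)
  finally show "rearr M f t \<le> rearr M f s"
    using rearr_le_iff[OF m _ rearr_nonneg[OF m st(1)], of t] st by auto
qed (rule rearr_nonneg[OF m])

lemma (in prob_space) emeasure_rearr:
  fixes f :: "'a \<Rightarrow> 'b::{real_normed_vector}"
  assumes m: "(\<lambda>x. norm (f x)) \<in> borel_measurable M" and s: "0 \<le> s"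
  shows "emeasure unit_measure {t\<in>space unit_measure. s < rearr M f t} =
    emeasure M {x\<in>space M. s < norm (f x)}"
proof -
  let ?m = "measure M {x\<in>space M. s < norm (f x)}"
  have "{t\<in>space unit_measure. s < rearr M f t} = {0<..<?m}"
    using less_rearr_iff[OF m _ s] prob_le_1[of "{x\<in>space M. s < norm (f x)}"]
    by (auto simp: emeasure_eq_measure ennreal_less_iff intro: less_le_trans)
  moreover have "?m \<le> 1" by simp
  ultimately show ?thesis
    by (simp add: emeasure_unit_interval emeasure_eq_measure)
qed

lemma rearr_cong_distr:
  assumes "\<And>s. 0 < s \<Longrightarrow> emeasure M {x\<in>space M. s < norm (f x)} = emeasure N {x\<in>space N. s < norm (g x)}"
  shows "rearr M f = rearr N g"
  unfolding rearr_def using assms by (intro ext arg_cong[of _ _ Inf]) auto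

lemma rearr_cong_AE:
  assumes "(\<lambda>x. norm (f x)) \<in> borel_measurable M" "(\<lambda>x. norm (g x)) \<in> borel_measurable M"
    and "AE x in M. norm (f x) = norm (g x)"
  shows "rearr M f = rearr M g"
proof (rule rearr_cong_distr)
  note [measurable] = assms(1,2)
  show "emeasure M {x\<in>space M. s < norm (f x)} = emeasure M {x\<in>space M. s < norm (g x)}" for s
    using assms(3) by (intro emeasure_eq_AE) auto
qed

lemma mplus_norm_measurable: "f \<in> mplus \<Longrightarrow> (\<lambda>x. norm (f x)) \<in> borel_measurable unit_measure"
  by (auto simp: mplus_def)

lemma (in prob_space) rearr_rearr:
  fixes f :: "'a \<Rightarrow> 'b::{real_normed_vector}"
  assumes m: "(\<lambda>x. norm (f x)) \<in> borel_measurable M"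
  shows "rearr unit_measure (rearr M f) = rearr M f"
proof (rule rearr_cong_distr)
  fix s :: real assume s: "0 < s"
  have "{t\<in>space unit_measure. s < norm (rearr M f t)} = {t\<in>space unit_measure. s < rearr M f t}"
    using rearr_nonneg[OF m] by auto
  then show "emeasure unit_measure {t\<in>space unit_measure. s < norm (rearr M f t)} =
    emeasure M {x\<in>space M. s < norm (f x)}"
    using emeasure_rearr[OF m] s by simp
qed

text \<open>A decreasing function and its rearrangement have level sets that are intervals with the same
  endpoints. So they can differ at a point only if it is the right endpoint of a level set of
  rational height, and there are countably many of these.\<close>

lemma rearr_dplus_AE:
  assumes f: "f \<in> dplus"
  shows "AE t in unit_measure. rearr unit_measure f t = f t"
proof -
  note m = mplus_norm_measurable[OF dplus_mplus[OF f]]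
  note [measurable] = m
  let ?E = "\<lambda>s. {x\<in>space unit_measure. s < norm (f x)}"
  let ?c = "\<lambda>s. measure unit_measure (?E s)"
  have E: "?E s = {x. 0 < x \<and> x < 1 \<and> s < f x}" for s
    using dplus_nonneg[OF f] by auto
  have le: "rearr unit_measure f t \<le> f t" if t: "0 < t" "t < 1" for t
  proof -
    have "emeasure unit_measure (?E (f t)) \<le> emeasure unit_measure {0<..<t}"
    proof (intro emeasure_mono)
      show "?E (f t) \<subseteq> {0<..<t}"
      proof
        fix x assume "x \<in> ?E (f t)"
        then have x: "0 < x" "x < 1" "f t < f x" using dplus_nonneg[OF f, of x] by auto
        with dplus_antimono[OF f t(1), of x] show "x \<in> {0<..<t}" by force
      qed
    qed (use t in \<open>auto simp: sets_restrict_space\<close>)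
    also have "\<dots> = ennreal t" using t by (simp add: emeasure_unit_interval)
    finally show ?thesis using unit.rearr_le_iff[OF m t(1) dplus_nonneg[OF f t]] by simp
  qed
  have ge: "t = ?c q" if t: "0 < t" "t < 1" and q: "rearr unit_measure f t \<le> q" "q < f t" for t q
  proof -
    have q0: "0 \<le> q" using unit.rearr_nonneg[OF m t(1)] q by simp
    have "emeasure unit_measure (?E q) \<le> ennreal t"
      using unit.rearr_le_iff[OF m t(1) q0] q by simp
    then have 1: "?c q \<le> t"
      using t by (simp add: unit.emeasure_eq_measure)
    have "emeasure unit_measure {0<..<t} \<le> emeasure unit_measure (?E q)"
    proof (intro emeasure_mono)
      show "{0<..<t} \<subseteq> ?E q"
      proof
        fix x assume "x \<in> {0<..<t}"
        with dplus_antimono[OF f, of x t] t q show "x \<in> ?E q" by (auto simp: E)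
      qed
      show "?E q \<in> sets unit_measure" by measurable
    qed
    also have "emeasure unit_measure {0<..<t} = ennreal t"
      using t by (simp add: emeasure_unit_interval)
    finally have "t \<le> ?c q" using t
      by (simp add: unit.emeasure_eq_measure)
    with 1 show ?thesis by simp
  qed
  have cnt: "countable (?c ` \<rat>)" by (intro countable_image countable_rat)
  have "AE t in unit_measure. t \<notin> ?c ` \<rat>"
  proof -
    have "AE t in lebesgue. t \<notin> ?c ` \<rat>"
      by (intro AE_not_in null_sets_completionI countable_imp_null_set_lborel cnt)
    then show ?thesis by (subst AE_restrict_space_iff) auto
  qed
  then show ?thesis
  proof (rule AE_mp, intro AE_I2 impI)
    fix t assume "t \<in> space unit_measure" and nt: "t \<notin> ?c ` \<rat>"
    then have t: "0 < t" "t < 1" by auto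
    show "rearr unit_measure f t = f t"
    proof (rule antisym[OF le[OF t]], rule ccontr)
      assume "\<not> f t \<le> rearr unit_measure f t"
      then obtain q where "q \<in> \<rat>" "rearr unit_measure f t < q" "q < f t"
        using Rats_dense_in_real[of "rearr unit_measure f t" "f t"] by auto
      with ge[OF t, of q] nt show False by (auto simp: image_iff)
    qed
  qed
qed

text \<open>Where \<open>norm \<circ> f\<close> exceeds the sum on the right, \<open>norm \<circ> g\<close> or \<open>norm \<circ> h\<close> exceeds its own summand,
  and each of the latter two sets has measure at most \<open>t / 2\<close>.\<close>

lemma rearr_add_le:
  fixes f g h :: "'a \<Rightarrow> 'b::{real_normed_vector}"
  assumes "prob_space M"
    and [measurable]: "(\<lambda>x. norm (f x)) \<in> borel_measurable M" "(\<lambda>x. norm (g x)) \<in> borel_measurable M"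
      "(\<lambda>x. norm (h x)) \<in> borel_measurable M"
    and fgh: "AE x in M. norm (f x) \<le> norm (g x) + norm (h x)" and t: "0 < t"
  shows "rearr M f t \<le> rearr M g (t / 2) + rearr M h (t / 2)"
proof -
  interpret prob_space M by fact
  let ?a = "rearr M g (t / 2)" and ?b = "rearr M h (t / 2)"
  have ab: "0 \<le> ?a" "0 \<le> ?b" using t by (auto intro!: rearr_nonneg)
  have "emeasure M {x\<in>space M. ?a + ?b < norm (f x)} \<le>
      emeasure M ({x\<in>space M. ?a < norm (g x)} \<union> {x\<in>space M. ?b < norm (h x)})"
    using fgh by (intro emeasure_mono_AE) auto
  also have "\<dots> \<le> emeasure M {x\<in>space M. ?a < norm (g x)} + emeasure M {x\<in>space M. ?b < norm (h x)}"
    by (intro emeasure_subadditive) auto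
  also have "\<dots> \<le> ennreal (t / 2) + ennreal (t / 2)"
    using rearr_le_iff[of g "t/2" ?a] rearr_le_iff[of h "t/2" ?b] ab t by (intro add_mono) auto
  also have "\<dots> = ennreal t" using t by (simp flip: ennreal_plus)
  finally show ?thesis using rearr_le_iff[of f t "?a + ?b"] ab t by auto
qed

lemma rearr_diff_bounded_le:
  fixes f g :: "'a \<Rightarrow> 'b::{real_normed_vector}"
  assumes "prob_space M"
    and [measurable]: "(\<lambda>x. norm (f x)) \<in> borel_measurable M" "(\<lambda>x. norm (g x)) \<in> borel_measurable M"
    and fgm: "AE x in M. norm (f x) \<le> norm (g x) + m" and m: "0 \<le> m" and t: "0 < t"
  shows "rearr M f t - m \<le> rearr M g t"
proof -
  interpret prob_space M by fact
  let ?a = "rearr M g t"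
  have a: "0 \<le> ?a" using t by (auto intro!: rearr_nonneg)
  have "emeasure M {x\<in>space M. ?a + m < norm (f x)} \<le> emeasure M {x\<in>space M. ?a < norm (g x)}"
    using fgm by (intro emeasure_mono_AE) auto
  also have "\<dots> \<le> ennreal t" using rearr_le_iff[of g t ?a] a t by auto
  finally show ?thesis using rearr_le_iff[of f t "?a + m"] a m t by auto
qed

text \<open>By \<open>emeasure_rearr\<close> the laws of \<open>norm \<circ> f\<close> and of the rearrangement agree on half-lines, hence
  they are equal.\<close>

lemma (in prob_space) nn_integral_rearr:
  fixes f :: "'a \<Rightarrow> 'b::{real_normed_vector}" and \<Theta> :: "real \<Rightarrow> ennreal"
  assumes m: "(\<lambda>x. norm (f x)) \<in> borel_measurable M" and [measurable]: "\<Theta> \<in> borel_measurable borel"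
  shows "(\<integral>\<^sup>+x. \<Theta> (norm (f x)) \<partial>M) = (\<integral>\<^sub>1t. \<Theta> (rearr M f t))"
proof -
  note [measurable] = m
  have [measurable]: "rearr M f \<in> borel_measurable unit_measure"
    using dplus_mplus[OF rearr_dplus[OF m]] by (auto simp: mplus_def)
  let ?P = "distr M borel (\<lambda>x. norm (f x))" and ?Q = "distr unit_measure borel (rearr M f)"
  interpret P: prob_space ?P by (rule prob_space_distr) measurable
  interpret Q: prob_space ?Q by (rule unit.prob_space_distr) measurable
  have "?P = ?Q"
  proof (rule measure_eqI_generator_eq[where E="range greaterThan" and \<Omega>=UNIV and A="\<lambda>n. {- real n<..}"])
    show "Int_stable (range greaterThan :: real set set)"
    proof (rule Int_stableI_image)
      show "\<exists>k\<in>UNIV. {i<..} \<inter> {j<..} = {k<..}" for i j :: real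
        by (intro bexI[of _ "max i j"]) auto
    qed
    show "sets ?P = sigma_sets UNIV (range greaterThan)" "sets ?Q = sigma_sets UNIV (range greaterThan)"
      by (simp_all add: borel_Ioi)
    show "(\<Union>n. {- real n<..}) = UNIV"
    proof (intro equalityI subsetI UNIV_I)
      fix x :: real
      obtain n where "- x < real n" using reals_Archimedean2 by blast
      then have "- real n < x" by linarith
      then show "x \<in> (\<Union>n. {- real n<..})" by auto
    qed
    fix X :: "real set" assume "X \<in> range greaterThan"
    then obtain s where X: "X = {s<..}" by auto
    show "emeasure ?P X = emeasure ?Q X"
    proof (cases "0 \<le> s")
      case True
      have "emeasure ?P X = emeasure M {x\<in>space M. s < norm (f x)}"
        by (auto simp: X emeasure_distr intro!: arg_cong[of _ _ "emeasure M"])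
      also have "\<dots> = emeasure ?Q X"
        unfolding emeasure_rearr[OF m True, symmetric]
        by (simp add: X emeasure_distr) (rule arg_cong[of _ _ "emeasure unit_measure"], auto)
      finally show ?thesis .
    next
      case False
      then have 1: "s < norm (f x)" for x using norm_ge_zero[of "f x"] by linarith
      have 2: "s < rearr M f t" if "0 < t" for t using rearr_nonneg[OF m that] False by linarith
      have "emeasure ?P X = emeasure M (space M)"
        using 1 by (auto simp: X emeasure_distr intro!: arg_cong[of _ _ "emeasure M"])
      moreover have "emeasure ?Q X = emeasure unit_measure (space unit_measure)"
        using 2 by (simp add: X emeasure_distr) (rule arg_cong[of _ _ "emeasure unit_measure"], auto)
      ultimately show ?thesis
        using emeasure_space_1 unit.emeasure_space_1 by simp
    qed
  qed (auto simp: P.emeasure_eq_measure)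
  then have "(\<integral>\<^sup>+y. \<Theta> y \<partial>?P) = (\<integral>\<^sup>+y. \<Theta> y \<partial>?Q)" by simp
  then show ?thesis by (simp add: nn_integral_distr)
qed

section \<open>Layer cakes and Hardy's lemma\<close>

lemma nn_integral_layer_cake:
  fixes k :: "'a \<Rightarrow> real" and g :: "'a \<Rightarrow> ennreal"
  assumes "sigma_finite_measure M"
    and [measurable]: "k \<in> borel_measurable M" "g \<in> borel_measurable M"
  shows "(\<integral>\<^sup>+x. ennreal (k x) * g x \<partial>M) =
    (\<integral>\<^sup>+l. (\<integral>\<^sup>+x. g x * indicator {x. 0 < l \<and> l < k x} x \<partial>M) \<partial>lborel)"
proof -
  interpret M: sigma_finite_measure M by fact
  interpret pair_sigma_finite M lborel by unfold_locales
  have "(\<integral>\<^sup>+x. ennreal (k x) * g x \<partial>M) =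
    (\<integral>\<^sup>+x. (\<integral>\<^sup>+l. g x * indicator {0<..<k x} l \<partial>lborel) \<partial>M)"
  proof (rule nn_integral_cong)
    fix x
    have "emeasure lborel {0<..<k x} = ennreal (k x)"
      by (cases "0 \<le> k x") (auto simp: ennreal_neg)
    then show "ennreal (k x) * g x = (\<integral>\<^sup>+l. g x * indicator {0<..<k x} l \<partial>lborel)"
      by (simp add: nn_integral_cmult_indicator mult.commute)
  qed
  also have "\<dots> = (\<integral>\<^sup>+x. (\<integral>\<^sup>+l. g x * indicator {x. 0 < l \<and> l < k x} x \<partial>lborel) \<partial>M)"
    by (intro nn_integral_cong) (auto simp: indicator_def)
  also have "\<dots> = (\<integral>\<^sup>+l. (\<integral>\<^sup>+x. g x * indicator {x. 0 < l \<and> l < k x} x \<partial>M) \<partial>lborel)"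
    by (rule Fubini'[symmetric]) measurable
  finally show ?thesis .
qed

lemma indicator_interval_unit_measurable [measurable]:
  "(indicator {a<..<b} :: real \<Rightarrow> ennreal) \<in> borel_measurable unit_measure"
  by (intro measurable_restrict_space1 borel_measurable_indicator) simp

lemma interval_unit_sets: "b \<le> 1 \<Longrightarrow> {0<..<b} \<in> sets unit_measure"
  by (auto simp: sets_restrict_space_iff)

lemma AE_unit_neq: "AE s in unit_measure. s \<noteq> c"
proof -
  have "AE s in lebesgue. s \<notin> {c}"
    by (intro AE_not_in null_sets_completionI) auto
  then show ?thesis by (subst AE_restrict_space_iff) auto
qed

text \<open>An initial segment of the unit interval is, up to its right end, an increasing union of
  countably many intervals \<open>(0,t)\<close> with \<open>t < 1\<close>.\<close>

lemma initial_segment_nn_integral_mono: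
  fixes f g :: "real \<Rightarrow> ennreal"
  assumes [measurable]: "f \<in> borel_measurable unit_measure" "g \<in> borel_measurable unit_measure"
    and le: "\<And>t. 0 < t \<Longrightarrow> t < 1 \<Longrightarrow>
      (\<integral>\<^sub>1s. f s * indicator {0<..<t} s) \<le> (\<integral>\<^sub>1s. g s * indicator {0<..<t} s)"
    and A: "A \<subseteq> {0<..<1}" "\<And>s t. t \<in> A \<Longrightarrow> 0 < s \<Longrightarrow> s \<le> t \<Longrightarrow> s \<in> A"
  shows "(\<integral>\<^sub>1s. f s * indicator A s) \<le> (\<integral>\<^sub>1s. g s * indicator A s)"
proof (cases "A = {}")
  case False
  define c where "c = Sup A"
  have bdd: "bdd_above A" using A(1) by (auto intro!: bdd_aboveI[of _ 1])
  have c: "0 < c" "c \<le> 1"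
  proof -
    obtain a where a: "a \<in> A" using False by auto
    then have "a \<le> c" unfolding c_def using bdd by (intro cSup_upper)
    then show "0 < c" using a A(1) by force
    show "c \<le> 1" unfolding c_def using False A(1) by (intro cSup_least) auto
  qed
  have Ac: "s \<in> A \<longleftrightarrow> 0 < s \<and> s < c" if "s \<noteq> c" for s
  proof
    assume s: "s \<in> A"
    then have "s \<le> c" unfolding c_def using bdd by (intro cSup_upper)
    then show "0 < s \<and> s < c" using that s A(1) by auto
  next
    assume s: "0 < s \<and> s < c"
    then obtain a where "a \<in> A" "s < a" unfolding c_def using False bdd by (auto simp: less_cSup_iff)
    then show "s \<in> A" using A(2)[of a s] s by auto
  qed
  \<comment> \<open>The factor \<open>1 - 1 / (n + 2)\<close> keeps the right ends positive and strictly below \<open>c\<close>, hence below 1.\<close>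
  have eq: "(\<integral>\<^sub>1s. h s * indicator A s) =
      (SUP n. \<integral>\<^sub>1s. h s * indicator {0<..<c * (1 - 1 / real (n + 2))} s)"
    if [measurable]: "h \<in> borel_measurable unit_measure" for h :: "real \<Rightarrow> ennreal"
  proof -
    let ?d = "\<lambda>n. c * (1 - 1 / real (n + 2))"
    have mono: "?d m \<le> ?d n" if "m \<le> n" for m n
      using that c by (intro mult_left_mono diff_left_mono divide_left_mono) auto
    have "(\<integral>\<^sub>1s. h s * indicator A s) = (\<integral>\<^sub>1s. (SUP n. h s * indicator {0<..<?d n} s))"
    proof (rule nn_integral_cong_AE, rule AE_mp[OF AE_unit_neq[of c]], intro AE_I2 impI)
      fix s assume "s \<noteq> c"
      have "indicator A s = (SUP n. indicator {0<..<?d n} s :: ennreal)"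
      proof (cases "s \<in> A")
        case True
        then have s: "0 < s" "s < c" using Ac \<open>s \<noteq> c\<close> by auto
        obtain n where n: "inverse (real (Suc n)) < (c - s) / c"
          using reals_Archimedean[of "(c - s) / c"] s c by auto
        have "1 / real (n + 2) \<le> inverse (real (Suc n))"
          by (simp add: inverse_eq_divide divide_left_mono)
        then have "c * (1 / real (n + 2)) \<le> c * inverse (real (Suc n))"
          using c by (intro mult_left_mono) auto
        also have "\<dots> < c - s" using n c by (simp add: pos_less_divide_eq mult.commute)
        finally have "s < ?d n" by (simp add: algebra_simps)
        then have "1 \<le> (SUP n. indicator {0<..<?d n} s :: ennreal)"
          using s by (intro SUP_upper2[of n]) auto
        moreover have "(SUP n. indicator {0<..<?d n} s :: ennreal) \<le> 1"
          by (intro SUP_least) (auto simp: indicator_def)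
        ultimately show ?thesis using True by (simp add: antisym)
      next
        case False
        have "?d n \<le> c" for n using c by (simp add: field_simps)
        moreover have "\<not> (0 < s \<and> s < c)" using False Ac \<open>s \<noteq> c\<close> by blast
        ultimately have "s \<notin> {0<..<?d n}" for n by (meson greaterThanLessThan_iff less_le_trans)
        then show ?thesis using False by simp
      qed
      then show "h s * indicator A s = (SUP n. h s * indicator {0<..<?d n} s)"
        by (simp add: SUP_mult_left_ennreal)
    qed
    also have "\<dots> = (SUP n. \<integral>\<^sub>1s. h s * indicator {0<..<?d n} s)"
    proof (rule nn_integral_monotone_convergence_SUP)
      show "incseq (\<lambda>n s. h s * indicator {0<..<?d n} s)"
        using mono by (auto simp: incseq_def le_fun_def intro!: mult_left_mono)
                      (auto simp: indicator_def dest: order.strict_trans2)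
    qed measurable
    finally show ?thesis .
  qed
  show ?thesis
    unfolding eq[OF assms(1)] eq[OF assms(2)]
  proof (intro SUP_mono' le)
    fix n
    show "0 < c * (1 - 1 / real (n + 2))" using c by simp
    have "c * (1 - 1 / real (n + 2)) < c * 1" using c by (intro mult_strict_left_mono) auto
    then show "c * (1 - 1 / real (n + 2)) < 1" using c by linarith
  qed
qed simp

text \<open>Hardy's lemma: domination of primitives survives multiplication by a decreasing function,
  whose level sets are initial segments.\<close>

lemma hardy_lemma:
  fixes f g :: "real \<Rightarrow> ennreal"
  assumes [measurable]: "f \<in> borel_measurable unit_measure" "g \<in> borel_measurable unit_measure"
    and le: "\<And>t. 0 < t \<Longrightarrow> t < 1 \<Longrightarrow>
      (\<integral>\<^sub>1s. f s * indicator {0<..<t} s) \<le> (\<integral>\<^sub>1s. g s * indicator {0<..<t} s)"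
    and k: "k \<in> dplus"
  shows "(\<integral>\<^sub>1s. ennreal (k s) * f s) \<le> (\<integral>\<^sub>1s. ennreal (k s) * g s)"
proof -
  have k_meas[measurable]: "k \<in> borel_measurable unit_measure" using dplus_mplus[OF k] by (auto simp: mplus_def)
  have *: "(\<integral>\<^sub>1x. h x * indicator {x. 0 < l \<and> l < k x} x) =
      (\<integral>\<^sub>1x. h x * indicator {x\<in>{0<..<1}. 0 < l \<and> l < k x} x)" for h and l :: real
    by (intro nn_integral_cong) (auto simp: indicator_def)
  have "(\<integral>\<^sub>1x. f x * indicator {x\<in>{0<..<1}. 0 < l \<and> l < k x} x) \<le>
      (\<integral>\<^sub>1x. g x * indicator {x\<in>{0<..<1}. 0 < l \<and> l < k x} x)" for l :: real
    by (rule initial_segment_nn_integral_mono[OF assms(1,2) le])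
       (auto dest: less_le_trans[OF _ dplus_antimono[OF k]])
  then have "(\<integral>\<^sup>+l. (\<integral>\<^sub>1x. f x * indicator {x. 0 < l \<and> l < k x} x) \<partial>lborel) \<le>
      (\<integral>\<^sup>+l. (\<integral>\<^sub>1x. g x * indicator {x. 0 < l \<and> l < k x} x) \<partial>lborel)"
    unfolding * by (rule nn_integral_mono)
  then show ?thesis
    unfolding nn_integral_layer_cake[OF unit.sigma_finite_measure_axioms k_meas assms(1), symmetric]
      nn_integral_layer_cake[OF unit.sigma_finite_measure_axioms k_meas assms(2), symmetric] .
qed

text \<open>By the layer cake formula it suffices to compare level sets: the part of one inside \<open>(0,t)\<close>
  has at most the measure of the interval \<open>(0,t)\<close> and that of the whole level set, and the level set
  of the rearrangement attains the smaller of the two.\<close>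

lemma nn_integral_initial_le_rearr:
  assumes f: "f \<in> mplus"
  shows "(\<integral>\<^sub>1s. ennreal (f s) * indicator {0<..<t} s) \<le>
    (\<integral>\<^sub>1s. ennreal (rearr unit_measure f s) * indicator {0<..<t} s)"
proof -
  note m = mplus_norm_measurable[OF f]
  note f_le = dplus_mplus[OF unit.rearr_dplus[OF m]]
  have [measurable]: "f \<in> borel_measurable unit_measure" "rearr unit_measure f \<in> borel_measurable unit_measure"
    using f f_le by (auto simp: mplus_def)
  have "(\<integral>\<^sub>1x. indicator {0<..<t} x * indicator {x. 0 < l \<and> l < f x} x) \<le>
     (\<integral>\<^sub>1x. indicator {0<..<t} x * indicator {x. 0 < l \<and> l < rearr unit_measure f x} x)"
    (is "?L \<le> ?R") for l :: real
  proof (cases "0 < l \<and> 0 < t")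
    case True
    let ?F = "{x\<in>space unit_measure. l < norm (f x)}" and ?m = "unit.prob {x\<in>space unit_measure. l < norm (f x)}"
    have F[measurable]: "?F \<in> sets unit_measure" using m by measurable
    have "?L = (\<integral>\<^sub>1x. indicator ({0<..<min 1 t} \<inter> ?F) x)"
      using f True by (intro nn_integral_cong) (auto simp: indicator_def mplus_def)
    also have "\<dots> = emeasure unit_measure ({0<..<min 1 t} \<inter> ?F)"
      by (intro nn_integral_indicator sets.Int F interval_unit_sets) simp
    also have "\<dots> \<le> emeasure unit_measure {0<..<min (min 1 t) ?m}"
    proof -
      have "emeasure unit_measure ({0<..<min 1 t} \<inter> ?F) \<le> emeasure unit_measure {0<..<min 1 t}"
        by (intro emeasure_mono interval_unit_sets) auto
      moreover have "emeasure unit_measure ({0<..<min 1 t} \<inter> ?F) \<le> emeasure unit_measure ?F"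
        using F by (intro emeasure_mono) auto
      moreover have "emeasure unit_measure {0<..<min 1 t} = ennreal (min 1 t)"
        using True by (intro emeasure_unit_interval) auto
      moreover have "emeasure unit_measure {0<..<min (min 1 t) ?m} = ennreal (min (min 1 t) ?m)"
        using True by (intro emeasure_unit_interval) auto
      moreover have "emeasure unit_measure ?F = ennreal ?m" by (rule unit.emeasure_eq_measure)
      ultimately show ?thesis by (cases "min 1 t \<le> ?m") (simp_all only: min_absorb1 min_absorb2 linear not_le less_imp_le)
    qed
    also have "\<dots> = (\<integral>\<^sub>1x. indicator {0<..<min (min 1 t) ?m} x)"
      by (intro nn_integral_indicator[symmetric] interval_unit_sets) simp
    also have "\<dots> \<le> ?R"
      using unit.less_rearr_iff[OF m, of _ l] True
      by (intro nn_integral_mono) (auto simp: indicator_def unit.emeasure_eq_measure ennreal_less_iff)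
    finally show ?thesis .
  next
    case False
    then show ?thesis by (cases "0 < l") simp_all
  qed
  then have "(\<integral>\<^sup>+l. (\<integral>\<^sub>1x. indicator {0<..<t} x * indicator {x. 0 < l \<and> l < f x} x) \<partial>lborel) \<le>
      (\<integral>\<^sup>+l. (\<integral>\<^sub>1x. indicator {0<..<t} x * indicator {x. 0 < l \<and> l < rearr unit_measure f x} x) \<partial>lborel)"
    by (rule nn_integral_mono)
  then show ?thesis
    by (subst (1 2) nn_integral_layer_cake) (simp_all add: unit.sigma_finite_measure_axioms)
qed

text \<open>The Hardy--Littlewood inequality when one factor is already decreasing: the primitive of
  \<open>f\<close> is largest for the decreasing arrangement, and Hardy's lemma applies.\<close>

lemma hardy_littlewood_decreasing:
  assumes f: "f \<in> mplus" and k: "k \<in> dplus"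
  shows "(\<integral>\<^sub>1s. ennreal (k s * f s)) \<le> (\<integral>\<^sub>1s. ennreal (k s * rearr unit_measure f s))"
proof -
  note f' = dplus_mplus[OF unit.rearr_dplus[OF mplus_norm_measurable[OF f]]]
  have "(\<integral>\<^sub>1s. ennreal (k s) * ennreal (f s)) \<le>
    (\<integral>\<^sub>1s. ennreal (k s) * ennreal (rearr unit_measure f s))"
    using f f' by (intro hardy_lemma k nn_integral_initial_le_rearr[OF f]) (auto simp: mplus_def)
  then show ?thesis
    by (subst (1 2) nn_integral_cong[OF ennreal_mult'[OF dplus_nonneg[OF k]]]) auto
qed

section \<open>The change of variables\<close>

lemma ell_ge_1: "0 < t \<Longrightarrow> t \<le> 1 \<Longrightarrow> 1 \<le> ell t"
  by (simp add: ell_def)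

lemma ell_antimono: "0 < s \<Longrightarrow> s \<le> t \<Longrightarrow> ell t \<le> ell s"
  by (simp add: ell_def)

text \<open>Half the primitive of \<^const>\<open>ell\<close>; the change of variables that \<open>\<sigma>\<close> encodes.\<close>

definition Phi :: "real \<Rightarrow> real" where "Phi y = y * (2 - ln y) / 2"

definition tau :: "real \<Rightarrow> real" where "tau = inv_into {0..1} Phi"

lemma Phi_0 [simp]: "Phi 0 = 0" and Phi_1 [simp]: "Phi 1 = 1"
  by (simp_all add: Phi_def)

lemma Phi_deriv: "0 < y \<Longrightarrow> (Phi has_real_derivative ell y / 2) (at y)"
  unfolding Phi_def ell_def by (auto intro!: derivative_eq_intros simp: field_simps)

lemma Phi_le: "0 < y \<Longrightarrow> y \<le> 1 \<Longrightarrow> Phi y \<le> y * ell y"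
  using mult_nonneg_nonpos[of y "ln y"] by (simp add: Phi_def ell_def field_simps)

lemma Phi_ge: "0 < y \<Longrightarrow> y \<le> 1 \<Longrightarrow> y \<le> Phi y"
  by (simp add: Phi_def algebra_simps mult_nonneg_nonpos)

lemma Phi_strict_mono: "0 \<le> x \<Longrightarrow> x < y \<Longrightarrow> y \<le> 1 \<Longrightarrow> Phi x < Phi y"
proof (cases "x = 0")
  case False
  assume *: "0 \<le> x" "x < y" "y \<le> 1"
  show ?thesis
  proof (rule DERIV_pos_imp_increasing[OF \<open>x < y\<close>])
    fix z assume "x \<le> z" "z \<le> y"
    then show "\<exists>d. (Phi has_real_derivative d) (at z) \<and> 0 < d"
      using * False Phi_deriv[of z] ell_ge_1[of z] by (intro exI[of _ "ell z / 2"]) auto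
  qed
qed (use Phi_ge[of y] in auto)

lemma Phi_less_iff: "0 \<le> x \<Longrightarrow> x \<le> 1 \<Longrightarrow> 0 \<le> y \<Longrightarrow> y \<le> 1 \<Longrightarrow> Phi x < Phi y \<longleftrightarrow> x < y"
  using Phi_strict_mono[of x y] Phi_strict_mono[of y x] by (cases x y rule: linorder_cases) auto

lemma Phi_le_iff: "0 \<le> x \<Longrightarrow> x \<le> 1 \<Longrightarrow> 0 \<le> y \<Longrightarrow> y \<le> 1 \<Longrightarrow> Phi x \<le> Phi y \<longleftrightarrow> x \<le> y"
  using Phi_less_iff[of y x] by (auto simp: not_less[symmetric])

lemma Phi_inj: "inj_on Phi {0..1}"
  by (rule inj_onI) (metis Phi_strict_mono atLeastAtMost_iff less_irrefl linorder_less_linear)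

text \<open>The inequality \<open>- ln y \<le> 2 / sqrt y - 2\<close> puts \<open>Phi\<close> below the square root.\<close>

lemma Phi_tendsto_0: "(Phi \<longlongrightarrow> 0) (at_right 0)"
proof -
  have upper: "Phi y \<le> sqrt y" if y: "0 < y" "y < 1" for y
  proof -
    have "ln (1 / sqrt y) \<le> 1 / sqrt y - 1" using y by (intro ln_le_minus_one) auto
    then have "2 - ln y \<le> 2 / sqrt y" using y by (simp add: ln_div ln_sqrt field_simps)
    then have "y * (2 - ln y) / 2 \<le> y * (2 / sqrt y) / 2" using y by (intro divide_right_mono mult_left_mono) auto
    also have "\<dots> = sqrt y" using y by (simp add: real_div_sqrt)
    finally show ?thesis by (simp add: Phi_def)
  qed
  have ev: "\<forall>\<^sub>F y in at_right 0. (0::real) < y \<and> y < 1"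
    using eventually_at_right_real[of "0::real" 1] by simp
  show ?thesis
  proof (rule tendsto_sandwich[of "\<lambda>_. 0" _ _ sqrt])
    show "\<forall>\<^sub>F y in at_right 0. 0 \<le> Phi y"
      using ev by eventually_elim (use Phi_ge in \<open>force\<close>)
    show "\<forall>\<^sub>F y in at_right 0. Phi y \<le> sqrt y"
      using ev by eventually_elim (use upper in auto)
    have "(sqrt \<longlongrightarrow> sqrt 0) (at_right 0)" by (intro tendsto_intros)
    then show "(sqrt \<longlongrightarrow> 0) (at_right 0)" by simp
  qed auto
qed

lemma Phi_continuous: "continuous_on {0..1} Phi"
  unfolding continuous_on_eq_continuous_within
proof
  fix x :: real assume x: "x \<in> {0..1}"
  show "continuous (at x within {0..1}) Phi"
  proof (cases "x = 0")
    case True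
    have "(Phi \<longlongrightarrow> 0) (at 0 within {0..1})"
      using Phi_tendsto_0 by (rule tendsto_mono[rotated]) (auto simp: at_within_Icc_at_right)
    then show ?thesis using True by (simp add: continuous_within)
  next
    case False
    then show ?thesis using x DERIV_isCont[OF Phi_deriv[of x]] by (auto intro: continuous_at_imp_continuous_within)
  qed
qed

lemma Phi_bij: "bij_betw Phi {0..1} {0..1}"
  unfolding bij_betw_def
proof (intro conjI Phi_inj equalityI subsetI)
  fix u :: real assume "u \<in> {0..1}"
  then show "u \<in> Phi ` {0..1}"
    using IVT'[of Phi 0 u 1] Phi_continuous by force
next
  fix u assume "u \<in> Phi ` {0..1}"
  then show "u \<in> {0..1}" using Phi_le_iff[of 0] Phi_le_iff[of _ 1] by auto
qed

lemma Phi_range: "0 < y \<Longrightarrow> y < 1 \<Longrightarrow> 0 < Phi y \<and> Phi y < 1"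
  using Phi_strict_mono[of 0 y] Phi_strict_mono[of y 1] by auto

lemma Phi_tau: "0 \<le> u \<Longrightarrow> u \<le> 1 \<Longrightarrow> Phi (tau u) = u"
  unfolding tau_def using Phi_bij by (simp add: bij_betw_inv_into_right)

lemma tau_Phi: "0 \<le> y \<Longrightarrow> y \<le> 1 \<Longrightarrow> tau (Phi y) = y"
  unfolding tau_def using Phi_inj by (simp add: inv_into_f_f)

lemma tau_range_closed: "0 \<le> u \<Longrightarrow> u \<le> 1 \<Longrightarrow> 0 \<le> tau u \<and> tau u \<le> 1"
  unfolding tau_def using Phi_bij inv_into_into[of u Phi "{0..1}"] by (auto simp: bij_betw_def)

lemma tau_range: "0 < u \<Longrightarrow> u < 1 \<Longrightarrow> 0 < tau u \<and> tau u < 1"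
  using tau_range_closed[of u] Phi_tau[of u] by (auto simp: less_le) 

lemma tau_less_iff: "0 \<le> u \<Longrightarrow> u \<le> 1 \<Longrightarrow> 0 \<le> v \<Longrightarrow> v \<le> 1 \<Longrightarrow> tau u < tau v \<longleftrightarrow> u < v"
  using Phi_less_iff[of "tau u" "tau v"] tau_range_closed[of u] tau_range_closed[of v] by (simp add: Phi_tau)

lemma tau_le_iff: "0 \<le> u \<Longrightarrow> u \<le> 1 \<Longrightarrow> 0 \<le> v \<Longrightarrow> v \<le> 1 \<Longrightarrow> tau u \<le> tau v \<longleftrightarrow> u \<le> v"
  using tau_less_iff[of v u] by (auto simp: not_less[symmetric])

lemma tau_measurable: "tau \<in> borel_measurable (restrict_space borel {0<..<1})"
  by (intro borel_measurable_mono_on_fnc mono_onI) (auto simp: tau_le_iff)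

lemma Phi_measurable [measurable]: "Phi \<in> borel_measurable borel"
  unfolding Phi_def by measurable

lemma nn_integral_unit_lborel:
  assumes "h \<in> borel_measurable (restrict_space borel {0<..<1})"
  shows "(\<integral>\<^sub>1t. h t) = (\<integral>\<^sup>+t. h t * indicator {0<..<1} t \<partial>lborel)"
proof -
  have "(\<lambda>t. h t * indicator {0<..<1} t) \<in> borel_measurable borel"
    using assms by (subst (asm) borel_measurable_restrict_space_iff_ennreal) auto
  then show ?thesis
    by (subst nn_integral_restrict_space) (auto simp: nn_integral_completion)
qed

text \<open>The derivative \<open>ell / 2\<close> of \<open>Phi\<close> is unbounded at the origin, so the substitution is made
  on intervals away from it, which then exhaust.\<close>

lemma nn_integral_Phi:
  fixes h :: "real \<Rightarrow> ennreal"
  assumes h: "h \<in> borel_measurable (restrict_space borel {0<..<1})" and t: "0 < t" "t \<le> 1"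
  shows "(\<integral>\<^sub>1s. h (Phi s) * ennreal (ell s) * indicator {0<..<t} s) =
    2 * (\<integral>\<^sub>1u. h u * indicator {0<..<Phi t} u)"
proof -
  define g where "g u = h u * indicator {0<..<1} u" for u
  have [measurable]: "g \<in> borel_measurable borel" unfolding g_def
    using h by (subst (asm) borel_measurable_restrict_space_iff_ennreal) auto
  have [measurable]: "ell \<in> borel_measurable borel" unfolding ell_def by measurable
  have Pt: "0 < Phi t" "Phi t \<le> 1" using Phi_strict_mono[of 0 t] Phi_le_iff[of t 1] t by simp_all
  define a where "a n = t / real (n + 2)" for n :: nat
  have a_bd: "0 < a n" "a n < t" for n
    using t mult_strict_left_mono[of 1 "real (n + 2)" t] by (auto simp: a_def pos_divide_less_eq)
  have decr: "a n \<le> a m" if "m \<le> n" for m n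
    unfolding a_def using that t by (intro divide_left_mono) auto
  have ex: "\<exists>n. a n \<le> s" if s: "0 < s" for s
  proof -
    obtain n where "inverse (real (Suc n)) < s / t" using reals_Archimedean[of "s / t"] s t by auto
    then have "t / real (Suc n) < s" using t by (simp add: field_simps)
    moreover have "a n \<le> t / real (Suc n)" unfolding a_def using t by (intro divide_left_mono) auto
    ultimately show ?thesis by (intro exI[of _ n]) simp
  qed
  have sub: "(\<integral>\<^sup>+x. g x * indicator {Phi (a n)..Phi t} x \<partial>lborel) =
      (\<integral>\<^sup>+x. g (Phi x) * ennreal (ell x / 2) * indicator {a n..t} x \<partial>lborel)" for n
  proof (rule nn_integral_substitution_aux)
    fix x assume "x \<in> {a n..t}"
    then have x: "0 < x" "x \<le> 1" using a_bd[of n] t by (auto intro: less_le_trans)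
    then show "(Phi has_real_derivative ell x / 2) (at x)" by (intro Phi_deriv)
    show "0 \<le> ell x / 2" using ell_ge_1[of x] x by simp
  next
    have "x \<noteq> 0" if "x \<in> {a n..t}" for x using that a_bd[of n] by auto
    then show "continuous_on {a n..t} (\<lambda>x. ell x / 2)"
      unfolding ell_def by (intro continuous_intros) auto
  qed (use a_bd in auto)
  have inc: "incseq (\<lambda>n. indicator {a n..t} s :: ennreal)" for s
    using decr by (auto simp: incseq_def indicator_def intro: order_trans)
  have inc': "incseq (\<lambda>n. indicator {Phi (a n)..Phi t} s :: ennreal)" for s
  proof -
    have "Phi (a n) \<le> Phi (a m)" if "m \<le> n" for m n
      using decr[OF that] a_bd[of m] a_bd[of n] t by (subst Phi_le_iff) linarith+
    then show ?thesis by (auto simp: incseq_def indicator_def intro: order_trans)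
  qed
  have sup: "(SUP n. indicator {a n..t} s :: ennreal) = indicator {0<..t} s" for s
  proof (cases "s \<in> {0<..t}")
    case True
    then obtain n where "a n \<le> s" using ex[of s] by auto
    then show ?thesis using True
      by (intro antisym SUP_least) (auto intro!: SUP_upper2[of n] simp: indicator_def)
  next
    case False
    then have "s \<notin> {a n..t}" for n using a_bd(1)[of n] by auto
    then show ?thesis using False by simp
  qed
  have sup': "(SUP n. indicator {Phi (a n)..Phi t} s :: ennreal) = indicator {0<..Phi t} s" for s
  proof (cases "s \<in> {0<..Phi t}")
    case True
    then have "tau s \<noteq> 0" using Phi_tau[of s] Pt by auto
    then have "0 < tau s" using tau_range_closed[of s] True Pt by auto
    then obtain n where "a n \<le> tau s" using ex by blast
    then have "Phi (a n) \<le> Phi (tau s)"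
      using tau_range_closed[of s] True Pt a_bd(1)[of n] by (subst Phi_le_iff) auto
    then have "Phi (a n) \<le> s" using Phi_tau[of s] True Pt by simp
    then show ?thesis using True
      by (intro antisym SUP_least) (auto intro!: SUP_upper2[of n] simp: indicator_def)
  next
    case False
    have "0 < Phi (a n)" for n using Phi_strict_mono[of 0 "a n"] a_bd[of n] t by auto
    then have "s \<notin> {Phi (a n)..Phi t}" for n using False by (auto dest: less_le_trans)
    then show ?thesis using False by simp
  qed
  have "(\<integral>\<^sub>1s. h (Phi s) * ennreal (ell s) * indicator {0<..<t} s) =
     (\<integral>\<^sub>1s. g (Phi s) * ennreal (ell s) * indicator {0<..<t} s)"
    using Phi_range by (intro nn_integral_cong) (auto simp: g_def indicator_def)
  also have "\<dots> = (\<integral>\<^sup>+s. g (Phi s) * ennreal (ell s) * indicator {0<..<t} s * indicator {0<..<1} s \<partial>lborel)"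
    by (intro nn_integral_unit_lborel measurable_restrict_space1) measurable
  also have "\<dots> = (\<integral>\<^sup>+s. 2 * (g (Phi s) * ennreal (ell s / 2) * indicator {0<..t} s) \<partial>lborel)"
  proof (rule nn_integral_cong_AE)
    have 2: "ennreal x = 2 * ennreal (x / 2)" if "0 \<le> x" for x :: real
      using that ennreal_mult'[of 2 "x / 2"] by simp
    have "AE s in lborel. s \<noteq> t" by (rule AE_lborel_singleton)
    then show "AE s in lborel. g (Phi s) * ennreal (ell s) * indicator {0<..<t} s * indicator {0<..<1} s =
        2 * (g (Phi s) * ennreal (ell s / 2) * indicator {0<..t} s)"
    proof eventually_elim
      case (elim s)
      show ?case
      proof (cases "0 < s \<and> s < t")
        case True
        then have "ennreal (ell s) = 2 * ennreal (ell s / 2)"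
          using t ell_ge_1[of s] by (intro 2) auto
        with True t show ?thesis by (simp add: mult_ac)
      qed (use elim in auto)
    qed
  qed
  also have "\<dots> = 2 * (\<integral>\<^sup>+s. g (Phi s) * ennreal (ell s / 2) * indicator {0<..t} s \<partial>lborel)"
    by (intro nn_integral_cmult) measurable
  also have "(\<integral>\<^sup>+s. g (Phi s) * ennreal (ell s / 2) * indicator {0<..t} s \<partial>lborel) =
      (\<integral>\<^sup>+s. (SUP n. g (Phi s) * ennreal (ell s / 2) * indicator {a n..t} s) \<partial>lborel)"
    by (simp add: sup flip: SUP_mult_left_ennreal)
  also have "\<dots> = (SUP n. \<integral>\<^sup>+s. g (Phi s) * ennreal (ell s / 2) * indicator {a n..t} s \<partial>lborel)"
    using inc by (intro nn_integral_monotone_convergence_SUP)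
      (auto simp: incseq_def le_fun_def intro!: mult_left_mono)
  also have "\<dots> = (SUP n. \<integral>\<^sup>+s. g s * indicator {Phi (a n)..Phi t} s \<partial>lborel)"
    by (simp add: sub)
  also have "\<dots> = (\<integral>\<^sup>+s. (SUP n. g s * indicator {Phi (a n)..Phi t} s) \<partial>lborel)"
    using inc' by (intro nn_integral_monotone_convergence_SUP[symmetric])
      (auto simp: incseq_def le_fun_def intro!: mult_left_mono)
  also have "\<dots> = (\<integral>\<^sup>+s. g s * indicator {0<..Phi t} s \<partial>lborel)"
    by (simp add: sup' flip: SUP_mult_left_ennreal)
  also have "\<dots> = (\<integral>\<^sup>+s. h s * indicator {0<..<Phi t} s * indicator {0<..<1} s \<partial>lborel)"
  proof (rule nn_integral_cong_AE)
    have "AE s in lborel. s \<noteq> Phi t" by (rule AE_lborel_singleton)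
    then show "AE s in lborel. g s * indicator {0<..Phi t} s =
        h s * indicator {0<..<Phi t} s * indicator {0<..<1} s"
      by eventually_elim (auto simp: g_def indicator_def)
  qed
  also have "\<dots> = (\<integral>\<^sub>1s. h s * indicator {0<..<Phi t} s)"
    using h by (intro nn_integral_unit_lborel[symmetric])
      (measurable, auto intro: measurable_restrict_space1)
  finally show ?thesis .
qed

lemma set_integral_ell:
  assumes f: "\<And>s. 0 < s \<Longrightarrow> s < 1 \<Longrightarrow> f s = ell s" and y: "0 \<le> y" "y \<le> 1"
  shows "(LINT s:{0<..<y}|lebesgue. f s) = 2 * Phi y"
proof (cases "y = 0")
  case False
  have [measurable]: "ell \<in> borel_measurable borel" unfolding ell_def by measurable
  have "(LINT s:{0<..<y}|lebesgue. f s) = (LINT s|lebesgue. indicator {0<..<y} s * ell s)"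
    unfolding set_lebesgue_integral_def using f y
    by (intro Bochner_Integration.integral_cong) (auto simp: indicator_def)
  also have "\<dots> = enn2real (\<integral>\<^sup>+s. ennreal (indicator {0<..<y} s * ell s) \<partial>lebesgue)"
  proof (rule integral_eq_nn_integral)
    show "(\<lambda>s. indicator {0<..<y} s * ell s) \<in> borel_measurable lebesgue"
      by (rule measurable_completion) measurable
    show "AE s in lebesgue. 0 \<le> indicator {0<..<y} s * ell s"
      using ell_ge_1 y by (intro AE_I2) (force simp: indicator_def)
  qed
  also have "(\<integral>\<^sup>+s. ennreal (indicator {0<..<y} s * ell s) \<partial>lebesgue) =
      (\<integral>\<^sup>+s. ennreal (indicator {0<..<y} s * ell s) \<partial>lborel)"
    by (intro nn_integral_completion) measurable
  also have "\<dots> = (\<integral>\<^sup>+s. ennreal (ell s) * indicator {0<..<y} s * indicator {0<..<1} s \<partial>lborel)"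
    using y by (intro nn_integral_cong) (auto simp: indicator_def)
  also have "\<dots> = (\<integral>\<^sub>1s. ennreal (ell s) * indicator {0<..<y} s)"
    by (intro nn_integral_unit_lborel[symmetric] measurable_restrict_space1) measurable
  also have "\<dots> = 2 * (\<integral>\<^sub>1u. indicator {0<..<Phi y} u)"
    using nn_integral_Phi[of "\<lambda>_. 1" y] False y by simp
  also have "(\<integral>\<^sub>1u. indicator {0<..<Phi y} u) = ennreal (Phi y)"
    using Phi_le_iff[of 0 y] Phi_le_iff[of y 1] y
    by (subst nn_integral_indicator) (simp_all add: interval_unit_sets emeasure_unit_interval)
  finally show ?thesis
    using Phi_le_iff[of 0 y] y by (simp add: enn2real_mult)
qed (simp add: set_lebesgue_integral_def)

text \<open>After the power substitution the equation for \<open>\<sigma>\<close> reads \<open>t powr p = Phi (\<sigma> t powr p)\<close>, the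
  normalizing constant being \<open>2 Phi 1 = 2\<close>; an increasing bijection satisfying it exists, and the
  equation determines its values.\<close>

lemma sigma_powr:
  assumes p: "0 < p" and b: "\<And>s. 0 < s \<Longrightarrow> s < 1 \<Longrightarrow> (b1 s / b2 s) powr p = ell s"
    and s: "0 < s" "s < 1"
  shows "sigma b1 b2 p (s powr (1 / p)) powr p = tau s"
    and "sigma_inv b1 b2 p (s powr (1 / p)) powr p = Phi s"
proof -
  have pp1: "(x powr p) powr (1 / p) = x" if "0 \<le> x" for x :: real
    using that p by (auto simp: powr_powr)
  have pp2: "(x powr (1 / p)) powr p = x" if "0 \<le> x" for x :: real
    using that p by (auto simp: powr_powr)
  note pp = pp1 pp2
  have I: "0 \<le> x powr q \<and> x powr q \<le> 1" if "0 \<le> x" "x \<le> 1" "0 < q" for x q :: real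
    using that powr_mono2[of q x 1] by simp
  have q: "0 < 1 / p" using p by simp
  have iff: "is_sigma b1 b2 p \<sigma> \<longleftrightarrow> strict_mono_on {0..1} \<sigma> \<and> bij_betw \<sigma> {0..1} {0..1} \<and>
      (\<forall>t\<in>{0..1}. t powr p = Phi (\<sigma> t powr p))" for \<sigma>
  proof -
    have "1 / (LINT s:{0<..<1}|lebesgue. (b1 s / b2 s) powr p) *
        (LINT s:{0<..<\<sigma> t powr p}|lebesgue. (b1 s / b2 s) powr p) = Phi (\<sigma> t powr p)"
      if "bij_betw \<sigma> {0..1} {0..1}" "t \<in> {0..1}" for t
    proof -
      have "\<sigma> t \<in> {0..1}" using that by (auto simp: bij_betw_def)
      then have "0 \<le> \<sigma> t powr p" "\<sigma> t powr p \<le> 1" using I[of "\<sigma> t" p] p by auto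
      then show ?thesis
        by (subst (1 2) set_integral_ell) (auto simp: b)
    qed
    then show ?thesis unfolding is_sigma_def by auto
  qed
  define \<sigma> where "\<sigma> = sigma b1 b2 p"
  have "is_sigma b1 b2 p (\<lambda>t. tau (t powr p) powr (1 / p))"
    unfolding iff
  proof (intro conjI ballI)
    show "strict_mono_on {0..1} (\<lambda>t. tau (t powr p) powr (1 / p))"
    proof (rule strict_mono_onI)
      fix r s :: real assume *: "r \<in> {0..1}" "s \<in> {0..1}" "r < s"
      then have "r powr p < s powr p" using p by (intro powr_less_mono2) auto
      then have "tau (r powr p) < tau (s powr p)" using * I[of r p] I[of s p] p by (subst tau_less_iff) auto
      then show "tau (r powr p) powr (1 / p) < tau (s powr p) powr (1 / p)"
        using * I[of r p] p tau_range_closed[of "r powr p"] by (intro powr_less_mono2) auto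
    qed
    show "bij_betw (\<lambda>t. tau (t powr p) powr (1 / p)) {0..1} {0..1}"
    proof (rule bij_betw_byWitness[where f'="\<lambda>u. Phi (u powr p) powr (1 / p)"])
      show "\<forall>a\<in>{0..1}. Phi ((tau (a powr p) powr (1 / p)) powr p) powr (1 / p) = a"
        using I[OF _ _ p] tau_range_closed by (auto simp: pp Phi_tau)
      show "\<forall>a'\<in>{0..1}. tau ((Phi (a' powr p) powr (1 / p)) powr p) powr (1 / p) = a'"
      proof
        fix a :: real assume a: "a \<in> {0..1}"
        then have "0 \<le> Phi (a powr p)" using I[of a p] p Phi_le_iff[of 0 "a powr p"] by auto
        then show "tau ((Phi (a powr p) powr (1 / p)) powr p) powr (1 / p) = a"
          using a I[of a p] p by (simp add: pp tau_Phi)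
      qed
      show "(\<lambda>t. tau (t powr p) powr (1 / p)) ` {0..1} \<subseteq> {0..1}"
        using I[OF _ _ p] tau_range_closed I[OF _ _ q] by fastforce
      show "(\<lambda>u. Phi (u powr p) powr (1 / p)) ` {0..1} \<subseteq> {0..1}"
      proof clarify
        fix a :: real assume a: "a \<in> {0..1}"
        then have "0 \<le> Phi (a powr p)" "Phi (a powr p) \<le> 1"
          using I[of a p] p Phi_le_iff[of 0 "a powr p"] Phi_le_iff[of "a powr p" 1] by auto
        then show "Phi (a powr p) powr (1 / p) \<in> {0..1}" using I[OF _ _ q] by auto
      qed
    qed
    show "t powr p = Phi ((tau (t powr p) powr (1 / p)) powr p)" if "t \<in> {0..1}" for t
      using that I[of t p] p tau_range_closed[of "t powr p"] by (simp add: pp Phi_tau)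
  qed
  then have "is_sigma b1 b2 p \<sigma>" unfolding \<sigma>_def sigma_def by (rule someI[where P="is_sigma b1 b2 p"])
  then have bij: "bij_betw \<sigma> {0..1} {0..1}" and "\<forall>t\<in>{0..1}. t powr p = Phi (\<sigma> t powr p)"
    unfolding iff by auto
  then have eq: "t powr p = Phi (\<sigma> t powr p)" if "t \<in> {0..1}" for t
    using that by blast
  have \<sigma>I: "\<sigma> t \<in> {0..1}" if "t \<in> {0..1}" for t using bij that by (auto simp: bij_betw_def)
  have s1: "s powr (1 / p) \<in> {0..1}" using I[of s "1 / p"] s q by auto
  have "\<sigma> (s powr (1 / p)) powr p = tau (Phi (\<sigma> (s powr (1 / p)) powr p))"
    using \<sigma>I[OF s1] I[of "\<sigma> (s powr (1 / p))" p] p by (subst tau_Phi) auto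
  also have "\<dots> = tau s" using eq[OF s1] s by (simp add: pp)
  finally show "sigma b1 b2 p (s powr (1 / p)) powr p = tau s" by (simp add: \<sigma>_def)
  have img: "s powr (1 / p) \<in> \<sigma> ` {0..1}" using bij s1 by (simp add: bij_betw_def)
  define r where "r = inv_into {0..1} \<sigma> (s powr (1 / p))"
  have "r \<in> {0..1}" "\<sigma> r = s powr (1 / p)"
    unfolding r_def using inv_into_into[OF img] f_inv_into_f[OF img] by auto
  then have "r powr p = Phi s" using eq[of r] s by (simp add: pp)
  then show "sigma_inv b1 b2 p (s powr (1 / p)) powr p = Phi s"
    by (simp add: sigma_inv_def r_def \<sigma>_def)
qed

section \<open>Separation by decreasing functions\<close>

lemma mplusI: "f \<in> borel_measurable unit_measure \<Longrightarrow> (\<And>t. 0 < t \<Longrightarrow> t < 1 \<Longrightarrow> 0 \<le> f t) \<Longrightarrow> f \<in> mplus"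
  by (auto simp: mplus_def)

lemma mplus_measurable: "f \<in> mplus \<Longrightarrow> f \<in> borel_measurable unit_measure"
  by (auto simp: mplus_def)

lemma mplus_nonneg: "f \<in> mplus \<Longrightarrow> 0 < t \<Longrightarrow> t < 1 \<Longrightarrow> 0 \<le> f t"
  by (auto simp: mplus_def)

lemma AE_unitI: "(\<And>t. 0 < t \<Longrightarrow> t < 1 \<Longrightarrow> P t) \<Longrightarrow> AE t in unit_measure. P t"
  by (intro AE_I2) auto

text \<open>Compositions with translations and iterated integrals ask for Borel measurability; a Borel version
  serves as well for every norm.\<close>

lemma mplus_borel_version:
  assumes f: "f \<in> mplus"
  obtains g where "g \<in> borel_measurable borel" "\<And>t. 0 \<le> g t" "AE t in unit_measure. f t = g t"
proof -
  have "(\<lambda>t. indicator {0<..<1} t *\<^sub>R f t) \<in> borel_measurable (completion lborel)"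
    using mplus_measurable[OF f] by (subst (asm) borel_measurable_restrict_space_iff) auto
  from completion_ex_borel_measurable_real[OF this] obtain g
    where g: "g \<in> borel_measurable lborel" "AE t in lborel. indicator {0<..<1} t *\<^sub>R f t = g t" by blast
  have "AE t in lebesgue. indicator {0<..<1} t *\<^sub>R f t = g t" using g(2) by (rule AE_completion)
  then have "AE t in unit_measure. indicator {0<..<1} t *\<^sub>R f t = g t"
    by (subst AE_restrict_space_iff) auto
  then have "AE t in unit_measure. f t = max 0 (g t)"
  proof (rule AE_mp, intro AE_unitI impI)
    fix t :: real assume "0 < t" "t < 1" "indicator {0<..<1} t *\<^sub>R f t = g t"
    then show "f t = max 0 (g t)" using mplus_nonneg[OF f, of t] by simp
  qed
  moreover have "(\<lambda>t. max 0 (g t)) \<in> borel_measurable borel" using g(1) by simp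
  ultimately show thesis by (intro that) auto
qed

locale ri_banach =
  fixes N :: "(real \<Rightarrow> real) \<Rightarrow> ennreal"
  assumes ri_banach: "ri_banach_function_norm N"
begin

lemma norm_mono: "f \<in> mplus \<Longrightarrow> g \<in> mplus \<Longrightarrow> AE t in unit_measure. f t \<le> g t \<Longrightarrow> N f \<le> N g"
  using ri_banach by (auto simp: ri_banach_function_norm_def fn_lattice_def)

lemma norm_cong:
  assumes "f \<in> mplus" "g \<in> mplus" "AE t in unit_measure. f t = g t"
  shows "N f = N g"
proof (rule antisym)
  show "N f \<le> N g" "N g \<le> N f"
    by (rule norm_mono; use assms in \<open>auto elim: eventually_mono\<close>)+
qed

lemma norm_scale: "f \<in> mplus \<Longrightarrow> 0 \<le> c \<Longrightarrow> N (\<lambda>t. c * f t) = ennreal c * N f"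
  using ri_banach by (auto simp: ri_banach_function_norm_def fn_positive_homogeneous_def)

lemma norm_zero_iff: "f \<in> mplus \<Longrightarrow> N f = 0 \<longleftrightarrow> (AE t in unit_measure. f t = 0)"
  using ri_banach by (auto simp: ri_banach_function_norm_def fn_positive_homogeneous_def)

lemma norm_add: "f \<in> mplus \<Longrightarrow> g \<in> mplus \<Longrightarrow> N (\<lambda>t. f t + g t) \<le> N f + N g"
  using ri_banach by (auto simp: ri_banach_function_norm_def)

lemma norm_one: "N (\<lambda>_. 1) < \<infinity>"
  using ri_banach by (auto simp: ri_banach_function_norm_def)

lemma norm_fatou:
  assumes "\<And>k. F k \<in> mplus" "f \<in> mplus"
    and "AE t in unit_measure. incseq (\<lambda>k. F k t) \<and> (\<lambda>k. F k t) \<longlonglongrightarrow> f t"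
  shows "(\<lambda>k. N (F k)) \<longlonglongrightarrow> N f"
  using ri_banach assms by (auto simp: ri_banach_function_norm_def fn_fatou_def)

lemma norm_L1: obtains C where "0 < C" "\<And>f. f \<in> mplus \<Longrightarrow> (\<integral>\<^sub>1t. ennreal (f t)) \<le> ennreal C * N f"
  using ri_banach by (auto simp: ri_banach_function_norm_def)

lemma norm_equimeasurable:
  assumes "f \<in> mplus" "g \<in> mplus" and eq: "rearr unit_measure f = rearr unit_measure g"
  shows "N f = N g"
proof -
  have "fn_rearrangement_invariant N" using ri_banach by (simp add: ri_banach_function_norm_def)
  then have "(\<forall>t\<in>{0<..<1}. rearr unit_measure f t = rearr unit_measure g t) \<longrightarrow> N f = N g"
    unfolding fn_rearrangement_invariant_def using assms(1,2) by blast
  then show ?thesis using eq by simp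
qed

lemma norm_rearr: "f \<in> mplus \<Longrightarrow> N (rearr unit_measure f) = N f"
  by (rule norm_equimeasurable)
     (simp_all add: unit.rearr_rearr[OF mplus_norm_measurable] dplus_mplus unit.rearr_dplus[OF mplus_norm_measurable])

lemma norm_convex:
  assumes f: "f \<in> mplus" and g: "g \<in> mplus" and le: "N f \<le> 1" "N g \<le> 1" and e: "0 \<le> e" "e \<le> 1"
  shows "(\<lambda>t. (1 - e) * f t + e * g t) \<in> mplus" "N (\<lambda>t. (1 - e) * f t + e * g t) \<le> 1"
proof -
  note [measurable] = mplus_measurable[OF f] mplus_measurable[OF g]
  have 1: "(\<lambda>t. (1 - e) * f t) \<in> mplus" "(\<lambda>t. e * g t) \<in> mplus"
    using mplus_nonneg[OF f] mplus_nonneg[OF g] e by (auto intro!: mplusI)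
  show "(\<lambda>t. (1 - e) * f t + e * g t) \<in> mplus"
    using mplus_nonneg[OF f] mplus_nonneg[OF g] e by (auto intro!: mplusI)
  have "N (\<lambda>t. (1 - e) * f t + e * g t) \<le> ennreal (1 - e) * N f + ennreal e * N g"
    using norm_add[OF 1] norm_scale[OF f, of "1 - e"] norm_scale[OF g, of e] e by simp
  also have "\<dots> \<le> ennreal (1 - e) * 1 + ennreal e * 1"
    using le by (intro add_mono mult_left_mono) auto
  also have "\<dots> = 1" using e by (simp flip: ennreal_plus)
  finally show "N (\<lambda>t. (1 - e) * f t + e * g t) \<le> 1" .
qed

text \<open>The unit ball is closed under almost everywhere limits: apply the Fatou property to the
  infima of the tails.\<close>

lemma unit_ball_limit:
  assumes y: "\<And>n. y n \<in> mplus" "\<And>n. N (y n) \<le> 1" and z: "z \<in> mplus"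
    and lim: "AE t in unit_measure. (\<lambda>n. y n t) \<longlonglongrightarrow> z t"
  shows "N z \<le> 1"
proof -
  define w where "w k t = (INF n\<in>{k..}. y n t)" for k t
  note [measurable] = mplus_measurable[OF y(1)]
  have bdd: "bdd_below ((\<lambda>n. y n t) ` A)" if "0 < t" "t < 1" for t A
    using mplus_nonneg[OF y(1) that] by (intro bdd_belowI[of _ 0]) auto
  have w: "w k \<in> mplus" for k
  proof (rule mplusI)
    show "w k \<in> borel_measurable unit_measure" unfolding w_def by measurable
    show "0 \<le> w k t" if "0 < t" "t < 1" for t
      unfolding w_def using mplus_nonneg[OF y(1) that] by (intro cINF_greatest) auto
  qed
  have wy: "w k t \<le> y n t" if "k \<le> n" "0 < t" "t < 1" for k n t
    unfolding w_def using that bdd by (intro cINF_lower) auto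
  have "AE t in unit_measure. incseq (\<lambda>k. w k t) \<and> (\<lambda>k. w k t) \<longlonglongrightarrow> z t"
    using lim
  proof (rule AE_mp, intro AE_unitI impI conjI)
    fix t :: real assume t: "0 < t" "t < 1" and l: "(\<lambda>n. y n t) \<longlonglongrightarrow> z t"
    show "incseq (\<lambda>k. w k t)" unfolding w_def
      by (intro incseq_SucI cINF_superset_mono bdd t) auto
    show "(\<lambda>k. w k t) \<longlonglongrightarrow> z t"
    proof (rule order_tendstoI)
      fix a assume "a < z t"
      then obtain b where b: "a < b" "b < z t" using dense by blast
      obtain k where k: "\<And>n. k \<le> n \<Longrightarrow> b < y n t"
        using order_tendstoD(1)[OF l b(2)] by (auto simp: eventually_sequentially)
      have "b \<le> w j t" if "k \<le> j" for j
        unfolding w_def using k that by (intro cINF_greatest) (auto intro: less_imp_le)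
      then show "\<forall>\<^sub>F k in sequentially. a < w k t"
        using b by (intro eventually_sequentiallyI[of k]) (auto intro: less_le_trans)
    next
      fix a assume "z t < a"
      with l have "\<forall>\<^sub>F k in sequentially. y k t < a" by (rule order_tendstoD)
      then show "\<forall>\<^sub>F k in sequentially. w k t < a"
        by eventually_elim (use wy[OF order_refl t] le_less_trans in blast)
    qed
  qed
  then have "(\<lambda>k. N (w k)) \<longlonglongrightarrow> N z" by (intro norm_fatou w z)
  moreover have "N (w k) \<le> 1" for k
    using norm_mono[OF w y(1)[of k] AE_unitI[OF wy[OF order_refl]]] y(2)[of k] by auto
  ultimately show ?thesis by (intro LIMSEQ_le_const2) auto
qed

text \<open>By the parallelogram law a minimizing sequence is Cauchy in the mean square, hence in the mean,
  so that a subsequence converges almost everywhere; the limit stays in the unit ball. Only minorants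
  of \<open>x\<close> compete, which keeps all functions bounded and the residual nonnegative.\<close>

lemma projection_exists:
  assumes x: "x \<in> mplus" and x_borel: "x \<in> borel_measurable borel"
    and B: "\<And>t. 0 < t \<Longrightarrow> t < 1 \<Longrightarrow> x t \<le> B"
  obtains z where "z \<in> borel_measurable borel" "\<And>t. 0 < t \<Longrightarrow> t < 1 \<Longrightarrow> 0 \<le> z t \<and> z t \<le> x t" "N z \<le> 1"
    "\<And>y. y \<in> mplus \<Longrightarrow> N y \<le> 1 \<Longrightarrow> (\<And>t. 0 < t \<Longrightarrow> t < 1 \<Longrightarrow> y t \<le> x t) \<Longrightarrow>
      (LINT t|unit_measure. (x t - z t)\<^sup>2) \<le> (LINT t|unit_measure. (x t - y t)\<^sup>2)"
proof -
  define K where "K = {y\<in>mplus. N y \<le> 1 \<and> (\<forall>t. 0 < t \<and> t < 1 \<longrightarrow> y t \<le> x t)}"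
  define J where "J y = (LINT t|unit_measure. (x t - y t)\<^sup>2)" for y :: "real \<Rightarrow> real"
  note [measurable] = mplus_measurable[OF x]
  have Km: "y \<in> borel_measurable unit_measure" if "y \<in> K" for y using that by (auto simp: K_def mplus_def)
  have Kb: "0 \<le> y t" "y t \<le> x t" "y t \<le> B" if "y \<in> K" "0 < t" "t < 1" for y t
    using that B[of t] mplus_nonneg[of y t] by (force simp: K_def)+
  have diff: "\<bar>f t - g t\<bar> \<le> B" if "0 \<le> f t" "f t \<le> B" "0 \<le> g t" "g t \<le> B" for f g :: "real \<Rightarrow> real" and t
    using that by auto
  have int: "integrable unit_measure (\<lambda>t. (f t - g t)\<^sup>2)" "integrable unit_measure (\<lambda>t. \<bar>f t - g t\<bar>)"
      "integrable unit_measure (\<lambda>t. f t - g t)"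
    if [measurable]: "f \<in> borel_measurable unit_measure" "g \<in> borel_measurable unit_measure"
      and b: "\<And>t. 0 < t \<Longrightarrow> t < 1 \<Longrightarrow> 0 \<le> f t \<and> f t \<le> B \<and> 0 \<le> g t \<and> g t \<le> B" for f g :: "real \<Rightarrow> real"
  proof -
    have *: "\<bar>f t - g t\<bar> \<le> B" if "0 < t" "t < 1" for t using b[OF that] by (intro diff) auto
    have "norm ((f t - g t)\<^sup>2) \<le> B\<^sup>2" if "0 < t" "t < 1" for t
      using power_mono[OF *[OF that], of 2] by simp
    then show "integrable unit_measure (\<lambda>t. (f t - g t)\<^sup>2)"
      by (intro unit.integrable_const_bound[where B="B\<^sup>2"] AE_unitI) auto
    show "integrable unit_measure (\<lambda>t. \<bar>f t - g t\<bar>)" "integrable unit_measure (\<lambda>t. f t - g t)"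
      using * by (auto intro!: unit.integrable_const_bound[where B=B] AE_unitI)
  qed
  have x0B: "0 \<le> x t" "x t \<le> B" if "0 < t" "t < 1" for t
    using mplus_nonneg[OF x that] B[OF that] by auto
  have xint: "integrable unit_measure (\<lambda>t. (x t - y t)\<^sup>2)" if "y \<in> K" for y
    using Kb[OF that] x0B by (intro int(1)[OF mplus_measurable[OF x] Km[OF that]]) auto
  have "(\<lambda>_. 0) \<in> K"
    using norm_zero_iff[of "\<lambda>_. 0"] mplus_nonneg[OF x] by (auto simp: K_def mplus_def)
  then have ne: "J ` K \<noteq> {}" by auto
  have J0: "0 \<le> J y" for y unfolding J_def by (intro integral_nonneg_AE) auto
  then have bdd: "bdd_below (J ` K)" by (intro bdd_belowI[of _ 0]) auto
  define m where "m = Inf (J ` K)"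
  have mJ: "m \<le> J y" if "y \<in> K" for y unfolding m_def using that bdd by (intro cInf_lower) auto
  have "\<exists>y\<in>K. J y < m + 1 / real (Suc n)" for n
    using cInf_lessD[OF ne, of "m + 1 / real (Suc n)"] by (auto simp: m_def)
  then obtain y where yK: "\<And>n. y n \<in> K" and yJ: "\<And>n. J (y n) < m + 1 / real (Suc n)" by metis
  note [measurable] = Km[OF yK]
  have para: "(LINT t|unit_measure. (y i t - y j t)\<^sup>2) \<le> 2 / real (Suc i) + 2 / real (Suc j)" for i j
  proof -
    let ?h = "\<lambda>t. (1 - 1 / 2) * y i t + 1 / 2 * y j t"
    have h: "?h \<in> K"
    proof -
      have "y i \<in> mplus" "y j \<in> mplus" "N (y i) \<le> 1" "N (y j) \<le> 1" using yK by (auto simp: K_def)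
      from norm_convex[OF this, of "1 / 2"] have "?h \<in> mplus" "N ?h \<le> 1" by auto
      moreover have "?h t \<le> x t" if "0 < t" "t < 1" for t using Kb[OF yK that, of i] Kb[OF yK that, of j] by auto
      ultimately show ?thesis by (auto simp: K_def)
    qed
    note [measurable] = Km[OF h]
    have "(LINT t|unit_measure. (y i t - y j t)\<^sup>2) =
        (LINT t|unit_measure. 2 * (x t - y i t)\<^sup>2 + 2 * (x t - y j t)\<^sup>2 - 4 * (x t - ?h t)\<^sup>2)"
      by (intro Bochner_Integration.integral_cong) (auto simp: power2_eq_square algebra_simps)
    also have "\<dots> = 2 * J (y i) + 2 * J (y j) - 4 * J ?h"
      unfolding J_def using xint[OF yK[of i]] xint[OF yK[of j]] xint[OF h] by simp
    also have "\<dots> \<le> 2 / real (Suc i) + 2 / real (Suc j)"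
    proof -
      have "2 / real (Suc n) = 2 * (1 / real (Suc n))" for n by (simp del: of_nat_Suc)
      then show ?thesis using yJ[of i] yJ[of j] mJ[OF h] by linarith
    qed
    finally show ?thesis .
  qed
  obtain r where r: "strict_mono r" "AE t in unit_measure. Cauchy (\<lambda>i. y (r i) t)"
  proof (rule cauchy_L1_AE_cauchy_subseq[of unit_measure y])
    fix n
    have "norm (y n t) \<le> B" if "0 < t" "t < 1" for t using Kb[OF yK that, of n] by auto
    then show "integrable unit_measure (y n)"
      by (intro unit.integrable_const_bound[where B=B] AE_unitI) auto
  next
    fix e :: real assume e: "0 < e"
    obtain M where M: "inverse (real (Suc M)) < (e / 2)\<^sup>2 / 4" using reals_Archimedean[of "(e / 2)\<^sup>2 / 4"] e by auto
    have "(LINT t|unit_measure. norm (y i t - y j t)) < e" if ij: "M \<le> i" "M \<le> j" for i j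
    proof -
      have "1 / real (Suc i) \<le> inverse (real (Suc M))" "1 / real (Suc j) \<le> inverse (real (Suc M))"
        using ij by (auto simp: inverse_eq_divide intro!: divide_left_mono)
      then have D: "(LINT t|unit_measure. (y i t - y j t)\<^sup>2) \<le> (e / 2)\<^sup>2"
        using para[of i j] M by linarith
      \<comment> \<open>The inequality of the means, in place of the Cauchy--Schwarz inequality.\<close>
      have am: "norm d \<le> e / 4 + d\<^sup>2 / e" for d :: real
      proof -
        have "0 \<le> (\<bar>d\<bar> - e / 2)\<^sup>2" by simp
        then have "e * \<bar>d\<bar> \<le> d\<^sup>2 + e\<^sup>2 / 4" by (simp add: power2_eq_square algebra_simps abs_mult_self)
        then show ?thesis using e by (simp add: field_simps power2_eq_square)
      qed
      have b: "integrable unit_measure (\<lambda>t. (y i t - y j t)\<^sup>2)" "integrable unit_measure (\<lambda>t. \<bar>y i t - y j t\<bar>)"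
        using Kb[OF yK] by (auto intro!: int[OF Km[OF yK[of i]] Km[OF yK[of j]]])
      have "(LINT t|unit_measure. norm (y i t - y j t)) \<le> (LINT t|unit_measure. e / 4 + (y i t - y j t)\<^sup>2 / e)"
        using b by (intro integral_mono am) simp_all
      also have "\<dots> = e / 4 + (LINT t|unit_measure. (y i t - y j t)\<^sup>2) / e"
        using b(1) unit.prob_space by simp
      also have "\<dots> \<le> e / 4 + (e / 2)\<^sup>2 / e" using D e by (intro add_left_mono divide_right_mono) auto
      also have "\<dots> < e" using e by (simp add: power2_eq_square field_simps)
      finally show ?thesis .
    qed
    then show "\<exists>N. \<forall>i\<ge>N. \<forall>j\<ge>N. (LINT t|unit_measure. norm (y i t - y j t)) < e" by blast
  qed
  define u where "u t = max 0 (min (x t) (lim (\<lambda>i. y (r i) t)))" for t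
  have lim: "AE t in unit_measure. (\<lambda>i. y (r i) t) \<longlonglongrightarrow> u t"
    using r(2)
  proof (rule AE_mp, intro AE_unitI impI)
    fix t :: real assume t: "0 < t" "t < 1" and "Cauchy (\<lambda>i. y (r i) t)"
    then have l: "(\<lambda>i. y (r i) t) \<longlonglongrightarrow> lim (\<lambda>i. y (r i) t)"
      by (simp add: Cauchy_convergent_iff convergent_LIMSEQ_iff)
    have "0 \<le> lim (\<lambda>i. y (r i) t)" "lim (\<lambda>i. y (r i) t) \<le> x t"
      using Kb[OF yK t] by (auto intro: LIMSEQ_le_const[OF l] LIMSEQ_le_const2[OF l])
    then show "(\<lambda>i. y (r i) t) \<longlonglongrightarrow> u t" using l by (simp add: u_def)
  qed
  have "u \<in> borel_measurable unit_measure" unfolding u_def by measurable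
  then have u: "u \<in> mplus" by (rule mplusI) (simp add: u_def)
  have Nu: "N u \<le> 1"
    using yK by (intro unit_ball_limit[OF _ _ u lim]) (auto simp: K_def)
  obtain g where g: "g \<in> borel_measurable borel" "\<And>t. 0 \<le> g t" "AE t in unit_measure. u t = g t"
    using mplus_borel_version[OF u] by blast
  define z where "z t = min (x t) (g t)" for t
  have zb[measurable]: "z \<in> borel_measurable borel" unfolding z_def using g(1) x_borel by simp
  have z0: "0 \<le> z t \<and> z t \<le> x t" if "0 < t" "t < 1" for t using g(2)[of t] x0B[OF that] by (auto simp: z_def)
  have zm[measurable]: "z \<in> borel_measurable unit_measure" by (intro borel_unit_measurable measurable_restrict_space1 zb)
  then have z: "z \<in> mplus" using z0 by (intro mplusI) auto
  have zu: "AE t in unit_measure. z t = u t"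
    using g(3) by (rule AE_mp, intro AE_unitI) (auto simp: z_def u_def dest: x0B)
  have "N z \<le> 1" using norm_cong[OF z u zu] Nu by simp
  have "(\<lambda>i. J (y (r i))) \<longlonglongrightarrow> J z"
    unfolding J_def
  proof (rule integral_dominated_convergence[where w="\<lambda>_. B\<^sup>2"])
    show "AE t in unit_measure. (\<lambda>i. (x t - y (r i) t)\<^sup>2) \<longlonglongrightarrow> (x t - z t)\<^sup>2"
      using lim zu by eventually_elim (auto intro!: tendsto_intros)
    fix i show "AE t in unit_measure. norm ((x t - y (r i) t)\<^sup>2) \<le> B\<^sup>2"
    proof (rule AE_unitI)
      fix t :: real assume t: "0 < t" "t < 1"
      have "\<bar>x t - y (r i) t\<bar> \<le> B" using Kb[OF yK t, of "r i"] x0B[OF t] by auto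
      from power_mono[OF this, of 2] show "norm ((x t - y (r i) t)\<^sup>2) \<le> B\<^sup>2" by simp
    qed
  qed auto
  moreover have "(\<lambda>i. m + 1 / real (Suc (r i))) \<longlonglongrightarrow> m + 0"
    by (intro tendsto_intros LIMSEQ_subseq_LIMSEQ[OF lim_1_over_n[THEN LIMSEQ_Suc] r(1), unfolded o_def])
  ultimately have "J z \<le> m + 0" using yJ by (intro LIMSEQ_le) (auto intro!: exI[of _ 0] less_imp_le)
  then have "J z \<le> J y" if "y \<in> K" for y using mJ[OF that] by simp
  then show thesis using zb z0 \<open>N z \<le> 1\<close> by (intro that[of z]) (auto simp: K_def J_def)
qed

end

definition swap_shift :: "real set \<Rightarrow> real \<Rightarrow> real \<Rightarrow> real" where
  "swap_shift E h t = (if t \<in> E then t + h else if t - h \<in> E then t - h else t)"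

text \<open>The line splits into \<open>E\<close>, its translate by \<open>h\<close>, and the rest; translating back, the first
  two are integrated together over \<open>E\<close>.\<close>

lemma nn_integral_swap_decomp:
  fixes H :: "real \<Rightarrow> ennreal"
  assumes [measurable]: "H \<in> borel_measurable borel" "E \<in> sets borel" and E: "\<And>t. t \<in> E \<Longrightarrow> t - h \<notin> E"
  shows "(\<integral>\<^sup>+t. H t \<partial>lborel) = (\<integral>\<^sup>+t. H t * indicator {t. t \<notin> E \<and> t - h \<notin> E} t \<partial>lborel) +
    (\<integral>\<^sup>+t. (H t + H (t + h)) * indicator E t \<partial>lborel)"
proof -
  have [measurable]: "{t. t - h \<in> E} \<in> sets borel" "{t. t \<notin> E \<and> t - h \<notin> E} \<in> sets borel"
    by measurable
  have "(\<integral>\<^sup>+t. H t \<partial>lborel) =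
      (\<integral>\<^sup>+t. H t * indicator {t. t \<notin> E \<and> t - h \<notin> E} t + (H t * indicator E t + H t * indicator {t. t - h \<in> E} t) \<partial>lborel)"
    using E by (intro nn_integral_cong) (auto simp: indicator_def)
  also have "\<dots> = (\<integral>\<^sup>+t. H t * indicator {t. t \<notin> E \<and> t - h \<notin> E} t \<partial>lborel) +
      ((\<integral>\<^sup>+t. H t * indicator E t \<partial>lborel) + (\<integral>\<^sup>+t. H t * indicator {t. t - h \<in> E} t \<partial>lborel))"
    by (simp add: nn_integral_add)
  also have "(\<integral>\<^sup>+t. H t * indicator {t. t - h \<in> E} t \<partial>lborel) = (\<integral>\<^sup>+t. H (h + 1 * t) * indicator {t. t - h \<in> E} (h + 1 * t) \<partial>lborel)"
    by (subst nn_integral_real_affine[where c=1 and t=h]) simp_all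
  also have "\<dots> = (\<integral>\<^sup>+t. H (t + h) * indicator E t \<partial>lborel)"
    by (intro nn_integral_cong) (auto simp: indicator_def add.commute)
  also have "(\<integral>\<^sup>+t. H t * indicator E t \<partial>lborel) + \<dots> = (\<integral>\<^sup>+t. (H t + H (t + h)) * indicator E t \<partial>lborel)"
    by (simp add: nn_integral_add distrib_right)
  finally show ?thesis .
qed

lemma swap_shift_measurable [measurable]:
  assumes [measurable]: "E \<in> sets borel"
  shows "swap_shift E h \<in> borel_measurable borel"
proof -
  have [measurable]: "{t. t - h \<in> E} \<in> sets borel" by measurable
  show ?thesis unfolding swap_shift_def by measurable
qed

lemma swap_shift_simps:
  assumes "\<And>t. t \<in> E \<Longrightarrow> t - h \<notin> E"
  shows "t \<in> E \<Longrightarrow> swap_shift E h t = t + h" "t \<in> E \<Longrightarrow> swap_shift E h (t + h) = t"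
    "t \<notin> E \<Longrightarrow> t - h \<notin> E \<Longrightarrow> swap_shift E h t = t"
  using assms[of "t + h"] by (auto simp: swap_shift_def)

lemma nn_integral_swap_shift:
  fixes H :: "real \<Rightarrow> ennreal"
  assumes [measurable]: "H \<in> borel_measurable borel" "E \<in> sets borel" and E: "\<And>t. t \<in> E \<Longrightarrow> t - h \<notin> E"
  shows "(\<integral>\<^sup>+t. H (swap_shift E h t) \<partial>lborel) = (\<integral>\<^sup>+t. H t \<partial>lborel)"
proof -
  have "(\<integral>\<^sup>+t. H (swap_shift E h t) * indicator {t. t \<notin> E \<and> t - h \<notin> E} t \<partial>lborel) =
      (\<integral>\<^sup>+t. H t * indicator {t. t \<notin> E \<and> t - h \<notin> E} t \<partial>lborel)"
    by (intro nn_integral_cong) (auto simp: swap_shift_simps[OF E] indicator_def)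
  moreover have "(\<integral>\<^sup>+t. (H (swap_shift E h t) + H (swap_shift E h (t + h))) * indicator E t \<partial>lborel) =
      (\<integral>\<^sup>+t. (H t + H (t + h)) * indicator E t \<partial>lborel)"
    by (intro nn_integral_cong) (auto simp: swap_shift_simps[OF E] indicator_def add.commute)
  ultimately show ?thesis
    by (subst (1 2) nn_integral_swap_decomp[OF _ _ E]) simp_all
qed

text \<open>The exchange of \<open>E\<close> with its translate preserves measure, so it does not change the norm of
  any function in a rearrangement-invariant space.\<close>

lemma rearr_swap_shift:
  fixes z :: "real \<Rightarrow> real"
  assumes z[measurable]: "z \<in> borel_measurable borel" and [measurable]: "E \<in> sets borel"
    and E: "\<And>t. t \<in> E \<Longrightarrow> t - h \<notin> E" and E01: "\<And>t. t \<in> E \<Longrightarrow> 0 < t \<and> t + h < 1" and h: "0 < h"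
  shows "rearr unit_measure (\<lambda>t. z (swap_shift E h t)) = rearr unit_measure z"
proof (rule rearr_cong_distr)
  fix s :: real
  have 01: "swap_shift E h t \<in> {0<..<1} \<longleftrightarrow> t \<in> {0<..<1}" for t
    using E01[of t] E01[of "t - h"] h by (auto simp: swap_shift_def)
  let ?H = "\<lambda>t. indicator {t. 0 < t \<and> t < 1 \<and> s < \<bar>z t\<bar>} t :: ennreal"
  have unit: "emeasure unit_measure {t\<in>space unit_measure. s < norm (f t)} = (\<integral>\<^sup>+t. indicator {t. 0 < t \<and> t < 1 \<and> s < \<bar>f t\<bar>} t \<partial>lborel)"
    if [measurable]: "f \<in> borel_measurable borel" for f :: "real \<Rightarrow> real"
  proof -
    have A: "{t. 0 < t \<and> t < 1 \<and> s < \<bar>f t\<bar>} \<in> sets borel" by measurable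
    have "emeasure unit_measure {t\<in>space unit_measure. s < norm (f t)} = emeasure lebesgue {t. 0 < t \<and> t < 1 \<and> s < \<bar>f t\<bar>}"
      by (subst emeasure_restrict_space) auto
    also have "\<dots> = emeasure lborel {t. 0 < t \<and> t < 1 \<and> s < \<bar>f t\<bar>}" using A by simp
    finally show ?thesis using A by simp
  qed
  have "(\<integral>\<^sup>+t. indicator {t. 0 < t \<and> t < 1 \<and> s < \<bar>z (swap_shift E h t)\<bar>} t \<partial>lborel) = (\<integral>\<^sup>+t. ?H (swap_shift E h t) \<partial>lborel)"
    using 01 by (intro nn_integral_cong) (auto simp: indicator_def)
  also have "\<dots> = (\<integral>\<^sup>+t. ?H t \<partial>lborel)"
    by (intro nn_integral_swap_shift E) auto
  finally show "emeasure unit_measure {t\<in>space unit_measure. s < norm (z (swap_shift E h t))} =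
      emeasure unit_measure {t\<in>space unit_measure. s < norm (z t)}"
    by (subst (1 2) unit) simp_all
qed

text \<open>By Fubini's theorem almost every point is correctly ordered with respect to almost every other
  point. Two points with this property are ordered correctly with respect to each other, as a third
  one can be found between them.\<close>

lemma AE_decreasing_version:
  assumes k[measurable]: "k \<in> borel_measurable borel"
    and b: "\<And>t. 0 < t \<Longrightarrow> t < 1 \<Longrightarrow> 0 \<le> k t \<and> k t \<le> B"
    and shift: "\<And>h. 0 < h \<Longrightarrow> AE s in lborel. 0 < s \<and> s + h < 1 \<longrightarrow> k (s + h) \<le> k s"
  obtains k' where "k' \<in> dplus" "AE t in unit_measure. k' t = k t"
proof -
  let ?P = "\<lambda>s t. 0 < s \<and> s < t \<and> t < 1 \<longrightarrow> k t \<le> k s"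
  have "AE h in lborel. AE s in lborel. ?P s (s + h)"
  proof (rule AE_I2)
    fix h :: real show "AE s in lborel. ?P s (s + h)"
      using shift[of h] by (cases "0 < h") (auto elim: eventually_mono)
  qed
  then have "AE s in lborel. AE h in lborel. ?P s (s + h)"
    by (subst lborel_pair.AE_commute) measurable
  then have 1: "AE s in lborel. AE t in lborel. ?P s t"
  proof eventually_elim
    case (elim s)
    have "AE t in lborel. ?P s (s + (- s + 1 * t))"
      by (rule AE_borel_affine[OF _ _ elim]) (simp, measurable)
    then show ?case by simp
  qed
  then have 2: "AE t in lborel. AE s in lborel. ?P s t"
    by (subst lborel_pair.AE_commute[symmetric]) measurable
  define D where "D = {u\<in>{0<..<1}. (AE t in lborel. ?P u t) \<and> (AE s in lborel. ?P s u)}"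
  have AED: "AE u in lborel. 0 < u \<and> u < 1 \<longrightarrow> u \<in> D"
    using 1 2 by eventually_elim (auto simp: D_def)
  have ne: "\<exists>r. a < r \<and> r < b \<and> Q r" if "a < b" "AE r in lborel. Q r" for a b :: real and Q
  proof (rule ccontr)
    assume "\<not> ?thesis"
    with that(2) have "AE r in lborel. r \<notin> {a<..<b}" by (auto elim: eventually_mono)
    then have "emeasure lborel {a<..<b} = 0" by (subst (asm) AE_iff_measurable[of "{a<..<b}"]) auto
    with that(1) show False by simp
  qed
  have mono: "k t \<le> k s" if st: "s \<in> D" "t \<in> D" "s \<le> t" for s t
  proof (cases "s = t")
    case False
    have rr: "AE r in lborel. ?P s r \<and> ?P r t" using st by (auto simp: D_def)
    then obtain r where "s < r" "r < t" "?P s r" "?P r t" using ne[of s t, OF _ rr] False st by auto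
    then show ?thesis using st by (auto simp: D_def)
  qed simp
  define k' where "k' t = (SUP s\<in>D \<inter> {t..}. k s)" for t
  have ne': "D \<inter> {t..} \<noteq> {}" if t: "0 < t" "t < 1" for t
  proof -
    obtain r where "t < r" "r < 1" "0 < r \<and> r < 1 \<longrightarrow> r \<in> D" using ne[OF t(2) AED] by auto
    then show ?thesis using t by auto
  qed
  have bdd: "bdd_above (k ` A)" if "A \<subseteq> D" for A
    using that b by (intro bdd_aboveI[of _ B]) (auto simp: D_def)
  have "k' \<in> dplus"
  proof (rule dplusI)
    fix s t :: real assume st: "0 < s" "s \<le> t" "t < 1"
    then show "k' t \<le> k' s" unfolding k'_def using ne'[of t] by (intro cSUP_subset_mono bdd) auto
  next
    fix t :: real assume t: "0 < t" "t < 1"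
    obtain s where s: "s \<in> D \<inter> {t..}" using ne'[OF t] by auto
    have "0 \<le> k s" using b[of s] s by (auto simp: D_def)
    also have "k s \<le> k' t" unfolding k'_def using s by (intro cSUP_upper bdd) auto
    finally show "0 \<le> k' t" .
  qed
  moreover have "AE t in unit_measure. k' t = k t"
  proof -
    have "AE u in lebesgue. 0 < u \<and> u < 1 \<longrightarrow> u \<in> D" using AED by (rule AE_completion)
    then have "AE u in unit_measure. u \<in> D" by (subst AE_restrict_space_iff) auto
    then show ?thesis
    proof eventually_elim
      case (elim t)
      show ?case unfolding k'_def
      proof (rule antisym)
        show "(SUP s\<in>D \<inter> {t..}. k s) \<le> k t" using mono elim by (intro cSUP_least) auto
        show "k t \<le> (SUP s\<in>D \<inter> {t..}. k s)" using elim by (intro cSUP_upper bdd) auto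
      qed
    qed
  qed
  ultimately show thesis by (rule that)
qed

context ri_banach
begin

text \<open>Moving from the projection \<open>z\<close> a little towards a point \<open>y\<close> of the unit ball, and cutting off at
  \<open>x\<close>, stays in the ball and so does not decrease the distance to \<open>x\<close>. The first order term in the
  step length is the assertion. Unbounded \<open>y\<close> are truncated.\<close>

lemma variational_inequality:
  assumes x: "x \<in> mplus" "\<And>t. 0 < t \<Longrightarrow> t < 1 \<Longrightarrow> x t \<le> B"
    and z: "z \<in> mplus" "\<And>t. 0 < t \<Longrightarrow> t < 1 \<Longrightarrow> z t \<le> x t" "N z \<le> 1"
    and min: "\<And>y. y \<in> mplus \<Longrightarrow> N y \<le> 1 \<Longrightarrow> (\<And>t. 0 < t \<Longrightarrow> t < 1 \<Longrightarrow> y t \<le> x t) \<Longrightarrow>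
      (LINT t|unit_measure. (x t - z t)\<^sup>2) \<le> (LINT t|unit_measure. (x t - y t)\<^sup>2)"
    and y: "y \<in> mplus" "N y \<le> 1"
  shows "(\<integral>\<^sub>1t. ennreal ((x t - z t) * y t)) \<le> (\<integral>\<^sub>1t. ennreal ((x t - z t) * z t))"
proof -
  note [measurable] = mplus_measurable[OF x(1)] mplus_measurable[OF z(1)]
  note x0 = mplus_nonneg[OF x(1)] and z0 = mplus_nonneg[OF z(1)]
  have bounded: "(\<integral>\<^sub>1t. ennreal ((x t - z t) * y t)) \<le> (\<integral>\<^sub>1t. ennreal ((x t - z t) * z t))"
    if y: "y \<in> mplus" "N y \<le> 1" and D: "\<And>t. 0 < t \<Longrightarrow> t < 1 \<Longrightarrow> y t \<le> D" for y and D :: real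
  proof -
    note [measurable] = mplus_measurable[OF y(1)]
    note y0 = mplus_nonneg[OF y(1)]
    have bd: "\<bar>x t - z t\<bar> \<le> B" "\<bar>y t - z t\<bar> \<le> B + D" "\<bar>y t\<bar> \<le> B + D" "\<bar>z t\<bar> \<le> B + D" if "0 < t" "t < 1" for t
      using x0[OF that] z0[OF that] x(2)[OF that] z(2)[OF that] y0[OF that] D[OF that] by auto
    have intp: "integrable unit_measure (\<lambda>t. f t * g t)"
      if [measurable]: "f \<in> borel_measurable unit_measure" "g \<in> borel_measurable unit_measure"
        and "\<And>t. 0 < t \<Longrightarrow> t < 1 \<Longrightarrow> \<bar>f t\<bar> \<le> F \<and> \<bar>g t\<bar> \<le> G" for f g :: "real \<Rightarrow> real" and F G
    proof (rule unit.integrable_const_bound[where B="F * G"])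
      show "AE t in unit_measure. norm (f t * g t) \<le> F * G"
      proof (rule AE_unitI)
        fix t :: real assume "0 < t" "t < 1"
        from that(3)[OF this] show "norm (f t * g t) \<le> F * G"
          by (auto simp: abs_mult intro!: mult_mono)
      qed
    qed measurable
    have i1: "integrable unit_measure (\<lambda>t. (x t - z t) * (y t - z t))"
      by (rule intp[of _ _ B "B + D"]) (use bd in auto)
    have i2: "integrable unit_measure (\<lambda>t. (x t - z t) * (x t - z t))"
      by (rule intp[of _ _ B B]) (use bd in auto)
    have i3: "integrable unit_measure (\<lambda>t. (y t - z t) * (y t - z t))"
      by (rule intp[of _ _ "B + D" "B + D"]) (use bd in auto)
    have i4: "integrable unit_measure (\<lambda>t. (x t - z t) * y t)" "integrable unit_measure (\<lambda>t. (x t - z t) * z t)"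
      by (rule intp[of _ _ B "B + D"]; use bd in auto)+
    define a where "a = (LINT t|unit_measure. (x t - z t) * (y t - z t))"
    define d where "d = (LINT t|unit_measure. (y t - z t) * (y t - z t))"
    have d0: "0 \<le> d" unfolding d_def by (intro integral_nonneg_AE) auto
    have ad: "a \<le> e * d / 2" if e: "0 < e" "e \<le> 1" for e
    proof -
      define v where "v t = (1 - e) * z t + e * y t" for t
      define w where "w t = min (x t) (v t)" for t
      have v: "v \<in> mplus" "N v \<le> 1"
        unfolding v_def using norm_convex[OF z(1) y(1) z(3) y(2)] e by auto
      note [measurable] = mplus_measurable[OF v(1)]
      have wm[measurable]: "w \<in> borel_measurable unit_measure" unfolding w_def by measurable
      have w: "w \<in> mplus"
        using x0 mplus_nonneg[OF v(1)] by (intro mplusI wm) (auto simp: w_def)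
      have "N w \<le> N v" by (intro norm_mono w v(1) AE_unitI) (auto simp: w_def)
      then have "N w \<le> 1" using v(2) by simp
      have vx: "x t - v t = (x t - z t) - e * (y t - z t)" for t by (simp add: v_def algebra_simps)
      have exp: "((x t - z t) - e * (y t - z t))\<^sup>2 = (x t - z t) * (x t - z t) - 2 * e * ((x t - z t) * (y t - z t)) + e\<^sup>2 * ((y t - z t) * (y t - z t))" for t
        by (simp add: power2_eq_square algebra_simps)
      have iv: "integrable unit_measure (\<lambda>t. (x t - v t)\<^sup>2)"
        unfolding vx exp by (intro Bochner_Integration.integrable_add Bochner_Integration.integrable_diff integrable_mult_right i1 i2 i3)
      have sq: "(x t - w t)\<^sup>2 \<le> (x t - v t)\<^sup>2" for t
        unfolding w_def by (cases "x t \<le> v t") (auto simp: min_def)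
      have "(LINT t|unit_measure. (x t - z t)\<^sup>2) \<le> (LINT t|unit_measure. (x t - w t)\<^sup>2)"
        by (rule min[OF w \<open>N w \<le> 1\<close>]) (simp add: w_def)
      also have "\<dots> \<le> (LINT t|unit_measure. (x t - v t)\<^sup>2)"
      proof (rule integral_mono[OF _ iv sq])
        show "integrable unit_measure (\<lambda>t. (x t - w t)\<^sup>2)"
          by (rule Bochner_Integration.integrable_bound[OF iv]) (use sq in auto)
      qed
      also have "\<dots> = (LINT t|unit_measure. (x t - z t) * (x t - z t)) - 2 * e * a + e\<^sup>2 * d"
        unfolding vx exp a_def d_def using i1 i2 i3 by simp
      finally have "2 * e * a \<le> e\<^sup>2 * d" by (simp add: power2_eq_square)
      then have "e * (2 * a) \<le> e * (e * d)" by (simp add: power2_eq_square algebra_simps)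
      then show ?thesis using e by simp
    qed
    have "a \<le> 0"
    proof (rule ccontr)
      assume "\<not> a \<le> 0"
      define e where "e = min 1 (a / (d + 1))"
      have e: "0 < e" "e \<le> 1" using \<open>\<not> a \<le> 0\<close> d0 by (auto simp: e_def)
      have "e * d \<le> a / (d + 1) * (d + 1)" using d0 \<open>\<not> a \<le> 0\<close> by (intro mult_mono) (auto simp: e_def)
      also have "\<dots> = a" using d0 by simp
      finally show False using ad[OF e] \<open>\<not> a \<le> 0\<close> by simp
    qed
    moreover have "a = (LINT t|unit_measure. (x t - z t) * y t) - (LINT t|unit_measure. (x t - z t) * z t)"
      unfolding a_def right_diff_distrib[of "x _ - z _" "y _"] using i4 by (rule Bochner_Integration.integral_diff)
    ultimately have "ennreal (LINT t|unit_measure. (x t - z t) * y t) \<le> ennreal (LINT t|unit_measure. (x t - z t) * z t)"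
      by (intro ennreal_leI) simp
    then show ?thesis
      using i4 z(2) y0 z0 by (subst (1 2) nn_integral_eq_integral) (auto intro!: AE_unitI)
  qed
  note [measurable] = mplus_measurable[OF y(1)]
  have lim: "(\<integral>\<^sub>1t. ennreal ((x t - z t) * y t)) = (SUP n. \<integral>\<^sub>1t. ennreal ((x t - z t) * min (y t) (real n)))"
  proof -
    have "(\<integral>\<^sub>1t. ennreal ((x t - z t) * y t)) = (\<integral>\<^sub>1t. (SUP n. ennreal ((x t - z t) * min (y t) (real n))))"
    proof (rule nn_integral_cong)
      fix t assume "t \<in> space unit_measure"
      then have t: "0 < t" "t < 1" by auto
      obtain m where m: "y t \<le> real m" using real_arch_simple by blast
      show "ennreal ((x t - z t) * y t) = (SUP n. ennreal ((x t - z t) * min (y t) (real n)))"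
      proof (rule antisym)
        show "ennreal ((x t - z t) * y t) \<le> (SUP n. ennreal ((x t - z t) * min (y t) (real n)))"
          using m by (intro SUP_upper2[of m]) auto
        show "(SUP n. ennreal ((x t - z t) * min (y t) (real n))) \<le> ennreal ((x t - z t) * y t)"
          using z(2)[OF t] by (intro SUP_least ennreal_leI mult_left_mono) auto
      qed
    qed
    also have "\<dots> = (SUP n. \<integral>\<^sub>1t. ennreal ((x t - z t) * min (y t) (real n)))"
    proof (rule nn_integral_monotone_convergence_SUP_AE)
      show "AE t in unit_measure. ennreal ((x t - z t) * min (y t) (real n)) \<le> ennreal ((x t - z t) * min (y t) (real (Suc n)))" for n
        using z(2) by (intro AE_unitI ennreal_leI mult_left_mono) auto
    qed measurable
    finally show ?thesis .
  qed
  show ?thesis unfolding lim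
  proof (rule SUP_least)
    fix n :: nat
    have m: "(\<lambda>t. min (y t) (real n)) \<in> mplus" using mplus_nonneg[OF y(1)] by (intro mplusI) auto
    have "N (\<lambda>t. min (y t) (real n)) \<le> N y" by (intro norm_mono m y AE_unitI) auto
    then show "(\<integral>\<^sub>1t. ennreal ((x t - z t) * min (y t) (real n))) \<le> (\<integral>\<^sub>1t. ennreal ((x t - z t) * z t))"
      using y(2) by (intro bounded[of _ "real n"] m) auto
  qed
qed

text \<open>For the projection \<open>z\<close> of \<open>x\<close>, the residual \<open>x - z\<close> separates \<open>x\<close> from the unit
  ball. It is decreasing: where it increased between \<open>s\<close> and \<open>s + h\<close>, the projection would decrease
  (as \<open>x\<close> does), and exchanging its values there, which costs nothing in norm, would contradict the
  variational inequality.\<close>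

lemma separation_bounded:
  assumes x: "x \<in> dplus" and B: "\<And>t. 0 < t \<Longrightarrow> t < 1 \<Longrightarrow> x t \<le> B" and Nx: "1 < N x"
  obtains k c where "k \<in> dplus" "0 < c"
    "\<And>y. y \<in> mplus \<Longrightarrow> N y \<le> 1 \<Longrightarrow> (\<integral>\<^sub>1t. ennreal (k t * y t)) \<le> ennreal c"
    "ennreal c < (\<integral>\<^sub>1t. ennreal (k t * x t))"
proof -
  define X where "X t = indicator {0<..<1} t * x t" for t :: real
  have Xb[measurable]: "X \<in> borel_measurable borel" unfolding X_def using x by (rule dplus_borel_indicator)
  have Xx: "X t = x t" if "0 < t" "t < 1" for t using that by (simp add: X_def)
  have Xm: "X \<in> mplus"
    using Xx dplus_nonneg[OF x] by (intro mplusI borel_unit_measurable measurable_restrict_space1 Xb) auto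
  have XB: "X t \<le> B" if "0 < t" "t < 1" for t using B Xx that by simp
  have NX: "N X = N x" using Xx by (intro norm_cong Xm dplus_mplus x AE_unitI) auto
  obtain z where zb[measurable]: "z \<in> borel_measurable borel"
    and z0: "\<And>t. 0 < t \<Longrightarrow> t < 1 \<Longrightarrow> 0 \<le> z t \<and> z t \<le> X t" and Nz: "N z \<le> 1"
    and zmin: "\<And>y. y \<in> mplus \<Longrightarrow> N y \<le> 1 \<Longrightarrow> (\<And>t. 0 < t \<Longrightarrow> t < 1 \<Longrightarrow> y t \<le> X t) \<Longrightarrow>
      (LINT t|unit_measure. (X t - z t)\<^sup>2) \<le> (LINT t|unit_measure. (X t - y t)\<^sup>2)"
    by (rule projection_exists[OF Xm Xb XB]) (assumption | blast intro: that)+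
  have zm: "z \<in> mplus" using z0 by (intro mplusI borel_unit_measurable measurable_restrict_space1 zb) auto
  define k where "k t = X t - z t" for t
  have kb[measurable]: "k \<in> borel_measurable borel" unfolding k_def by measurable
  have km[measurable]: "k \<in> borel_measurable unit_measure" by (intro borel_unit_measurable measurable_restrict_space1 kb)
  note [measurable] = mplus_measurable[OF zm] mplus_measurable[OF Xm]
  have k0: "0 \<le> k t \<and> k t \<le> B" if "0 < t" "t < 1" for t
    using z0[OF that] XB[OF that] by (auto simp: k_def)
  have var: "(\<integral>\<^sub>1t. ennreal (k t * y t)) \<le> (\<integral>\<^sub>1t. ennreal (k t * z t))"
    if "y \<in> mplus" "N y \<le> 1" for y
    unfolding k_def using z0 by (intro variational_inequality[OF Xm XB zm _ Nz zmin that]) auto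
  have fin: "(\<integral>\<^sub>1t. ennreal (k t * z t)) < \<infinity>"
  proof -
    have "ennreal (k t * z t) \<le> ennreal (B * B)" if "0 < t" "t < 1" for t
      using k0[OF that] z0[OF that] XB[OF that] by (intro ennreal_leI mult_mono) auto
    then have "(\<integral>\<^sub>1t. ennreal (k t * z t)) \<le> (\<integral>\<^sub>1t. ennreal (B * B))"
      by (intro nn_integral_mono_AE AE_unitI)
    also have "\<dots> < \<infinity>" by (simp add: unit.emeasure_space_1[simplified])
    finally show ?thesis .
  qed
  have swap: "AE s in lborel. 0 < s \<and> s + h < 1 \<longrightarrow> k (s + h) \<le> k s" if h: "0 < h" for h
  proof -
    \<comment> \<open>Confined to an interval of length \<open>h\<close>, the bad points are disjoint from their translates.\<close>
    define E where "E a = {s. a < s \<and> s < a + h \<and> 0 < s \<and> s + h < 1 \<and> k s < k (s + h)}" for a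
    have "AE s in lborel. s \<notin> E a" for a
    proof -
      have Eb[measurable]: "E a \<in> sets borel" unfolding E_def by measurable
      have Ed: "t - h \<notin> E a" if "t \<in> E a" for t using that h by (auto simp: E_def)
      have E01: "0 < t \<and> t + h < 1" if "t \<in> E a" for t using that h by (auto simp: E_def)
      let ?y = "\<lambda>t. z (swap_shift (E a) h t)"
      have yb: "?y \<in> borel_measurable borel" by measurable
      have "0 \<le> ?y t" if "0 < t" "t < 1" for t
        using that E01[of t] E01[of "t - h"] h z0 by (auto simp: swap_shift_def)
      then have y: "?y \<in> mplus" by (intro mplusI borel_unit_measurable measurable_restrict_space1 yb)
      have "N ?y = N z"
        by (rule norm_equimeasurable[OF y zm rearr_swap_shift[OF zb Eb Ed E01 h]])
      then have le: "(\<integral>\<^sub>1t. ennreal (k t * ?y t)) \<le> (\<integral>\<^sub>1t. ennreal (k t * z t))"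
        using var[OF y] Nz by simp
      define H where "H f t = ennreal (k t * f t) * indicator {0<..<1} t" for f and t :: real
      have Hb: "H f \<in> borel_measurable borel" if [measurable]: "f \<in> borel_measurable borel" for f
        unfolding H_def by measurable
      have Hint: "(\<integral>\<^sub>1t. ennreal (k t * f t)) = (\<integral>\<^sup>+t. H f t \<partial>lborel)"
        if [measurable]: "f \<in> borel_measurable borel" for f
        unfolding H_def by (intro nn_integral_unit_lborel measurable_restrict_space1) measurable
      note [measurable] = Hb[OF zb] Hb[OF yb]
      let ?R = "\<lambda>f. \<integral>\<^sup>+t. H f t * indicator {t. t \<notin> E a \<and> t - h \<notin> E a} t \<partial>lborel"
      let ?G = "\<lambda>f t. (H f t + H f (t + h)) * indicator (E a) t"
      have R: "?R ?y = ?R z"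
        by (intro nn_integral_cong) (auto simp: H_def indicator_def swap_shift_simps[OF Ed])
      have dz: "(\<integral>\<^sub>1t. ennreal (k t * z t)) = ?R z + (\<integral>\<^sup>+t. ?G z t \<partial>lborel)"
        unfolding Hint[OF zb] by (rule nn_integral_swap_decomp[OF Hb[OF zb] Eb Ed])
      have dy: "(\<integral>\<^sub>1t. ennreal (k t * ?y t)) = ?R z + (\<integral>\<^sup>+t. ?G ?y t \<partial>lborel)"
        unfolding Hint[OF yb] R[symmetric] by (rule nn_integral_swap_decomp[OF Hb[OF yb] Eb Ed])
      have fin': "?R z < \<infinity>" "(\<integral>\<^sup>+t. ?G z t \<partial>lborel) < \<infinity>" using fin unfolding dz by simp_all
      have le': "(\<integral>\<^sup>+t. ?G ?y t \<partial>lborel) \<le> (\<integral>\<^sup>+t. ?G z t \<partial>lborel)"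
        using le fin'(1) unfolding dz dy by auto
      \<comment> \<open>The rearrangement inequality for two numbers: after the exchange the larger value of \<open>z\<close>
        meets the larger value of \<open>k\<close>.\<close>
      have less: "?G z t < ?G ?y t" if t: "t \<in> E a" for t
      proof -
        have 01: "0 < t" "t < 1" "0 < t + h" "t + h < 1" and kk: "k t < k (t + h)" using t h by (auto simp: E_def)
        have "X (t + h) \<le> X t" using dplus_antimono[OF x, of t "t + h"] 01 h by (simp add: Xx)
        then have zz: "z (t + h) < z t" using kk by (simp add: k_def)
        have "0 < (k (t + h) - k t) * (z t - z (t + h))" using kk zz by (intro mult_pos_pos) auto
        then have "k t * z t + k (t + h) * z (t + h) < k t * z (t + h) + k (t + h) * z t"
          by (simp add: algebra_simps)
        then have "ennreal (k t * z t + k (t + h) * z (t + h)) < ennreal (k t * z (t + h) + k (t + h) * z t)"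
          using k0[OF 01(1,2)] k0[OF 01(3,4)] z0[OF 01(1,2)] z0[OF 01(3,4)]
          by (intro ennreal_lessI) (auto intro: le_less_trans[rotated])
        then show ?thesis
          using t 01 k0[OF 01(1,2)] k0[OF 01(3,4)] z0[OF 01(1,2)] z0[OF 01(3,4)]
          by (simp add: H_def swap_shift_simps[OF Ed] ennreal_plus)
      qed
      have "AE t in lborel. ?G ?y t \<le> ?G z t"
      proof (rule ccontr)
        assume "\<not> ?thesis"
        then have "(\<integral>\<^sup>+t. ?G z t \<partial>lborel) < (\<integral>\<^sup>+t. ?G ?y t \<partial>lborel)"
          using fin'(2) less by (intro nn_integral_less) (auto simp: indicator_def intro: less_imp_le)
        with le' show False by simp
      qed
      then show ?thesis by eventually_elim (use less in \<open>force simp: not_le[symmetric]\<close>)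
    qed
    then have "AE s in lborel. \<forall>a\<in>\<rat>. s \<notin> E a" by (subst AE_ball_countable) (auto simp: countable_rat)
    then show ?thesis
    proof (rule AE_mp, intro AE_I2 impI)
      fix s assume s: "\<forall>a\<in>\<rat>. s \<notin> E a" "0 < s \<and> s + h < 1"
      obtain a where "a \<in> \<rat>" "s - h < a" "a < s" using Rats_dense_in_real[of "s - h" s] h by auto
      with s have "s \<notin> E a" "a < s" "s < a + h" by auto
      with s(2) show "k (s + h) \<le> k s" by (auto simp: E_def)
    qed
  qed
  obtain k' where k': "k' \<in> dplus" "AE t in unit_measure. k' t = k t"
    by (rule AE_decreasing_version[OF kb k0 swap]) (assumption | blast intro: that)+
  have k'_int: "(\<integral>\<^sub>1t. ennreal (k' t * y t)) = (\<integral>\<^sub>1t. ennreal (k t * y t))" for y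
    using k'(2) by (intro nn_integral_cong_AE) (auto elim: eventually_mono)
  have notz: "\<not> (AE t in unit_measure. k t = 0)"
  proof
    assume "AE t in unit_measure. k t = 0"
    then have "AE t in unit_measure. X t = z t" by eventually_elim (simp add: k_def)
    then have "N X = N z" by (intro norm_cong Xm zm)
    with Nx NX Nz show False by simp
  qed
  define c where "c = enn2real (\<integral>\<^sub>1t. ennreal (k t * z t))"
  have c: "(\<integral>\<^sub>1t. ennreal (k t * z t)) = ennreal c" using fin by (simp add: c_def less_top)
  have "0 < c"
  proof (rule ccontr)
    assume "\<not> 0 < c"
    then have c0: "(\<integral>\<^sub>1t. ennreal (k t * z t)) = 0" unfolding c by (simp add: ennreal_neg)
    \<comment> \<open>A small constant function lies in the unit ball; it tests that \<open>k\<close> vanishes.\<close>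
    define d where "d = 1 / (enn2real (N (\<lambda>_. 1)) + 1)"
    have e0: "0 \<le> enn2real (N (\<lambda>_. 1))" by simp
    then have d: "0 < d" by (simp add: d_def add_nonneg_pos)
    have one: "(\<lambda>_. 1) \<in> mplus" by (auto simp: mplus_def)
    have "N (\<lambda>t. d * 1) = ennreal d * ennreal (enn2real (N (\<lambda>_. 1)))"
      using norm_scale[OF one, of d] d norm_one by simp
    also have "\<dots> = ennreal (d * enn2real (N (\<lambda>_. 1)))" using d by (simp add: ennreal_mult')
    also have "\<dots> \<le> 1"
    proof -
      have "0 < enn2real (N (\<lambda>_. 1)) + 1" using e0 by linarith
      then show ?thesis by (simp add: d_def del: add_is_0)
    qed
    finally have "N (\<lambda>t. d * 1) \<le> 1" .
    moreover have "(\<lambda>t. d * 1) \<in> mplus" using d by (auto simp: mplus_def)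
    ultimately have "(\<integral>\<^sub>1t. ennreal (k t * (d * 1))) = 0" using var c0 by force
    then have "AE t in unit_measure. ennreal (k t * d) = 0" by (subst (asm) nn_integral_0_iff_AE) auto
    then have "AE t in unit_measure. k t = 0"
    proof (rule AE_mp, intro AE_unitI impI)
      fix t :: real assume t: "0 < t" "t < 1" and "ennreal (k t * d) = 0"
      then have "k t * d \<le> 0" by (simp add: ennreal_eq_0_iff)
      then show "k t = 0" using k0[OF t] d by (auto simp: mult_le_0_iff)
    qed
    with notz show False by simp
  qed
  moreover have "ennreal c < (\<integral>\<^sub>1t. ennreal (k t * x t))"
  proof -
    have "(\<integral>\<^sub>1t. ennreal (k t * x t)) = (\<integral>\<^sub>1t. ennreal (k t * z t) + ennreal (k t * k t))"
    proof (rule nn_integral_cong_AE, rule AE_unitI)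
      fix t :: real assume t: "0 < t" "t < 1"
      have "k t * x t = k t * z t + k t * k t" using Xx[OF t] by (simp add: k_def algebra_simps)
      then show "ennreal (k t * x t) = ennreal (k t * z t) + ennreal (k t * k t)"
        using k0[OF t] z0[OF t] by (simp add: ennreal_plus)
    qed
    also have "\<dots> = ennreal c + (\<integral>\<^sub>1t. ennreal (k t * k t))"
      by (simp add: nn_integral_add c)
    finally have eq: "(\<integral>\<^sub>1t. ennreal (k t * x t)) = \<dots>" .
    have "(\<integral>\<^sub>1t. ennreal (k t * k t)) \<noteq> 0"
    proof
      assume "(\<integral>\<^sub>1t. ennreal (k t * k t)) = 0"
      then have "AE t in unit_measure. ennreal (k t * k t) = 0" by (subst (asm) nn_integral_0_iff_AE) auto
      then have "AE t in unit_measure. k t = 0"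
      proof (rule AE_mp, intro AE_unitI impI)
        fix t :: real assume "ennreal (k t * k t) = 0"
        then have "k t * k t \<le> 0" by (simp add: ennreal_eq_0_iff)
        then show "k t = 0" by (metis mult_le_0_iff order_antisym_conv zero_le_square mult_eq_0_iff)
      qed
      with notz show False by simp
    qed
    then show ?thesis unfolding eq
      by (metis add.right_neutral ennreal_add_left_cancel_less ennreal_less_top not_gr_zero infinity_ennreal_def less_irrefl)
  qed
  ultimately show thesis
    using k'(1) var by (intro that[of k' c]) (auto simp: k'_int c)
qed

text \<open>This is the Lorentz--Luxemburg theorem for rearrangement-invariant norms, with a functional that
  is decreasing. The Fatou property reduces it to bounded \<open>x\<close>, and scaling to the unit ball.\<close>

theorem separation:
  assumes x: "x \<in> dplus" and m: "m < N x"
  obtains k where "k \<in> dplus"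
    "\<And>g. g \<in> mplus \<Longrightarrow> (\<integral>\<^sub>1t. ennreal (k t * g t)) \<le> N g"
    "m < (\<integral>\<^sub>1t. ennreal (k t * x t))"
proof -
  define y where "y n t = min (x t) (real n)" for n t
  have yd: "y n \<in> dplus" for n
    using dplus_antimono[OF x] dplus_nonneg[OF x] by (intro dplusI) (auto simp: y_def min.coboundedI1 intro: min.mono)
  have "AE t in unit_measure. incseq (\<lambda>n. y n t) \<and> (\<lambda>n. y n t) \<longlonglongrightarrow> x t"
  proof (intro AE_unitI conjI)
    fix t :: real
    show "incseq (\<lambda>n. y n t)" by (auto simp: y_def incseq_def)
    obtain n where "x t \<le> real n" using real_arch_simple by blast
    then have "y j t = x t" if "n \<le> j" for j using that by (auto simp: y_def min_def dest: of_nat_mono[where 'a=real])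
    then show "(\<lambda>n. y n t) \<longlonglongrightarrow> x t" by (intro tendsto_eventually eventually_sequentiallyI[of n])
  qed
  then have "(\<lambda>n. N (y n)) \<longlonglongrightarrow> N x" by (intro norm_fatou dplus_mplus yd x)
  from order_tendstoD(1)[OF this m] obtain n where n: "m < N (y n)" by (auto simp: eventually_sequentially)
  then obtain M' where M': "m < M'" "M' < N (y n)" using dense by blast
  obtain M where M: "M' = ennreal M" "0 < M"
  proof (cases M')
    case (real r)
    then show thesis using M'(1) that[of r] by (cases "r = 0") auto
  qed (use M'(2) in auto)
  have zd: "(\<lambda>t. 1 / M * y n t) \<in> dplus"
    using dplus_antimono[OF yd] dplus_nonneg[OF yd] M(2) by (intro dplusI) (auto intro: divide_right_mono)
  have "1 < N (\<lambda>t. 1 / M * y n t)"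
  proof -
    have "ennreal (1 / M) * ennreal M < ennreal (1 / M) * N (y n)"
      using M' M by (intro ennreal_mult_strict_left_mono) (auto simp: ennreal_zero_less_divide)
    moreover have "ennreal (1 / M) * ennreal M = 1" using M(2) by (simp flip: ennreal_mult')
    moreover have "N (\<lambda>t. 1 / M * y n t) = ennreal (1 / M) * N (y n)"
      using M(2) by (intro norm_scale dplus_mplus yd) auto
    ultimately show ?thesis by simp
  qed
  note N1 = this
  have yb: "1 / M * y n t \<le> real n / M" if "0 < t" "t < 1" for t
    using M(2) by (auto simp: y_def intro: divide_right_mono)
  obtain k c where k: "k \<in> dplus" "0 < c"
    and kle: "\<And>y. y \<in> mplus \<Longrightarrow> N y \<le> 1 \<Longrightarrow> (\<integral>\<^sub>1t. ennreal (k t * y t)) \<le> ennreal c"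
    and kgt: "ennreal c < (\<integral>\<^sub>1t. ennreal (k t * (1 / M * y n t)))"
    by (rule separation_bounded[OF zd yb N1]) (assumption | blast intro: that)+
  note [measurable] = mplus_measurable[OF dplus_mplus[OF k(1)]] mplus_measurable[OF dplus_mplus[OF yd]]
  have scale: "(\<integral>\<^sub>1t. ennreal (k t * (a * g t))) = ennreal a * (\<integral>\<^sub>1t. ennreal (k t * g t))"
    if "g \<in> mplus" "0 \<le> a" for g a
  proof -
    note [measurable] = mplus_measurable[OF that(1)]
    have "(\<integral>\<^sub>1t. ennreal (k t * (a * g t))) = (\<integral>\<^sub>1t. ennreal a * ennreal (k t * g t))"
      using that(2) by (intro nn_integral_cong) (simp add: mult_ac flip: ennreal_mult')
    then show ?thesis by (simp add: nn_integral_cmult)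
  qed
  have scale': "(\<integral>\<^sub>1t. ennreal (k t / c * g t)) = ennreal (1 / c) * (\<integral>\<^sub>1t. ennreal (k t * g t))"
    if "g \<in> mplus" for g
    using scale[OF that, of "1 / c"] k(2) by simp
  have c1: "ennreal (1 / c) * ennreal c = 1" using k(2) by (simp flip: ennreal_mult')
  show thesis
  proof (rule that[of "\<lambda>t. k t / c"])
    show "(\<lambda>t. k t / c) \<in> dplus"
      using dplus_antimono[OF k(1)] dplus_nonneg[OF k(1)] k(2) by (intro dplusI) (auto intro: divide_right_mono)
    fix g assume g: "g \<in> mplus"
    show "(\<integral>\<^sub>1t. ennreal (k t / c * g t)) \<le> N g"
    proof (cases "N g = 0 \<or> N g = \<infinity>")
      case True
      then show ?thesis
      proof
        assume "N g = 0"
        then have "AE t in unit_measure. g t = 0" using norm_zero_iff[OF g] by simp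
        then have "(\<integral>\<^sub>1t. ennreal (k t / c * g t)) = (\<integral>\<^sub>1t. 0)"
          by (intro nn_integral_cong_AE) (auto elim: eventually_mono)
        then show ?thesis by simp
      qed simp
    next
      case False
      then obtain b where b: "N g = ennreal b" "0 < b" by (cases "N g") (auto simp: less_le)
      have "N (\<lambda>t. 1 / b * g t) = ennreal (1 / b) * ennreal b" using norm_scale[OF g, of "1 / b"] b by simp
      also have "\<dots> = 1" using b(2) by (simp flip: ennreal_mult')
      finally have "N (\<lambda>t. 1 / b * g t) \<le> 1" by simp
      moreover have "(\<lambda>t. 1 / b * g t) \<in> mplus"
        using mplus_measurable[OF g] mplus_nonneg[OF g] b(2) by (intro mplusI) auto
      ultimately have "ennreal (1 / b) * (\<integral>\<^sub>1t. ennreal (k t * g t)) \<le> ennreal c"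
        using kle scale[OF g, of "1 / b"] b(2) by fastforce
      then have "ennreal b * (ennreal (1 / b) * (\<integral>\<^sub>1t. ennreal (k t * g t))) \<le> ennreal b * ennreal c"
        by (intro mult_left_mono) auto
      moreover have "ennreal b * ennreal (1 / b) = 1" using b(2) by (simp flip: ennreal_mult')
      ultimately have "(\<integral>\<^sub>1t. ennreal (k t * g t)) \<le> ennreal b * ennreal c"
        by (simp flip: mult.assoc)
      then have "ennreal (1 / c) * (\<integral>\<^sub>1t. ennreal (k t * g t)) \<le> ennreal (1 / c) * (ennreal b * ennreal c)"
        by (intro mult_left_mono) auto
      also have "\<dots> = N g" using c1 b(1) by (simp add: mult.left_commute)
      finally show ?thesis unfolding scale'[OF g] .
    qed
  next
    have "ennreal (1 / c) * ennreal c < ennreal (1 / c) * (ennreal (1 / M) * (\<integral>\<^sub>1t. ennreal (k t * y n t)))"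
      using kgt scale[OF dplus_mplus[OF yd[of n]], of "1 / M"] M(2) k(2)
      by (intro ennreal_mult_strict_left_mono) (auto simp: ennreal_zero_less_divide)
    then have "1 < ennreal (1 / M) * (\<integral>\<^sub>1t. ennreal (k t / c * y n t))"
      unfolding c1 scale'[OF dplus_mplus[OF yd]] by (simp add: mult.left_commute)
    then have "ennreal M * 1 < ennreal M * (ennreal (1 / M) * (\<integral>\<^sub>1t. ennreal (k t / c * y n t)))"
      using M(2) by (intro ennreal_mult_strict_left_mono) auto
    moreover have "ennreal M * ennreal (1 / M) = 1" using M(2) by (simp flip: ennreal_mult')
    ultimately have "ennreal M < (\<integral>\<^sub>1t. ennreal (k t / c * y n t))" by (simp flip: mult.assoc)
    also have "\<dots> \<le> (\<integral>\<^sub>1t. ennreal (k t / c * x t))"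
      using dplus_nonneg[OF k(1)] k(2) by (intro nn_integral_mono_AE AE_unitI ennreal_leI mult_left_mono) (auto simp: y_def)
    finally show "m < (\<integral>\<^sub>1t. ennreal (k t / c * x t))" using M'(1) M(1) by simp
  qed
qed

text \<open>If the inequality failed, a decreasing functional would witness the failure; but by Hardy's
  lemma decreasing functionals respect the domination of the primitives.\<close>

corollary hardy_littlewood_polya:
  assumes f: "f \<in> dplus" and g: "g \<in> mplus" and C: "0 \<le> C"
    and le: "\<And>t. 0 < t \<Longrightarrow> t < 1 \<Longrightarrow> (\<integral>\<^sub>1s. ennreal (f s) * indicator {0<..<t} s) \<le>
      ennreal C * (\<integral>\<^sub>1s. ennreal (g s) * indicator {0<..<t} s)"
  shows "N f \<le> ennreal C * N g"
proof (rule ccontr)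
  assume "\<not> ?thesis"
  then have "ennreal C * N g < N f" by simp
  then obtain k where k: "k \<in> dplus" "\<And>g. g \<in> mplus \<Longrightarrow> (\<integral>\<^sub>1t. ennreal (k t * g t)) \<le> N g"
      "ennreal C * N g < (\<integral>\<^sub>1t. ennreal (k t * f t))"
    by (rule separation[OF f]) (assumption | blast intro: that)+
  note [measurable] = mplus_measurable[OF dplus_mplus[OF k(1)]] mplus_measurable[OF dplus_mplus[OF f]] mplus_measurable[OF g]
  have mult: "(\<integral>\<^sub>1t. ennreal (k t * h t)) = (\<integral>\<^sub>1t. ennreal (k t) * ennreal (h t))" for h
    using dplus_nonneg[OF k(1)] by (intro nn_integral_cong) (auto simp: ennreal_mult')
  have "(\<integral>\<^sub>1t. ennreal (k t) * ennreal (f t)) \<le> (\<integral>\<^sub>1t. ennreal (k t) * (ennreal C * ennreal (g t)))"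
  proof (rule hardy_lemma[OF _ _ _ k(1)])
    fix t :: real assume "0 < t" "t < 1"
    from le[OF this] show "(\<integral>\<^sub>1s. ennreal (f s) * indicator {0<..<t} s) \<le>
        (\<integral>\<^sub>1s. ennreal C * ennreal (g s) * indicator {0<..<t} s)"
      by (simp add: nn_integral_cmult mult.assoc)
  qed measurable
  also have "\<dots> = ennreal C * (\<integral>\<^sub>1t. ennreal (k t) * ennreal (g t))"
    by (simp add: mult.left_commute nn_integral_cmult)
  also have "\<dots> \<le> ennreal C * N g"
    using k(2)[OF g] unfolding mult by (intro mult_left_mono) auto
  finally show False using k(3) unfolding mult by simp
qed

end

section \<open>Uniform variables on nonatomic probability spaces\<close>

locale nonatomic_prob = prob_space +
  assumes nonatomic: "nonatomic M"
begin

text \<open>Of a set of smaller positive measure and its complement one has at most half the measure;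
  iterate.\<close>

lemma small_subset:
  assumes A: "A \<in> sets M" "0 < prob A" and e: "0 < e"
  obtains B where "B \<in> sets M" "B \<subseteq> A" "0 < prob B" "prob B < e"
proof -
  have half: "\<exists>B\<in>sets M. B \<subseteq> A \<and> 0 < prob B \<and> prob B \<le> prob A / 2" if A: "A \<in> sets M" "0 < prob A" for A
  proof -
    have "0 < emeasure M A" using A(2) by (simp add: emeasure_eq_measure)
    then obtain B where B: "B \<in> sets M" "B \<subseteq> A" "0 < emeasure M B" "emeasure M B < emeasure M A"
      using nonatomic A(1) unfolding nonatomic_def by blast
    then have "0 < prob B" "prob B < prob A" by (simp_all add: emeasure_eq_measure ennreal_less_iff)
    moreover have "prob (A - B) = prob A - prob B" using A B by (intro finite_measure_Diff)
    ultimately consider "prob B \<le> prob A / 2" "0 < prob B" | "prob (A - B) \<le> prob A / 2" "0 < prob (A - B)"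
      by linarith
    then show ?thesis
    proof cases
      case 1 then show ?thesis using B by blast
    next
      case 2 then show ?thesis using A B by (intro bexI[of _ "A - B"]) auto
    qed
  qed
  have iter: "\<exists>B\<in>sets M. B \<subseteq> A \<and> 0 < prob B \<and> prob B \<le> prob A / 2 ^ n" for n
  proof (induction n)
    case 0 then show ?case using A by auto
  next
    case (Suc n)
    then obtain B where B: "B \<in> sets M" "B \<subseteq> A" "0 < prob B" "prob B \<le> prob A / 2 ^ n" by blast
    from half[OF B(1,3)] obtain C where "C \<in> sets M" "C \<subseteq> B" "0 < prob C" "prob C \<le> prob B / 2" by blast
    then show ?case using B by (intro bexI[of _ C]) auto
  qed
  obtain n where n: "(1 / 2) ^ n < e" using real_arch_pow_inv[of e "1/2"] e by auto
  obtain B where "B \<in> sets M" "B \<subseteq> A" "0 < prob B" "prob B \<le> prob A / 2 ^ n" using iter by blast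
  moreover have "prob A / 2 ^ n \<le> (1 / 2) ^ n" by (simp add: power_one_over divide_right_mono)
  ultimately show thesis using n by (intro that[of B]) auto
qed

text \<open>Sierpinski's theorem. A set is built up greedily, at each step adding at least half of the
  largest mass that still fits. If the union fell short, a small remaining set would fit at every
  step, and the masses added could not tend to zero.\<close>

lemma subset_of_prob:
  assumes A: "A \<in> sets M" and c: "0 \<le> c" "c \<le> prob A"
  obtains B where "B \<in> sets M" "B \<subseteq> A" "prob B = c"
proof -
  let ?P = "\<lambda>B. B \<in> sets M \<and> B \<subseteq> A \<and> prob B \<le> c"
  let ?Q = "\<lambda>B B'. B \<subseteq> B' \<and> (\<forall>C\<in>sets M. C \<subseteq> A - B \<longrightarrow> prob C \<le> c - prob B \<longrightarrow> prob C \<le> 2 * (prob B' - prob B))"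
  have "\<exists>B. \<forall>n. ?P (B n) \<and> ?Q (B n) (B (Suc n))"
  proof (rule dependent_nat_choice[where P="\<lambda>_. ?P" and Q="\<lambda>_. ?Q"])
    show "\<exists>B. ?P B" using c by (intro exI[of _ "{}"]) auto
  next
    fix B and n :: nat assume B: "?P B"
    define S where "S = {prob C | C. C \<in> sets M \<and> C \<subseteq> A - B \<and> prob C \<le> c - prob B}"
    have S0: "0 \<in> S" unfolding S_def using B by (auto intro!: exI[of _ "{}"])
    have bdd: "bdd_above S" unfolding S_def by (auto intro!: bdd_aboveI[of _ 1])
    have up: "s \<le> Sup S" if "s \<in> S" for s using that bdd by (intro cSup_upper)
    have "\<exists>s\<in>S. Sup S \<le> 2 * s"
    proof (cases "Sup S = 0")
      case False
      then have "Sup S / 2 < Sup S" using up[OF S0] by simp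
      then obtain s where "s \<in> S" "Sup S / 2 < s" using less_cSup_iff[of S "Sup S / 2"] S0 bdd by blast
      then show ?thesis by (intro bexI[of _ s]) auto
    qed (use S0 in auto)
    then obtain C where C: "C \<in> sets M" "C \<subseteq> A - B" "prob C \<le> c - prob B" "Sup S \<le> 2 * prob C"
      unfolding S_def by blast
    have un: "prob (B \<union> C) = prob B + prob C" using B C by (intro finite_measure_Union) auto
    show "\<exists>B'. ?P B' \<and> ?Q B B'"
    proof (intro exI[of _ "B \<union> C"] conjI ballI impI)
      fix D assume "D \<in> sets M" "D \<subseteq> A - B" "prob D \<le> c - prob B"
      then have "prob D \<le> Sup S" by (intro up) (auto simp: S_def)
      then show "prob D \<le> 2 * (prob (B \<union> C) - prob B)" using C(4) un by simp
    qed (use B C un in auto)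
  qed
  then obtain B where all: "\<forall>n. ?P (B n) \<and> ?Q (B n) (B (Suc n))" by blast
  have B: "?P (B n)" and Q: "?Q (B n) (B (Suc n))" for n using all by blast+
  define U where "U = (\<Union>n. B n)"
  have U: "U \<in> sets M" "U \<subseteq> A" using B by (auto simp: U_def)
  have lim: "(\<lambda>n. prob (B n)) \<longlonglongrightarrow> prob U"
    unfolding U_def using B Q by (intro finite_Lim_measure_incseq incseq_SucI) auto
  have Uc: "prob U \<le> c" using B by (intro LIMSEQ_le_const2[OF lim]) auto
  have "prob U = c"
  proof (rule ccontr)
    assume "prob U \<noteq> c"
    then have less: "prob U < c" using Uc by simp
    have "prob (A - U) = prob A - prob U" using A U by (intro finite_measure_Diff)
    then obtain D where D: "D \<in> sets M" "D \<subseteq> A - U" "0 < prob D" "prob D < c - prob U"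
      using small_subset[of "A - U" "c - prob U"] less c A U by auto
    have "prob D \<le> 2 * (prob (B (Suc n)) - prob (B n))" for n
    proof -
      have "prob (B n) \<le> prob U" using U by (intro finite_measure_mono) (auto simp: U_def)
      moreover have "D \<subseteq> A - B n" using D(2) by (auto simp: U_def)
      ultimately show ?thesis using Q[of n] D by auto
    qed
    moreover have "(\<lambda>n. 2 * (prob (B (Suc n)) - prob (B n))) \<longlonglongrightarrow> 2 * (prob U - prob U)"
      by (intro tendsto_intros lim LIMSEQ_Suc)
    ultimately have "prob D \<le> 2 * (prob U - prob U)" by (intro LIMSEQ_le_const) auto
    with D(3) show False by simp
  qed
  with U show thesis by (rule that)
qed

lemma midpoint_set:
  assumes "D \<in> sets M" "E \<in> sets M" "D \<subseteq> E"
  shows "\<exists>F\<in>sets M. D \<subseteq> F \<and> F \<subseteq> E \<and> prob F = (prob D + prob E) / 2"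
proof -
  have diff: "prob (E - D) = prob E - prob D" using assms by (intro finite_measure_Diff)
  have le: "prob D \<le> prob E" using assms by (intro finite_measure_mono)
  obtain B where B: "B \<in> sets M" "B \<subseteq> E - D" "prob B = (prob E - prob D) / 2"
    using subset_of_prob[of "E - D" "(prob E - prob D) / 2"] diff le assms by auto
  have "prob (D \<union> B) = prob D + prob B" using assms B by (intro finite_measure_Union) auto
  then show ?thesis using assms B by (intro bexI[of _ "D \<union> B"]) (auto simp: field_simps)
qed

text \<open>The sets of the \<open>n\<close>-th generation have the masses \<open>j / 2 ^ n\<close>; bisecting the differences gives
  the next generation. They are nested like the dyadic rationals, as the sublevel sets of a uniform
  variable must be.\<close>

lemma dyadic_chain:
  obtains C :: "nat \<Rightarrow> nat \<Rightarrow> 'a set" where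
    "\<And>n j. C n j \<in> sets M" "\<And>n j. prob (C n j) = min 1 (real j / 2 ^ n)"
    "C 0 1 = space M" "\<And>m i n j. i * 2 ^ n \<le> j * 2 ^ m \<Longrightarrow> C m i \<subseteq> C n j"
proof -
  obtain mid where mid: "\<And>D E. D \<in> sets M \<Longrightarrow> E \<in> sets M \<Longrightarrow> D \<subseteq> E \<Longrightarrow>
      mid D E \<in> sets M \<and> D \<subseteq> mid D E \<and> mid D E \<subseteq> E \<and> prob (mid D E) = (prob D + prob E) / 2"
    using midpoint_set by metis
  define C where "C = rec_nat (\<lambda>j::nat. if j = 0 then {} else space M)
    (\<lambda>n c j. if even j then c (j div 2) else mid (c (j div 2)) (c (Suc (j div 2))))"
  have C0: "C 0 j = (if j = 0 then {} else space M)" for j by (simp add: C_def)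
  have CS: "C (Suc n) j = (if even j then C n (j div 2) else mid (C n (j div 2)) (C n (Suc (j div 2))))" for n j
    by (simp add: C_def)
  have main: "C n j \<in> sets M \<and> C n j \<subseteq> C n (Suc j) \<and> prob (C n j) = min 1 (real j / 2 ^ n)" for n j
  proof (induction n arbitrary: j)
    case 0 then show ?case by (auto simp: C0 prob_space)
  next
    case (Suc n)
    define i where "i = j div 2"
    note IH = Suc.IH[of i] Suc.IH[of "Suc i"]
    note md = mid[of "C n i" "C n (Suc i)"]
    show ?case
    proof (cases "even j")
      case True
      then have "j = 2 * i" by (simp add: i_def)
      then show ?thesis using IH md by (auto simp: CS)
    next
      case False
      then have j: "j = 2 * i + 1" by (simp add: i_def)
      have "(min 1 (real i / 2 ^ n) + min 1 (real (Suc i) / 2 ^ n)) / 2 = min 1 (real j / 2 ^ Suc n)"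
      proof (cases "i < 2 ^ n")
        case True
        then have "Suc i \<le> 2 ^ n" by simp
        then have 1: "real (Suc i) \<le> 2 ^ n" by (metis of_nat_le_iff of_nat_numeral of_nat_power)
        have 2: "real i \<le> 2 ^ n" using 1 by linarith
        have "real j \<le> 2 ^ Suc n" using 1 by (simp add: j)
        with 1 2 have m: "min 1 (real i / 2 ^ n) = real i / 2 ^ n" "min 1 (real (Suc i) / 2 ^ n) = real (Suc i) / 2 ^ n"
          "min 1 (real j / 2 ^ Suc n) = real j / 2 ^ Suc n" by simp_all
        show ?thesis unfolding m by (simp add: j field_simps)
      next
        case False
        then have "2 ^ n \<le> i" by simp
        then have 1: "2 ^ n \<le> real i" by (metis of_nat_le_iff of_nat_numeral of_nat_power)
        have "2 ^ Suc n \<le> real j" using 1 unfolding j by (simp only: of_nat_add of_nat_mult power_Suc of_nat_numeral of_nat_1)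
        then have c: "1 \<le> real j / 2 ^ Suc n" by (simp only: pos_le_divide_eq zero_less_power zero_less_numeral mult_1)
        have a: "1 \<le> real i / 2 ^ n" using 1 by (simp only: pos_le_divide_eq zero_less_power zero_less_numeral mult_1)
        have b: "1 \<le> real (Suc i) / 2 ^ n" by (rule order_trans[OF a]) (simp add: divide_right_mono)
        show ?thesis unfolding min_absorb1[OF a] min_absorb1[OF b] min_absorb1[OF c] by simp
      qed
      then show ?thesis using IH md j by (auto simp: CS)
    qed
  qed
  have mono: "C n i \<subseteq> C n j" if "i \<le> j" for n i j
  proof (rule lift_Suc_mono_le[of "C n", OF _ that])
    show "C n l \<subseteq> C n (Suc l)" for l using main by blast
  qed
  have lift: "C (m + k) (i * 2 ^ k) = C m i" for m k i
  proof (induction k)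
    case (Suc k)
    have "i * 2 ^ Suc k = 2 * (i * 2 ^ k)" by simp
    then show ?case using Suc by (simp only: add_Suc_right CS) simp
  qed simp
  show thesis
  proof (rule that[of C])
    fix m i n j :: nat assume "i * 2 ^ n \<le> j * 2 ^ m"
    then have "C (m + n) (i * 2 ^ n) \<subseteq> C (m + n) (j * 2 ^ m)" by (rule mono)
    then show "C m i \<subseteq> C n j" using lift[of m n i] lift[of n m j] by (simp add: add.commute)
  qed (use main C0 in auto)
qed

text \<open>The variable at \<open>x\<close> is the infimum of the dyadic rationals whose set in the chain contains \<open>x\<close>.
  The boundary values 0 and 1 are taken on null sets only and are redefined, so that functions on the
  open unit interval can be composed with the variable.\<close>

lemma uniform_variable:
  obtains V where "V \<in> borel_measurable M" "\<And>x. 0 < V x \<and> V x < 1"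
    "\<And>A. A \<in> sets borel \<Longrightarrow> emeasure M {x\<in>space M. V x \<in> A} = emeasure unit_measure {t\<in>space unit_measure. t \<in> A}"
proof -
  obtain C :: "nat \<Rightarrow> nat \<Rightarrow> 'a set" where Cs: "\<And>n j. C n j \<in> sets M"
    and Cp: "\<And>n j. prob (C n j) = min 1 (real j / 2 ^ n)"
    and C01: "C 0 1 = space M" and Cm: "\<And>m i n j. i * 2 ^ n \<le> j * 2 ^ m \<Longrightarrow> C m i \<subseteq> C n j"
    by (rule dyadic_chain) (assumption | blast intro: that)+
  define S where "S x = {real j / 2 ^ n | j n. x \<in> C n j}" for x
  define W where "W x = Inf (S x)" for x
  have ne: "1 \<in> S x" if "x \<in> space M" for x
  proof -
    have "x \<in> C 0 1" using that C01 by simp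
    then show ?thesis unfolding S_def by (intro CollectI exI[of _ 1] exI[of _ 0]) simp
  qed
  have bdd: "bdd_below (S x)" for x by (auto intro!: bdd_belowI[of _ 0] simp: S_def)
  have Wt: "{x\<in>space M. W x < t} = (\<Union>(n, j)\<in>{(n, j). real j / 2 ^ n < t}. C n j)" for t
  proof (intro equalityI subsetI)
    fix x assume "x \<in> {x\<in>space M. W x < t}"
    then have x: "x \<in> space M" "Inf (S x) < t" by (auto simp: W_def)
    then obtain s where "s \<in> S x" "s < t" using cInf_less_iff[of "S x" t] ne[of x] bdd by auto
    then show "x \<in> (\<Union>(n, j)\<in>{(n, j). real j / 2 ^ n < t}. C n j)" by (auto simp: S_def)
  next
    fix x assume "x \<in> (\<Union>(n, j)\<in>{(n, j). real j / 2 ^ n < t}. C n j)"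
    then obtain n j where nj: "x \<in> C n j" "real j / 2 ^ n < t" by auto
    then have "W x \<le> real j / 2 ^ n" unfolding W_def using bdd by (intro cInf_lower) (auto simp: S_def)
    then show "x \<in> {x\<in>space M. W x < t}" using nj sets.sets_into_space[OF Cs] by auto
  qed
  have [measurable]: "W \<in> borel_measurable M"
    unfolding borel_measurable_iff_less Wt using Cs by (auto intro!: sets.countable_UN')
  have Wp: "prob {x\<in>space M. W x < t} = t" if t: "0 < t" "t \<le> 1" for t
  proof -
    have bounds: "t - (1 / 2) ^ n \<le> prob {x\<in>space M. W x < t} \<and> prob {x\<in>space M. W x < t} \<le> t + (1 / 2) ^ n" for n
    proof
      define j where "j = nat \<lceil>t * 2 ^ n\<rceil>"
      have pos: "0 < t * 2 ^ n" using t by simp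
      then have j: "real j = of_int \<lceil>t * 2 ^ n\<rceil>" "0 < j" by (auto simp: j_def)
      have j1: "t * 2 ^ n \<le> real j" "real j < t * 2 ^ n + 1" unfolding j(1) by linarith+
      have less: "real (j - 1) / 2 ^ n < t" using j1(2) j(2) by (simp add: pos_divide_less_eq of_nat_diff)
      have "C n (j - 1) \<subseteq> {x\<in>space M. W x < t}" unfolding Wt using less by auto
      then have "prob (C n (j - 1)) \<le> prob {x\<in>space M. W x < t}" by (intro finite_measure_mono) auto
      moreover have "t - (1 / 2) ^ n \<le> real (j - 1) / 2 ^ n"
        using j1(1) j(2) by (simp add: field_simps of_nat_diff)
      ultimately show "t - (1 / 2) ^ n \<le> prob {x\<in>space M. W x < t}" using less t by (simp add: Cp)
      have "{x\<in>space M. W x < t} \<subseteq> C n j"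
      proof -
        have "C m i \<subseteq> C n j" if "real i / 2 ^ m < t" for m i
        proof (rule Cm)
          have "real i < t * 2 ^ m" using that by (simp add: pos_divide_less_eq)
          then have "real i * 2 ^ n \<le> (t * 2 ^ m) * 2 ^ n" by (intro mult_right_mono) auto
          also have "\<dots> = (t * 2 ^ n) * 2 ^ m" by simp
          also have "\<dots> \<le> real j * 2 ^ m" using j1(1) by (intro mult_right_mono) auto
          finally have "real (i * 2 ^ n) \<le> real (j * 2 ^ m)" by simp
          then show "i * 2 ^ n \<le> j * 2 ^ m" by (simp only: of_nat_le_iff)
        qed
        then show ?thesis unfolding Wt by auto
      qed
      then have "prob {x\<in>space M. W x < t} \<le> prob (C n j)" using Cs by (intro finite_measure_mono)
      also have "\<dots> \<le> real j / 2 ^ n" by (simp add: Cp)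
      also have "\<dots> \<le> t + (1 / 2) ^ n" using j1(2) by (simp add: field_simps)
      finally show "prob {x\<in>space M. W x < t} \<le> t + (1 / 2) ^ n" .
    qed
    have half: "(\<lambda>n. (1 / 2) ^ n :: real) \<longlonglongrightarrow> 0" by (intro LIMSEQ_realpow_zero) auto
    have "(\<lambda>n. t - (1 / 2) ^ n) \<longlonglongrightarrow> t - 0" "(\<lambda>n. t + (1 / 2) ^ n) \<longlonglongrightarrow> t + 0"
      by (intro tendsto_intros half)+
    then have "t - 0 \<le> prob {x\<in>space M. W x < t}" "prob {x\<in>space M. W x < t} \<le> t + 0"
      using bounds by (auto intro: LIMSEQ_le_const LIMSEQ_le_const2)
    then show ?thesis by simp
  qed
  define V where "V x = (if 0 < W x \<and> W x < 1 then W x else 1 / 2)" for x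
  have [measurable]: "V \<in> borel_measurable M" unfolding V_def by measurable
  have V01: "0 < V x \<and> V x < 1" for x by (auto simp: V_def)
  have "prob {x\<in>space M. W x < 1} = 1" using Wp[of 1] by simp
  then have "AE x in M. W x < 1" by (subst (asm) prob_Collect_eq_1) auto
  moreover have "AE x in M. 0 < W x"
  proof -
    have "prob {x\<in>space M. W x \<le> 0} \<le> e" if "0 < e" "e \<le> 1" for e
    proof -
      have "prob {x\<in>space M. W x \<le> 0} \<le> prob {x\<in>space M. W x < e}"
        using that by (intro finite_measure_mono) auto
      then show ?thesis using Wp[OF that] by simp
    qed
    note small = this[of "prob {x\<in>space M. W x \<le> 0} / 2"]
    have "prob {x\<in>space M. W x \<le> 0} = 0"
    proof (rule ccontr)
      assume "prob {x\<in>space M. W x \<le> 0} \<noteq> 0"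
      then have "0 < prob {x\<in>space M. W x \<le> 0}" by (simp add: zero_less_measure_iff)
      then show False using small prob_le_1[of "{x\<in>space M. W x \<le> 0}"] by linarith
    qed
    then have "AE x in M. \<not> W x \<le> 0" by (subst (asm) prob_Collect_eq_0) auto
    then show ?thesis by eventually_elim simp
  qed
  ultimately have VW: "AE x in M. V x = W x" by eventually_elim (simp add: V_def)
  have id[measurable]: "(\<lambda>t. t) \<in> borel_measurable unit_measure"
    by (intro borel_unit_measurable measurable_restrict_space1) simp
  let ?P = "distr M borel V" and ?Q = "distr unit_measure borel (\<lambda>t. t)"
  interpret P: prob_space ?P by (rule prob_space_distr) measurable
  have "?P = ?Q"
  proof (rule measure_eqI_generator_eq[where E="range lessThan" and \<Omega>=UNIV and A="\<lambda>n. {..<real n}"])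
    show "Int_stable (range lessThan :: real set set)"
    proof (rule Int_stableI_image)
      show "\<exists>k\<in>UNIV. {..<i} \<inter> {..<j} = {..<k}" for i j :: real
        by (intro bexI[of _ "min i j"]) auto
    qed
    show "sets ?P = sigma_sets UNIV (range lessThan)" "sets ?Q = sigma_sets UNIV (range lessThan)"
      by (simp_all add: borel_Iio)
    show "(\<Union>n. {..<real n}) = UNIV" using reals_Archimedean2 by auto
    fix X :: "real set" assume "X \<in> range lessThan"
    then obtain t where X: "X = {..<t}" by auto
    have P: "emeasure ?P X = emeasure M {x\<in>space M. V x < t}"
      by (simp add: X emeasure_distr) (rule arg_cong[of _ _ "emeasure M"], auto)
    have Q: "emeasure ?Q X = emeasure unit_measure {s\<in>space unit_measure. s < t}"
      by (simp add: X emeasure_distr) (rule arg_cong[of _ _ "emeasure unit_measure"], auto)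
    consider "t \<le> 0" | "0 < t" "t \<le> 1" | "1 < t" by linarith
    then show "emeasure ?P X = emeasure ?Q X"
    proof cases
      case 1
      then have "{x\<in>space M. V x < t} = {}" "{s\<in>space unit_measure. s < t} = {}"
        using V01 by (auto simp: not_less intro: order_trans less_imp_le)
      then show ?thesis unfolding P Q by (simp only: emeasure_empty)
    next
      case 2
      have "emeasure M {x\<in>space M. V x < t} = emeasure M {x\<in>space M. W x < t}"
        using VW by (intro emeasure_eq_AE) auto
      moreover have "{s\<in>space unit_measure. s < t} = {0<..<t}" using 2 by auto
      ultimately show ?thesis unfolding P Q using Wp[OF 2] 2 by (simp add: emeasure_eq_measure emeasure_unit_interval)
    next
      case 3
      then have "{x\<in>space M. V x < t} = space M" "{s\<in>space unit_measure. s < t} = space unit_measure"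
        using V01 by (auto intro: less_trans)
      then show ?thesis unfolding P Q by (simp only: emeasure_space_1 unit.emeasure_space_1)
    qed
  qed (auto simp: P.emeasure_eq_measure)
  have "emeasure M {x\<in>space M. V x \<in> A} = emeasure unit_measure {t\<in>space unit_measure. t \<in> A}"
    if A: "A \<in> sets borel" for A
  proof -
    have "emeasure M {x\<in>space M. V x \<in> A} = emeasure ?P A"
      using A by (subst emeasure_distr) (auto intro!: arg_cong[of _ _ "emeasure M"])
    also have "\<dots> = emeasure ?Q A" using \<open>?P = ?Q\<close> by simp
    also have "\<dots> = emeasure unit_measure {t\<in>space unit_measure. t \<in> A}"
      using A id by (subst emeasure_distr) (auto intro!: arg_cong[of _ _ "emeasure unit_measure"])
    finally show ?thesis .
  qed
  then show thesis using V01 by (intro that[of V]) auto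
qed

text \<open>Hence every decreasing function on the unit interval is, up to equimeasurability, a function
  on the given space.\<close>

lemma rearr_uniform:
  assumes V[measurable]: "V \<in> borel_measurable M" and V01: "\<And>x. 0 < V x \<and> V x < 1"
    and VA: "\<And>A. A \<in> sets borel \<Longrightarrow> emeasure M {x\<in>space M. V x \<in> A} = emeasure unit_measure {t\<in>space unit_measure. t \<in> A}"
    and d: "d \<in> dplus"
  shows "(\<lambda>x. complex_of_real (d (V x))) \<in> borel_measurable M"
    and "rearr M (\<lambda>x. complex_of_real (d (V x))) = rearr unit_measure d"
proof -
  define e where "e t = indicator {0<..<1} t * d t" for t :: real
  have [measurable]: "e \<in> borel_measurable borel" unfolding e_def using d by (rule dplus_borel_indicator)
  have ed: "e (V x) = d (V x)" for x using V01 by (simp add: e_def)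
  have "(\<lambda>x. complex_of_real (e (V x))) \<in> borel_measurable M" by measurable
  then show "(\<lambda>x. complex_of_real (d (V x))) \<in> borel_measurable M" by (simp add: ed)
  show "rearr M (\<lambda>x. complex_of_real (d (V x))) = rearr unit_measure d"
  proof (rule rearr_cong_distr)
    fix s :: real assume s: "0 < s"
    have A: "{t. s < \<bar>e t\<bar>} \<in> sets borel" by measurable
    have "{x\<in>space M. s < norm (complex_of_real (d (V x)))} = {x\<in>space M. V x \<in> {t. s < \<bar>e t\<bar>}}"
      by (auto simp: ed)
    moreover have "{t\<in>space unit_measure. s < norm (d t)} = {t\<in>space unit_measure. t \<in> {t. s < \<bar>e t\<bar>}}"
      by (auto simp: e_def)
    ultimately show "emeasure M {x\<in>space M. s < norm (complex_of_real (d (V x)))} =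
        emeasure unit_measure {t\<in>space unit_measure. s < norm (d t)}"
      using VA[OF A] by simp
  qed
qed

end

section \<open>Powers on the extended half-line\<close>

lemma epowr_ennreal: "0 \<le> x \<Longrightarrow> epowr (ennreal x) a = ennreal (x powr a)"
  by (simp add: epowr_def)

lemma epowr_top [simp]: "epowr \<top> a = \<top>"
  by (simp add: epowr_def)

lemma epowr_0 [simp]: "epowr 0 a = 0"
  by (simp add: epowr_def)

lemma epowr_mono: "0 \<le> a \<Longrightarrow> x \<le> y \<Longrightarrow> epowr x a \<le> epowr y a"
  by (cases x; cases y) (auto simp: epowr_ennreal top_unique intro!: powr_mono2)

lemma epowr_epowr: "epowr (epowr x a) b = epowr x (a * b)"
  by (cases x) (auto simp: epowr_ennreal powr_powr)

lemma epowr_1 [simp]: "epowr x 1 = x"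
  by (cases x) (auto simp: epowr_ennreal)

lemma epowr_inverse:
  assumes "0 < p"
  shows "epowr (epowr x p) (1 / p) = x" "epowr (epowr x (1 / p)) p = x"
  using assms by (simp_all add: epowr_epowr)

lemma epowr_mult: "0 \<le> c \<Longrightarrow> 0 < a \<Longrightarrow> epowr (ennreal c * x) a = ennreal (c powr a) * epowr x a"
proof (cases x)
  case (real r)
  assume "0 \<le> c" "0 < a"
  then show ?thesis using real by (simp add: epowr_ennreal powr_mult flip: ennreal_mult)
next
  case top
  assume "0 \<le> c" "0 < a"
  then show ?thesis using top by (cases "c = 0") (auto simp: ennreal_mult_top)
qed

lemma epowr_less_top_iff [simp]: "epowr x a < \<top> \<longleftrightarrow> x < \<top>"
  by (cases x) (auto simp: epowr_ennreal)

lemma epowr_le_multI: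
  assumes "0 < p" "0 \<le> C" "epowr x p \<le> ennreal C * epowr y p"
  shows "x \<le> ennreal (C powr (1 / p)) * y"
proof -
  have "epowr (epowr x p) (1 / p) \<le> epowr (ennreal C * epowr y p) (1 / p)"
    using assms by (intro epowr_mono) auto
  then show ?thesis using assms by (simp add: epowr_inverse epowr_mult)
qed

lemma powr_add_le:
  fixes a b p :: real
  assumes "0 \<le> a" "0 \<le> b" "0 < p"
  shows "(a + b) powr p \<le> 2 powr p * (a powr p + b powr p)"
proof -
  have "(a + b) powr p \<le> (2 * max a b) powr p" using assms by (intro powr_mono2) auto
  also have "\<dots> = 2 powr p * (max a b) powr p" using assms by (simp add: powr_mult)
  also have "\<dots> \<le> 2 powr p * (a powr p + b powr p)"
    by (intro mult_left_mono) (auto simp: max_def)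
  finally show ?thesis .
qed

lemma le_mult_Inf:
  fixes x :: ennreal
  assumes "0 < C" and le: "\<And>v. v \<in> A \<Longrightarrow> x \<le> ennreal C * v"
  shows "x \<le> ennreal C * Inf A"
proof -
  have 1: "ennreal (1 / C) * ennreal C = 1" "ennreal C * ennreal (1 / C) = 1"
    using assms(1) by (simp_all flip: ennreal_mult')
  have "ennreal (1 / C) * x \<le> Inf A"
  proof (rule Inf_greatest)
    fix v assume "v \<in> A"
    then have "ennreal (1 / C) * x \<le> ennreal (1 / C) * (ennreal C * v)" by (intro mult_left_mono le) auto
    also have "\<dots> = v" using 1 by (simp flip: mult.assoc)
    finally show "ennreal (1 / C) * x \<le> v" .
  qed
  then have "ennreal C * (ennreal (1 / C) * x) \<le> ennreal C * Inf A" by (intro mult_left_mono) auto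
  moreover have "ennreal C * (ennreal (1 / C) * x) = x" using 1 by (simp flip: mult.assoc)
  ultimately show ?thesis by simp
qed

section \<open>The weights\<close>

lemma Lq_norm_real: "0 < p \<Longrightarrow> Lq_norm (ennreal p) M f = epowr (\<integral>\<^sup>+x. ennreal (norm (f x) powr p) \<partial>M) (1 / p)"
  by (simp add: Lq_norm_def)

lemma (in prob_space) nn_integral_powr_rearr:
  fixes f :: "'a \<Rightarrow> complex" and p :: real
  assumes [measurable]: "f \<in> borel_measurable M"
  shows "(\<integral>\<^sup>+x. ennreal (norm (f x) powr p) \<partial>M) = (\<integral>\<^sub>1t. ennreal (rearr M f t powr p))"
  by (rule nn_integral_rearr[where \<Theta>="\<lambda>r. ennreal (r powr p)"]; measurable)

lemma nn_integral_lebesgue_unit: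
  assumes "b \<le> 1"
  shows "(\<integral>\<^sup>+s\<in>{0<..<b}. f s \<partial>lebesgue) = (\<integral>\<^sub>1s. f s * indicator {0<..<b} s)"
  using assms by (subst nn_integral_restrict_space) (auto intro!: nn_integral_cong simp: indicator_def)

text \<open>The derivative of \<open>Phi\<close> is positive, so the change of variables shows that preimages of null
  sets are null sets.\<close>

lemma AE_Phi:
  assumes B: "{u\<in>{0<..<1}. \<not> P u} \<in> sets borel" and ae: "AE u in unit_measure. P u"
  shows "AE s in unit_measure. P (Phi s)"
proof -
  have [measurable]: "ell \<in> borel_measurable borel" unfolding ell_def by measurable
  define g where "g u = (indicator {u\<in>{0<..<1}. \<not> P u} u :: ennreal)" for u
  have gb[measurable]: "g \<in> borel_measurable borel" unfolding g_def using B by measurable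
  have "(\<integral>\<^sub>1s. g (Phi s) * ennreal (ell s) * indicator {0<..<1} s) =
      2 * (\<integral>\<^sub>1u. g u * indicator {0<..<Phi 1} u)"
    by (intro nn_integral_Phi measurable_restrict_space1 gb) auto
  also have "(\<integral>\<^sub>1u. g u * indicator {0<..<Phi 1} u) = (\<integral>\<^sub>1u. 0)"
    using ae by (intro nn_integral_cong_AE) (auto elim!: eventually_mono simp: g_def)
  finally have "(\<integral>\<^sub>1s. g (Phi s) * ennreal (ell s) * indicator {0<..<1} s) = 0" by simp
  moreover have "(\<lambda>s. g (Phi s) * ennreal (ell s) * indicator {0<..<1} s) \<in> borel_measurable unit_measure"
  proof -
    have "(\<lambda>s. g (Phi s) * ennreal (ell s) * indicator {0<..<1} s) \<in> borel_measurable lebesgue"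
      by (rule measurable_completion) measurable
    then show ?thesis by (rule measurable_restrict_space1)
  qed
  ultimately have "AE s in unit_measure. g (Phi s) * ennreal (ell s) * indicator {0<..<1} s = 0"
    by (subst (asm) nn_integral_0_iff_AE) auto
  then show ?thesis
  proof (rule AE_mp, intro AE_unitI impI)
    fix s :: real assume s: "0 < s" "s < 1" and "g (Phi s) * ennreal (ell s) * indicator {0<..<1} s = 0"
    then show "P (Phi s)" using ell_ge_1[of s] Phi_range[OF s] by (auto simp: g_def ennreal_eq_0_iff indicator_def split: if_splits)
  qed
qed

lemma nn_integral_half:
  assumes q: "q \<in> borel_measurable (restrict_space borel {0<..<1})" and y: "0 < y" "y < 1"
  shows "(\<integral>\<^sub>1s. q (s / 2) * indicator {0<..<y} s) = 2 * (\<integral>\<^sub>1s. q s * indicator {0<..<y / 2} s)"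
proof -
  define g where "g s = q s * indicator {0<..<1} s * indicator {0<..<y / 2} s" for s :: real
  have [measurable]: "g \<in> borel_measurable borel" unfolding g_def
    using q by (subst (asm) borel_measurable_restrict_space_iff_ennreal) auto
  have "(\<integral>\<^sub>1s. q (s / 2) * indicator {0<..<y} s) = (\<integral>\<^sub>1s. g (s / 2))"
    using y by (intro nn_integral_cong) (auto simp: g_def indicator_def)
  also have "\<dots> = (\<integral>\<^sup>+s. g (s / 2) * indicator {0<..<1} s \<partial>lborel)"
    by (intro nn_integral_unit_lborel measurable_restrict_space1) measurable
  also have "\<dots> = (\<integral>\<^sup>+s. g (0 + 1 / 2 * s) \<partial>lborel)"
    using y by (intro nn_integral_cong) (auto simp: g_def indicator_def)
  finally have 1: "(\<integral>\<^sub>1s. q (s / 2) * indicator {0<..<y} s) = \<dots>" .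
  have "(\<integral>\<^sub>1s. q s * indicator {0<..<y / 2} s) = (\<integral>\<^sub>1s. g s)"
    by (intro nn_integral_cong) (auto simp: g_def indicator_def)
  also have "\<dots> = (\<integral>\<^sup>+s. g s * indicator {0<..<1} s \<partial>lborel)"
    by (intro nn_integral_unit_lborel measurable_restrict_space1) measurable
  also have "\<dots> = (\<integral>\<^sup>+s. g s \<partial>lborel)"
    by (intro nn_integral_cong) (auto simp: g_def indicator_def)
  also have "\<dots> = ennreal \<bar>1 / 2\<bar> * (\<integral>\<^sup>+s. g (0 + 1 / 2 * s) \<partial>lborel)"
    by (rule nn_integral_real_affine) auto
  finally have 2: "(\<integral>\<^sub>1s. q s * indicator {0<..<y / 2} s) = \<dots>" .
  have "2 * ennreal \<bar>1 / 2\<bar> = 1" using ennreal_mult'[of 2 "1 / 2"] by simp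
  then show ?thesis unfolding 1 2 by (simp flip: mult.assoc)
qed

locale gauss_weights =
  fixes p \<alpha> \<beta> :: real and b1 b2 :: "real \<Rightarrow> real"
  assumes p: "0 < p" and \<alpha>: "0 \<le> \<alpha>" "\<alpha> < 1 / p" and \<beta>: "\<beta> = 1 / p - \<alpha>"
    and b1: "b1 = (\<lambda>t. ell t powr \<alpha>)" and b2: "b2 = (\<lambda>t. ell t powr (- \<beta>))"
begin

abbreviation Lp :: "'c measure \<Rightarrow> ('c \<Rightarrow> complex) set" where
  "Lp M \<equiv> fspace M (Lq_norm (ennreal p) M)"

abbreviation K_unweighted :: "'c measure \<Rightarrow> ('c \<Rightarrow> complex) \<Rightarrow> real \<Rightarrow> ennreal" where
  "K_unweighted M \<equiv> K_functional M (Lq_norm (ennreal p) M) (Lq_norm \<infinity> M)"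

abbreviation K_weighted :: "'c measure \<Rightarrow> ('c \<Rightarrow> complex) \<Rightarrow> real \<Rightarrow> ennreal" where
  "K_weighted M \<equiv> K_functional M (weighted_norm (ennreal p) b1 M) (weighted_norm \<infinity> b2 M)"

text \<open>The \<open>p\<close>-th powers of \<open>b1\<close> and of \<open>1 / b2\<close>.\<close>

definition w :: "real \<Rightarrow> real" where "w t = ell t powr (\<alpha> * p)"

definition u :: "real \<Rightarrow> real" where "u t = ell t powr (\<beta> * p)"

lemma exponents: "0 \<le> \<alpha> * p" "\<alpha> * p < 1" "0 < \<beta> * p" "\<beta> * p \<le> 1" "\<alpha> * p + \<beta> * p = 1" "0 < \<beta>"
  using p \<alpha> by (auto simp: \<beta> field_simps)

lemma ell_pos: "0 < t \<Longrightarrow> t < 1 \<Longrightarrow> 0 < ell t"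
  using ell_ge_1[of t] by simp

lemma w_ge_1: "0 < t \<Longrightarrow> t < 1 \<Longrightarrow> 1 \<le> w t"
  using ell_ge_1[of t] exponents by (simp add: w_def ge_one_powr_ge_zero)

lemma u_ge_1: "0 < t \<Longrightarrow> t < 1 \<Longrightarrow> 1 \<le> u t"
  using ell_ge_1[of t] exponents by (simp add: u_def ge_one_powr_ge_zero)

lemma w_antimono: "0 < s \<Longrightarrow> s \<le> t \<Longrightarrow> t < 1 \<Longrightarrow> w t \<le> w s"
  using ell_antimono[of s t] ell_pos[of t] exponents by (simp add: w_def powr_mono2)

lemma w_u: "0 < t \<Longrightarrow> t < 1 \<Longrightarrow> w t * u t = ell t"
  using ell_pos[of t] exponents by (simp add: w_def u_def flip: powr_add)

lemma b1_powr: "b1 t powr p = w t"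
  by (simp add: b1 w_def powr_powr)

lemma b1_nonneg [simp]: "0 \<le> b1 t" and b2_nonneg [simp]: "0 \<le> b2 t"
  by (simp_all add: b1 b2)

lemma quotient_b2: "x / b2 t = x * ell t powr \<beta>"
  by (simp add: b2 powr_minus divide_inverse)

lemma quotient_powr: "0 < t \<Longrightarrow> t < 1 \<Longrightarrow> (b1 t / b2 t) powr p = ell t"
  using ell_pos[of t] p by (simp add: quotient_b2 b1 \<beta> powr_powr flip: powr_add)

lemma sigma_tau: "0 < s \<Longrightarrow> s < 1 \<Longrightarrow> sigma b1 b2 p (s powr (1 / p)) powr p = tau s"
  by (rule sigma_powr(1)[OF p quotient_powr])

lemma sigma_inv_Phi: "0 < s \<Longrightarrow> s < 1 \<Longrightarrow> sigma_inv b1 b2 p (s powr (1 / p)) powr p = Phi s"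
  by (rule sigma_powr(2)[OF p quotient_powr])

lemma ell_measurable [measurable]: "ell \<in> borel_measurable borel"
  unfolding ell_def by measurable

lemma w_measurable [measurable]: "w \<in> borel_measurable borel"
  unfolding w_def by measurable

lemma u_measurable [measurable]: "u \<in> borel_measurable borel"
  unfolding u_def by measurable

lemma dplus_powr: "f \<in> dplus \<Longrightarrow> 0 < q \<Longrightarrow> (\<lambda>t. f t powr q) \<in> dplus"
  using dplus_antimono[of f] dplus_nonneg[of f] by (intro dplusI) (auto intro: powr_mono2)

lemma dplus_compose_Phi:
  assumes f: "f \<in> dplus" and q: "0 \<le> q"
  shows "(\<lambda>t. f (Phi t) * ell t powr q) \<in> dplus"
proof (rule dplusI)
  fix s t :: real assume st: "0 < s" "s \<le> t" "t < 1"
  then have 1: "0 < Phi s" "Phi s \<le> Phi t" "Phi t < 1"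
    using Phi_range[of s] Phi_range[of t] Phi_le_iff[of s t] by auto
  show "f (Phi t) * ell t powr q \<le> f (Phi s) * ell s powr q"
    using dplus_antimono[OF f 1] dplus_nonneg[OF f, of "Phi s"] 1 st q ell_pos[of t] ell_antimono[of s t]
    by (intro mult_mono powr_mono2) auto
next
  fix t :: real assume "0 < t" "t < 1"
  then show "0 \<le> f (Phi t) * ell t powr q"
    using dplus_nonneg[OF f, of "Phi t"] Phi_range[of t] by simp
qed

lemma powr_compose_Phi:
  assumes "f \<in> dplus" "0 < t" "t < 1"
  shows "(f (Phi t) * ell t powr \<beta>) powr p = f (Phi t) powr p * u t"
  using dplus_nonneg[OF assms(1), of "Phi t"] Phi_range[of t] assms(2,3)
  by (simp add: powr_mult powr_powr u_def)

text \<open>On the right of the gaussibility condition the \<open>p\<close>-th power of \<open>b1 / b2\<close> is \<open>ell\<close>, twice the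
  derivative of \<open>Phi\<close>, and the argument of \<open>f\<^sup>*\<close> is \<open>Phi\<close>: the integral is one of \<open>f\<^sup>*\<close> alone, extended
  up to \<open>Phi t\<close>.\<close>

lemma gaussible_iff:
  fixes M :: "'a measure" and M' :: "'b measure"
  assumes M: "prob_space M"
  shows "gaussible p b1 b2 M M' T \<longleftrightarrow>
    is_operator M (Lp M) M' T \<and>
    (\<exists>C>0. \<forall>f\<in>Lp M. \<forall>t\<in>{0<..<1}.
      (\<integral>\<^sub>1s. ennreal ((rearr M' (T f) s * b1 s) powr p) * indicator {0<..<t} s) \<le>
      ennreal C * (\<integral>\<^sub>1s. ennreal (rearr M f s powr p) * indicator {0<..<Phi t} s))"
proof -
  interpret prob_space M by fact
  let ?Lp = "Lp M"
  define L where "L f t = (\<integral>\<^sub>1s. ennreal ((rearr M' (T f) s * b1 s) powr p) * indicator {0<..<t} s)" for f :: "'a \<Rightarrow> complex" and t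
  define R where "R f t = (\<integral>\<^sub>1s. ennreal (rearr M f s powr p) * indicator {0<..<Phi t} s)" for f :: "'a \<Rightarrow> complex" and t
  have l: "(\<integral>\<^sup>+s\<in>{0<..<t}. ennreal ((rearr M' (T f) s * b1 s) powr p) \<partial>lebesgue) = L f t" if "t < 1" for t f
    unfolding L_def using that by (intro nn_integral_lebesgue_unit) simp
  have r: "(\<integral>\<^sup>+s\<in>{0<..<t}. ennreal ((rearr M f (sigma_inv b1 b2 p (s powr (1 / p)) powr p) * (b1 s / b2 s)) powr p) \<partial>lebesgue) = 2 * R f t"
    if t: "0 < t" "t < 1" and f: "f \<in> ?Lp" for t f
  proof -
    have fd: "rearr M f \<in> dplus" using f by (intro rearr_dplus) (auto simp: fspace_def)
    have "(\<integral>\<^sup>+s\<in>{0<..<t}. ennreal ((rearr M f (sigma_inv b1 b2 p (s powr (1 / p)) powr p) * (b1 s / b2 s)) powr p) \<partial>lebesgue) =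
        (\<integral>\<^sub>1s. ennreal ((rearr M f (sigma_inv b1 b2 p (s powr (1 / p)) powr p) * (b1 s / b2 s)) powr p) * indicator {0<..<t} s)"
      using t by (intro nn_integral_lebesgue_unit) simp
    also have "\<dots> = (\<integral>\<^sub>1s. ennreal (rearr M f (Phi s) powr p) * ennreal (ell s) * indicator {0<..<t} s)"
    proof (intro nn_integral_cong)
      fix s assume "s \<in> space unit_measure"
      then have s: "0 < s" "s < 1" by auto
      have "(rearr M f (Phi s) * (b1 s / b2 s)) powr p = rearr M f (Phi s) powr p * (b1 s / b2 s) powr p"
        by (rule powr_mult)
      then show "ennreal ((rearr M f (sigma_inv b1 b2 p (s powr (1 / p)) powr p) * (b1 s / b2 s)) powr p) * indicator {0<..<t} s =
          ennreal (rearr M f (Phi s) powr p) * ennreal (ell s) * indicator {0<..<t} s"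
        using s by (simp add: sigma_inv_Phi quotient_powr ennreal_mult')
    qed
    also have "\<dots> = 2 * R f t"
      unfolding R_def using t dplus_borel[OF dplus_powr[OF fd p]]
      by (intro nn_integral_Phi[where h="\<lambda>s. ennreal (rearr M f s powr p)"] measurable_compose[OF _ measurable_ennreal]) auto
    finally show ?thesis .
  qed
  have "(\<exists>C>0. \<forall>f\<in>?Lp. \<forall>t\<in>{0<..<1}. L f t \<le> ennreal C * (2 * R f t)) \<longleftrightarrow>
      (\<exists>C>0. \<forall>f\<in>?Lp. \<forall>t\<in>{0<..<1}. L f t \<le> ennreal C * R f t)" (is "?A \<longleftrightarrow> ?B")
  proof
    assume ?A
    then obtain C where C: "0 < C" "\<forall>f\<in>?Lp. \<forall>t\<in>{0<..<1}. L f t \<le> ennreal C * (2 * R f t)" by blast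
    moreover have "ennreal C * (2 * x) = ennreal (C * 2) * x" for x
      using C(1) by (simp add: ennreal_mult' mult.assoc)
    ultimately show ?B by (intro exI[of _ "C * 2"]) auto
  next
    assume ?B
    then obtain C where C: "0 < C" "\<forall>f\<in>?Lp. \<forall>t\<in>{0<..<1}. L f t \<le> ennreal C * R f t" by blast
    moreover have "ennreal (C / 2) * (2 * x) = ennreal C * x" for x
      using C(1) by (simp add: ennreal_mult'[of 2, symmetric] flip: mult.assoc ennreal_numeral ennreal_mult')
    ultimately show ?A by (intro exI[of _ "C / 2"]) auto
  qed
  moreover have "(\<forall>f\<in>?Lp. \<forall>t\<in>{0<..<1}.
        (\<integral>\<^sup>+s\<in>{0<..<t}. ennreal ((rearr M' (T f) s * b1 s) powr p) \<partial>lebesgue) \<le> ennreal C *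
          (\<integral>\<^sup>+s\<in>{0<..<t}. ennreal ((rearr M f (sigma_inv b1 b2 p (s powr (1 / p)) powr p) * (b1 s / b2 s)) powr p) \<partial>lebesgue)) \<longleftrightarrow>
      (\<forall>f\<in>?Lp. \<forall>t\<in>{0<..<1}. L f t \<le> ennreal C * (2 * R f t))" for C
    by (intro ball_cong refl) (simp only: l r greaterThanLessThan_iff)
  ultimately show ?thesis
    unfolding gaussible_def L_def R_def by (simp only:)
qed

end

section \<open>The two K-functionals\<close>

context gauss_weights
begin

text \<open>Decompose \<open>f\<close> according to whether its modulus exceeds \<open>f\<^sup>*(v)\<close>. The rearrangement of the large
  part is carried by \<open>(0,v)\<close>, and there \<open>f\<^sup>*\<close> is at least \<open>f\<^sup>*(v)\<close>, so that the integral controls both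
  parts.\<close>

lemma K_Lp_Linf_le:
  fixes M :: "'a measure" and f :: "'a \<Rightarrow> complex"
  assumes M: "prob_space M" and f: "f \<in> Lp M" and v: "0 < v" "v < 1"
  shows "K_unweighted M f (v powr (1 / p)) \<le>
    2 * epowr (\<integral>\<^sub>1s. ennreal (rearr M f s powr p) * indicator {0<..<v} s) (1 / p)"
proof -
  interpret prob_space M by fact
  have [measurable]: "f \<in> borel_measurable M" using f by (simp add: fspace_def)
  have fm: "(\<lambda>x. norm (f x)) \<in> borel_measurable M" by measurable
  define l where "l = rearr M f v"
  have l0: "0 \<le> l" unfolding l_def using rearr_nonneg[OF fm] v by simp
  note fd = rearr_dplus[OF fm]
  let ?I = "\<integral>\<^sub>1s. ennreal (rearr M f s powr p) * indicator {0<..<v} s"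
  define g where "g x = (if l < norm (f x) then f x else 0)" for x
  define h where "h x = (if l < norm (f x) then 0 else f x)" for x
  have [measurable]: "g \<in> borel_measurable M" "h \<in> borel_measurable M"
    unfolding g_def h_def by measurable
  have "(\<integral>\<^sup>+x. ennreal (norm (g x) powr p) \<partial>M) =
      (\<integral>\<^sup>+x. (if l < norm (f x) then ennreal (norm (f x) powr p) else 0) \<partial>M)"
    by (intro nn_integral_cong) (auto simp: g_def)
  also have "\<dots> = (\<integral>\<^sub>1s. (if l < rearr M f s then ennreal (rearr M f s powr p) else 0))"
    by (rule nn_integral_rearr[OF fm, where \<Theta>="\<lambda>r. if l < r then ennreal (r powr p) else 0"]) measurable
  also have "\<dots> \<le> ?I"
  proof (rule nn_integral_mono)
    fix s assume "s \<in> space unit_measure"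
    then have s: "0 < s" "s < 1" by auto
    have "s < v" if "l < rearr M f s"
    proof (rule ccontr)
      assume "\<not> s < v"
      then show False using dplus_antimono[OF fd v(1), of s] s that by (simp add: l_def)
    qed
    then show "(if l < rearr M f s then ennreal (rearr M f s powr p) else 0) \<le> ennreal (rearr M f s powr p) * indicator {0<..<v} s"
      using s by auto
  qed
  finally have gI: "Lq_norm (ennreal p) M g \<le> epowr ?I (1 / p)"
    using p unfolding Lq_norm_real[OF p] by (intro epowr_mono) auto
  have hl: "Lq_norm \<infinity> M h \<le> ennreal l"
    unfolding Lq_norm_def by (auto intro!: esssup_I AE_I2 ennreal_leI simp: h_def l0)
  have "(\<integral>\<^sub>1s. ennreal (l powr p) * indicator {0<..<v} s) \<le> ?I"
  proof (rule nn_integral_mono)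
    fix s assume "s \<in> space unit_measure"
    then have s: "0 < s" "s < 1" by auto
    show "ennreal (l powr p) * indicator {0<..<v} s \<le> ennreal (rearr M f s powr p) * indicator {0<..<v} s"
      using dplus_antimono[OF fd s(1), of v] v l0 p by (auto simp: indicator_def l_def intro!: ennreal_leI powr_mono2)
  qed
  moreover have "(\<integral>\<^sub>1s. ennreal (l powr p) * indicator {0<..<v} s) = ennreal (l powr p) * ennreal v"
    using v by (subst nn_integral_cmult_indicator) (simp_all add: interval_unit_sets emeasure_unit_interval)
  ultimately have "epowr (ennreal (l powr p * v)) (1 / p) \<le> epowr ?I (1 / p)"
    using p v by (intro epowr_mono) (simp_all add: ennreal_mult')
  also have "epowr (ennreal (l powr p * v)) (1 / p) = ennreal (v powr (1 / p)) * ennreal l"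
    using p v l0 by (subst epowr_ennreal) (simp_all add: powr_mult powr_powr ennreal_mult' mult.commute)
  finally have hI: "ennreal (v powr (1 / p)) * Lq_norm \<infinity> M h \<le> epowr ?I (1 / p)"
    using mult_left_mono[OF hl, of "ennreal (v powr (1 / p))"] by (auto intro: order_trans)
  have "(\<integral>\<^sup>+x. ennreal (norm (g x) powr p) \<partial>M) \<le> (\<integral>\<^sup>+x. ennreal (norm (f x) powr p) \<partial>M)"
    by (intro nn_integral_mono) (auto simp: g_def)
  then have "Lq_norm (ennreal p) M g \<le> Lq_norm (ennreal p) M f"
    using p unfolding Lq_norm_real[OF p] by (intro epowr_mono) auto
  then have "g \<in> Lp M" "h \<in> fspace M (Lq_norm \<infinity> M)"
    using f hl by (auto simp: fspace_def intro: le_less_trans)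
  moreover have "AE x in M. f x = g x + h x" by (auto simp: g_def h_def)
  ultimately have "K_unweighted M f (v powr (1 / p)) \<le>
      Lq_norm (ennreal p) M g + ennreal (v powr (1 / p)) * Lq_norm \<infinity> M h"
    unfolding K_functional_def by (intro Inf_lower) auto
  also have "\<dots> \<le> epowr ?I (1 / p) + epowr ?I (1 / p)" using gI hI by (rule add_mono)
  also have "\<dots> = 2 * epowr ?I (1 / p)" by (simp add: mult_2)
  finally show ?thesis .
qed

text \<open>The rearrangement of a sum at \<open>s\<close> is bounded by the rearrangements of the summands at \<open>s / 2\<close>;
  as the weight decreases, this costs a factor two under the integral. The first summand is then
  estimated by its norm. The second is at most a multiple of \<open>1 / b2\<close>, so it contributes the integral
  of the \<open>p\<close>-th power of \<open>b1 / b2\<close>, which is \<open>ell\<close>, and this is \<open>2 Phi y\<close>. The constant is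
  \<open>6 = 2 + 2 * 2\<close>.\<close>

lemma weighted_integral_le_decomposition:
  fixes M :: "'b measure" and F g h :: "'b \<Rightarrow> complex"
  assumes M: "prob_space M"
    and [measurable]: "F \<in> borel_measurable M" "g \<in> borel_measurable M" "h \<in> borel_measurable M"
    and F: "AE x in M. F x = g x + h x" and fin: "weighted_norm \<infinity> b2 M h < \<infinity>" and y: "0 < y" "y < 1"
  shows "(\<integral>\<^sub>1s. ennreal ((rearr M F s * b1 s) powr p) * indicator {0<..<y} s) \<le>
    ennreal (6 * 2 powr p) * epowr (weighted_norm (ennreal p) b1 M g +
      ennreal (Phi y powr (1 / p)) * weighted_norm \<infinity> b2 M h) p"
proof -
  interpret prob_space M by fact
  have m: "(\<lambda>x. norm (F x)) \<in> borel_measurable M" "(\<lambda>x. norm (g x)) \<in> borel_measurable M" "(\<lambda>x. norm (h x)) \<in> borel_measurable M"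
    by measurable
  note gd = rearr_dplus[OF m(2)] and hd = rearr_dplus[OF m(3)]
  have Phi_y: "0 < Phi y" "Phi y < 1" using Phi_range[OF y] by auto
  let ?n0 = "weighted_norm (ennreal p) b1 M g" and ?n1 = "weighted_norm \<infinity> b2 M h"
  let ?t = "Phi y powr (1 / p)"
  define q0 where "q0 s = rearr M g s powr p * w s" for s
  define q1 where "q1 s = rearr M h s powr p * w s" for s
  have q0: "(\<lambda>s. ennreal (q0 s)) \<in> borel_measurable (restrict_space borel {0<..<1})"
    and q1: "(\<lambda>s. ennreal (q1 s)) \<in> borel_measurable (restrict_space borel {0<..<1})"
    unfolding q0_def q1_def
    by (intro measurable_compose[OF _ measurable_ennreal] borel_measurable_times dplus_borel dplus_powr gd hd p measurable_restrict_space1 w_measurable)+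
  have "(\<integral>\<^sub>1s. ennreal ((rearr M F s * b1 s) powr p) * indicator {0<..<y} s) \<le>
      (\<integral>\<^sub>1s. ennreal (2 powr p) * (ennreal (q0 (s / 2)) * indicator {0<..<y} s + ennreal (q1 (s / 2)) * indicator {0<..<y} s))"
  proof (rule nn_integral_mono)
    fix s assume "s \<in> space unit_measure"
    then have s: "0 < s" "s < 1" by auto
    have 0: "0 \<le> rearr M F s" "0 \<le> rearr M g (s / 2)" "0 \<le> rearr M h (s / 2)"
      using s by (auto intro!: rearr_nonneg m)
    have "rearr M F s \<le> rearr M g (s / 2) + rearr M h (s / 2)"
      using F by (intro rearr_add_le[OF M m] s) (auto elim!: eventually_mono intro: norm_triangle_ineq)
    then have "rearr M F s powr p \<le> (rearr M g (s / 2) + rearr M h (s / 2)) powr p"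
      using 0 p by (intro powr_mono2) auto
    also have "\<dots> \<le> 2 powr p * (rearr M g (s / 2) powr p + rearr M h (s / 2) powr p)"
      using 0 p by (intro powr_add_le) auto
    finally have "rearr M F s powr p * w s \<le> 2 powr p * (rearr M g (s / 2) powr p + rearr M h (s / 2) powr p) * w (s / 2)"
      using w_antimono[of "s / 2" s] w_ge_1[OF s] s by (intro mult_mono) auto
    also have "\<dots> = 2 powr p * (q0 (s / 2) + q1 (s / 2))" by (simp add: q0_def q1_def algebra_simps)
    finally have "(rearr M F s * b1 s) powr p \<le> 2 powr p * (q0 (s / 2) + q1 (s / 2))"
      by (simp add: powr_mult b1_powr)
    then have "ennreal ((rearr M F s * b1 s) powr p) \<le> ennreal (2 powr p * (q0 (s / 2) + q1 (s / 2)))"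
      by (rule ennreal_leI)
    also have "\<dots> = ennreal (2 powr p) * (ennreal (q0 (s / 2)) + ennreal (q1 (s / 2)))"
      using w_ge_1[of "s / 2"] s by (simp add: ennreal_mult' q0_def q1_def)
    finally show "ennreal ((rearr M F s * b1 s) powr p) * indicator {0<..<y} s \<le>
        ennreal (2 powr p) * (ennreal (q0 (s / 2)) * indicator {0<..<y} s + ennreal (q1 (s / 2)) * indicator {0<..<y} s)"
      by (auto simp: indicator_def)
  qed
  also have "\<dots> = ennreal (2 powr p) * ((\<integral>\<^sub>1s. ennreal (q0 (s / 2)) * indicator {0<..<y} s) +
      (\<integral>\<^sub>1s. ennreal (q1 (s / 2)) * indicator {0<..<y} s))"
  proof -
    have half: "(\<lambda>s. ennreal (q (s / 2))) \<in> borel_measurable unit_measure"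
      if "(\<lambda>s. ennreal (q s)) \<in> borel_measurable (restrict_space borel {0<..<1})" for q :: "real \<Rightarrow> real"
    proof -
      have "(\<lambda>s. ennreal (q s) * indicator {0<..<1} s) \<in> borel_measurable borel"
        using that by (subst (asm) borel_measurable_restrict_space_iff_ennreal) auto
      then have "(\<lambda>s. ennreal (q (s / 2)) * indicator {0<..<1} (s / 2)) \<in> borel_measurable borel"
        by (rule measurable_compose[rotated]) measurable
      then have "(\<lambda>s. ennreal (q (s / 2)) * indicator {0<..<1} (s / 2)) \<in> borel_measurable unit_measure"
        by (intro measurable_restrict_space1 measurable_completion) simp
      then show ?thesis by (rule measurable_cong[THEN iffD1, rotated]) auto
    qed
    note [measurable] = half[OF q0] half[OF q1]
    show ?thesis by (simp add: nn_integral_cmult nn_integral_add)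
  qed
  finally have split: "(\<integral>\<^sub>1s. ennreal ((rearr M F s * b1 s) powr p) * indicator {0<..<y} s) \<le> \<dots>" .
  have h0: "(\<integral>\<^sub>1s. ennreal (q0 (s / 2)) * indicator {0<..<y} s) = 2 * (\<integral>\<^sub>1s. ennreal (q0 s) * indicator {0<..<y / 2} s)"
    by (rule nn_integral_half[OF q0 y])
  have h1: "(\<integral>\<^sub>1s. ennreal (q1 (s / 2)) * indicator {0<..<y} s) = 2 * (\<integral>\<^sub>1s. ennreal (q1 s) * indicator {0<..<y / 2} s)"
    by (rule nn_integral_half[OF q1 y])
  have le0: "(\<integral>\<^sub>1s. ennreal (q0 s) * indicator {0<..<y / 2} s) \<le> epowr ?n0 p"
  proof -
    have "epowr ?n0 p = (\<integral>\<^sub>1s. ennreal (norm (b1 s * rearr M g s) powr p))"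
      using p by (simp add: weighted_norm_def Lq_norm_real epowr_inverse)
    moreover have "(\<integral>\<^sub>1s. ennreal (q0 s) * indicator {0<..<y / 2} s) \<le>
        (\<integral>\<^sub>1s. ennreal (norm (b1 s * rearr M g s) powr p))"
    proof (rule nn_integral_mono)
      fix s assume "s \<in> space unit_measure"
      then have s: "0 < s" "s < 1" by auto
      then have "norm (b1 s * rearr M g s) powr p = q0 s"
        using dplus_nonneg[OF gd s] by (simp add: q0_def abs_mult powr_mult b1_powr)
      then show "ennreal (q0 s) * indicator {0<..<y / 2} s \<le> ennreal (norm (b1 s * rearr M g s) powr p)"
        by (simp add: indicator_def)
    qed
    ultimately show ?thesis by simp
  qed
  have le1: "(\<integral>\<^sub>1s. ennreal (q1 s) * indicator {0<..<y / 2} s) \<le> 2 * epowr (ennreal ?t * ?n1) p"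
  proof -
    obtain c where c: "?n1 = ennreal c" "0 \<le> c" using fin by (cases ?n1) auto
    have "AE s in unit_measure. ennreal (norm (b2 s * rearr M h s)) \<le> ennreal c"
      unfolding c(1)[symmetric] weighted_norm_def Lq_norm_def by (simp add: esssup_AE)
    then have "AE s in unit_measure. ennreal (q1 s) \<le> ennreal (c powr p) * ennreal (ell s)"
    proof (rule AE_mp, intro AE_unitI impI)
      fix s :: real assume s: "0 < s" "s < 1" and "ennreal (norm (b2 s * rearr M h s)) \<le> ennreal c"
      then have "b2 s * rearr M h s \<le> c" using dplus_nonneg[OF hd s] c(2) by (simp add: abs_mult)
      then have "rearr M h s \<le> c * ell s powr \<beta>"
        using ell_pos[OF s] by (simp add: b2 powr_minus field_simps)
      then have "rearr M h s powr p \<le> (c * ell s powr \<beta>) powr p"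
        using dplus_nonneg[OF hd s] p by (intro powr_mono2) auto
      then have "rearr M h s powr p \<le> c powr p * u s" by (simp add: powr_mult powr_powr u_def)
      then have "q1 s \<le> c powr p * u s * w s"
        unfolding q1_def using w_ge_1[OF s] by (intro mult_right_mono) auto
      also have "\<dots> = c powr p * ell s" using w_u[OF s] by (simp add: mult_ac)
      finally show "ennreal (q1 s) \<le> ennreal (c powr p) * ennreal (ell s)"
        by (simp add: ennreal_leI flip: ennreal_mult')
    qed
    then have "(\<integral>\<^sub>1s. ennreal (q1 s) * indicator {0<..<y / 2} s) \<le>
        (\<integral>\<^sub>1s. ennreal (c powr p) * (1 * ennreal (ell s) * indicator {0<..<y} s))"
      using y by (intro nn_integral_mono_AE) (auto elim!: eventually_mono simp: indicator_def)
    also have "\<dots> = ennreal (c powr p) * (\<integral>\<^sub>1s. 1 * ennreal (ell s) * indicator {0<..<y} s)"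
    proof (rule nn_integral_cmult)
      have "(\<lambda>s. 1 * ennreal (ell s) * indicator {0<..<y} s) \<in> borel_measurable lebesgue"
        by (rule measurable_completion) measurable
      then show "(\<lambda>s. 1 * ennreal (ell s) * indicator {0<..<y} s) \<in> borel_measurable unit_measure"
        by (rule measurable_restrict_space1)
    qed
    also have "(\<integral>\<^sub>1s. 1 * ennreal (ell s) * indicator {0<..<y} s) = 2 * (\<integral>\<^sub>1s. 1 * indicator {0<..<Phi y} s)"
      using y by (intro nn_integral_Phi) auto
    also have "(\<integral>\<^sub>1s. 1 * indicator {0<..<Phi y} s) = ennreal (Phi y)"
      using Phi_y by (simp add: interval_unit_sets emeasure_unit_interval)
    also have "ennreal (c powr p) * (2 * ennreal (Phi y)) = 2 * (ennreal (Phi y) * ennreal (c powr p))"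
      by (simp add: mult_ac)
    also have "ennreal (Phi y) * ennreal (c powr p) = epowr (ennreal ?t * ?n1) p"
      unfolding c(1) using Phi_y p c(2) by (subst epowr_mult) (simp_all add: epowr_ennreal powr_powr)
    finally show ?thesis .
  qed
  have 1: "(\<integral>\<^sub>1s. ennreal ((rearr M F s * b1 s) powr p) * indicator {0<..<y} s) \<le>
      ennreal (2 powr p) * (2 * epowr ?n0 p + 2 * (2 * epowr (ennreal ?t * ?n1) p))"
    by (rule order_trans[OF split[unfolded h0 h1]]) (intro add_mono mult_left_mono le0 le1; simp)
  have "epowr ?n0 p \<le> epowr (?n0 + ennreal ?t * ?n1) p" "epowr (ennreal ?t * ?n1) p \<le> epowr (?n0 + ennreal ?t * ?n1) p"
    using p by (simp_all add: epowr_mono add_increasing add_increasing2)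
  then have "2 * epowr ?n0 p + 2 * (2 * epowr (ennreal ?t * ?n1) p) \<le>
      2 * epowr (?n0 + ennreal ?t * ?n1) p + 2 * (2 * epowr (?n0 + ennreal ?t * ?n1) p)"
    by (intro add_mono mult_left_mono) auto
  also have "\<dots> = 6 * epowr (?n0 + ennreal ?t * ?n1) p"
    by (simp flip: mult.assoc distrib_right)
  finally have "ennreal (2 powr p) * (2 * epowr ?n0 p + 2 * (2 * epowr (ennreal ?t * ?n1) p)) \<le>
      ennreal (2 powr p) * (6 * epowr (?n0 + ennreal ?t * ?n1) p)"
    by (intro mult_left_mono) auto
  also have "\<dots> = ennreal (6 * 2 powr p) * epowr (?n0 + ennreal ?t * ?n1) p"
    by (simp add: ennreal_mult' mult_ac)
  finally show ?thesis using 1 by (rule order_trans[rotated])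
qed

text \<open>Take the K-functionals at \<open>Phi y powr (1 / p)\<close>, which matches the weighted primitive up to \<open>y\<close>
  on the side of \<open>T f\<close> with the primitive up to \<open>Phi y\<close> on the side of \<open>f\<close>.\<close>

proposition K_bounded_imp_gaussible:
  fixes M :: "'a measure" and M' :: "'b measure"
  assumes M: "prob_space M" and M': "prob_space M'"
    and T: "is_operator M (Lp M) M' T"
    and C: "0 < C" and K: "\<And>f t. f \<in> Lp M \<Longrightarrow> 0 < t \<Longrightarrow> t < 1 \<Longrightarrow>
      K_weighted M' (T f) t
      \<le> ennreal C * K_unweighted M f t"
  shows "gaussible p b1 b2 M M' T"
  unfolding gaussible_iff[OF M]
proof (intro conjI T)
  let ?D = "(6 * 2 powr p) powr (1 / p) * (C * 2)"
  have D: "0 < ?D" using C by simp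
  have "(\<integral>\<^sub>1s. ennreal ((rearr M' (T f) s * b1 s) powr p) * indicator {0<..<y} s) \<le>
      ennreal (?D powr p) * (\<integral>\<^sub>1s. ennreal (rearr M f s powr p) * indicator {0<..<Phi y} s)"
    if f: "f \<in> Lp M" and y: "0 < y" "y < 1" for f y
  proof -
    let ?L = "\<integral>\<^sub>1s. ennreal ((rearr M' (T f) s * b1 s) powr p) * indicator {0<..<y} s"
    let ?R = "\<integral>\<^sub>1s. ennreal (rearr M f s powr p) * indicator {0<..<Phi y} s"
    let ?t = "Phi y powr (1 / p)"
    have Phi_y: "0 < Phi y" "Phi y < 1" using Phi_range[OF y] by auto
    have t: "0 < ?t" "?t < 1" using Phi_y p powr_less_mono2[of "1 / p" "Phi y" 1] by auto
    have Tf: "T f \<in> borel_measurable M'" using T f by (simp add: is_operator_def)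
    have "epowr ?L (1 / p) \<le> ennreal ((6 * 2 powr p) powr (1 / p)) *
        K_weighted M' (T f) ?t"
      unfolding K_functional_def
    proof (rule le_mult_Inf)
      fix v assume "v \<in> {weighted_norm (ennreal p) b1 M' g + ennreal ?t * weighted_norm \<infinity> b2 M' h |g h.
          g \<in> fspace M' (weighted_norm (ennreal p) b1 M') \<and> h \<in> fspace M' (weighted_norm \<infinity> b2 M') \<and>
          (AE x in M'. T f x = g x + h x)}"
      then obtain g h where v: "v = weighted_norm (ennreal p) b1 M' g + ennreal ?t * weighted_norm \<infinity> b2 M' h"
        and gh: "g \<in> borel_measurable M'" "h \<in> borel_measurable M'" "weighted_norm \<infinity> b2 M' h < \<infinity>" "AE x in M'. T f x = g x + h x"
        by (auto simp: fspace_def)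
      have "?L \<le> ennreal (6 * 2 powr p) * epowr v p"
        unfolding v by (rule weighted_integral_le_decomposition[OF M' Tf gh(1,2,4,3) y])
      then have "epowr ?L (1 / p) \<le> epowr (ennreal (6 * 2 powr p) * epowr v p) (1 / p)"
        using p by (intro epowr_mono) auto
      also have "\<dots> = ennreal ((6 * 2 powr p) powr (1 / p)) * v"
        using p by (simp add: epowr_mult epowr_inverse)
      finally show "epowr ?L (1 / p) \<le> ennreal ((6 * 2 powr p) powr (1 / p)) * v" .
    qed simp
    also have "\<dots> \<le> ennreal ((6 * 2 powr p) powr (1 / p)) * (ennreal C * (2 * epowr ?R (1 / p)))"
      using K[OF f t] K_Lp_Linf_le[OF M f Phi_y]
      by (intro mult_left_mono) (auto intro: order_trans[OF _ mult_left_mono])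
    also have "\<dots> = ennreal ?D * epowr ?R (1 / p)"
      using C by (simp add: ennreal_mult' mult_ac)
    finally have "epowr (epowr ?L (1 / p)) p \<le> epowr (ennreal ?D * epowr ?R (1 / p)) p"
      using p by (intro epowr_mono) auto
    then show ?thesis using p D by (simp only: epowr_inverse epowr_mult less_imp_le)
  qed
  then show "\<exists>C>0. \<forall>f\<in>Lp M. \<forall>t\<in>{0<..<1}.
      (\<integral>\<^sub>1s. ennreal ((rearr M' (T f) s * b1 s) powr p) * indicator {0<..<t} s) \<le>
      ennreal C * (\<integral>\<^sub>1s. ennreal (rearr M f s powr p) * indicator {0<..<Phi t} s)"
    using D by (intro exI[of _ "?D powr p"]) auto
qed

text \<open>A decomposition of \<open>f\<close> with bounded part at most \<open>m\<close> induces one of its image under the copy of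
  \<open>U\<close>: cut \<open>f\<^sup>*\<close> at height \<open>m\<close>. What lies above is at most the rearrangement of the unbounded part, and
  the substitution \<open>Phi\<close> turns its weighted norm into the \<open>L\<^sup>p\<close> norm, up to the factor
  \<open>2 powr (1 / p)\<close>.\<close>

lemma transplanted_operator_K_bounded:
  fixes M :: "'a measure" and M' :: "'b measure"
  assumes M: "prob_space M" and M': "nonatomic_prob M'"
    and V: "V \<in> borel_measurable M'" "\<And>x. 0 < V x \<and> V x < 1"
      "\<And>A. A \<in> sets borel \<Longrightarrow> emeasure M' {x\<in>space M'. V x \<in> A} = emeasure unit_measure {t\<in>space unit_measure. t \<in> A}"
    and f: "f \<in> borel_measurable M" and t: "0 < t" "t < 1"
  shows "K_weighted M'
      (\<lambda>x. complex_of_real (rearr M f (Phi (V x)) * ell (V x) powr \<beta>)) t \<le>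
    ennreal (2 powr (1 / p)) * K_unweighted M f t"
proof -
  interpret M: prob_space M by fact
  interpret M': nonatomic_prob M' by fact
  note [measurable] = f
  have fm: "(\<lambda>x. norm (f x)) \<in> borel_measurable M" by measurable
  note fd = M.rearr_dplus[OF fm]
  show ?thesis
    unfolding K_functional_def[of M]
  proof (rule le_mult_Inf)
    fix v assume "v \<in> {Lq_norm (ennreal p) M g + ennreal t * Lq_norm \<infinity> M h |g h.
        g \<in> Lp M \<and> h \<in> fspace M (Lq_norm \<infinity> M) \<and> (AE x in M. f x = g x + h x)}"
    then obtain g h where v: "v = Lq_norm (ennreal p) M g + ennreal t * Lq_norm \<infinity> M h"
      and g: "g \<in> Lp M" and h: "h \<in> fspace M (Lq_norm \<infinity> M)"
      and fgh: "AE x in M. f x = g x + h x"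
      by auto
    have [measurable]: "g \<in> borel_measurable M" "h \<in> borel_measurable M" using g h by (auto simp: fspace_def)
    have gm: "(\<lambda>x. norm (g x)) \<in> borel_measurable M" by measurable
    note gd = M.rearr_dplus[OF gm]
    obtain m where m: "Lq_norm \<infinity> M h = ennreal m" "0 \<le> m" using h by (cases "Lq_norm \<infinity> M h") (auto simp: fspace_def)
    have "AE x in M. ennreal (norm (h x)) \<le> ennreal m"
      unfolding m(1)[symmetric] Lq_norm_def by (simp add: esssup_AE)
    with fgh have "AE x in M. norm (f x) \<le> norm (g x) + m"
    proof eventually_elim
      case (elim x)
      then show ?case using norm_triangle_ineq[of "g x" "h x"] m(2) by simp
    qed
    then have cut: "rearr M f s - m \<le> rearr M g s" if "0 < s" for s
      by (rule rearr_diff_bounded_le[OF M fm gm _ m(2) that])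
    define d0 where "d0 s = max 0 (rearr M f (Phi s) - m) * ell s powr \<beta>" for s
    define d1 where "d1 s = min (rearr M f (Phi s)) m * ell s powr \<beta>" for s
    have c0: "(\<lambda>s. max 0 (rearr M f s - m)) \<in> dplus"
    proof (rule dplusI)
      fix s t :: real assume "0 < s" "s \<le> t" "t < 1"
      then have "rearr M f t \<le> rearr M f s" by (rule dplus_antimono[OF fd])
      then show "max 0 (rearr M f t - m) \<le> max 0 (rearr M f s - m)" by (intro max.mono) auto
    qed simp
    have c1: "(\<lambda>s. min (rearr M f s) m) \<in> dplus"
    proof (rule dplusI)
      fix s t :: real assume "0 < s" "s \<le> t" "t < 1"
      then have "rearr M f t \<le> rearr M f s" by (rule dplus_antimono[OF fd])
      then show "min (rearr M f t) m \<le> min (rearr M f s) m" by (intro min.mono) auto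
    qed (use dplus_nonneg[OF fd] m(2) in auto)
    have d0: "d0 \<in> dplus" unfolding d0_def using dplus_compose_Phi[OF c0] exponents by simp
    have d1: "d1 \<in> dplus" unfolding d1_def using dplus_compose_Phi[OF c1] exponents by simp
    let ?g = "\<lambda>x. complex_of_real (d0 (V x))" and ?h = "\<lambda>x. complex_of_real (d1 (V x))"
    note rg = M'.rearr_uniform[OF V d0] and rh = M'.rearr_uniform[OF V d1]
    have rd0: "AE s in unit_measure. rearr M' ?g s = d0 s" using rearr_dplus_AE[OF d0] rg(2) by simp
    have rd1: "AE s in unit_measure. rearr M' ?h s = d1 s" using rearr_dplus_AE[OF d1] rh(2) by simp
    have "epowr (weighted_norm (ennreal p) b1 M' ?g) p = (\<integral>\<^sub>1s. ennreal (norm (b1 s * rearr M' ?g s) powr p))"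
      using p by (simp add: weighted_norm_def Lq_norm_real epowr_inverse)
    also have "\<dots> = (\<integral>\<^sub>1s. ennreal ((max 0 (rearr M f (Phi s) - m)) powr p) * ennreal (ell s) * indicator {0<..<1} s)"
    proof (rule nn_integral_cong_AE, rule AE_mp[OF rd0], intro AE_unitI impI)
      fix s :: real assume s: "0 < s" "s < 1" and eq: "rearr M' ?g s = d0 s"
      have "norm (b1 s * d0 s) powr p = w s * ((max 0 (rearr M f (Phi s) - m)) powr p * u s)"
        by (simp add: d0_def abs_mult powr_mult b1_powr powr_powr u_def)
      also have "\<dots> = (max 0 (rearr M f (Phi s) - m)) powr p * ell s" using w_u[OF s] by (simp add: mult_ac)
      finally show "ennreal (norm (b1 s * rearr M' ?g s) powr p) =
          ennreal ((max 0 (rearr M f (Phi s) - m)) powr p) * ennreal (ell s) * indicator {0<..<1} s"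
        using s ell_pos[OF s] by (simp add: eq ennreal_mult')
    qed
    also have "\<dots> = 2 * (\<integral>\<^sub>1s. ennreal ((max 0 (rearr M f s - m)) powr p) * indicator {0<..<Phi 1} s)"
      using dplus_borel[OF dplus_powr[OF c0 p]]
      by (intro nn_integral_Phi[where h="\<lambda>s. ennreal ((max 0 (rearr M f s - m)) powr p)"] measurable_compose[OF _ measurable_ennreal]) auto
    also have "\<dots> \<le> 2 * (\<integral>\<^sub>1s. ennreal (rearr M g s powr p))"
    proof (intro mult_left_mono nn_integral_mono)
      fix s assume "s \<in> space unit_measure"
      then have s: "0 < s" "s < 1" by auto
      have "max 0 (rearr M f s - m) powr p \<le> rearr M g s powr p"
        using cut[OF s(1)] dplus_nonneg[OF gd s] p by (intro powr_mono2) auto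
      then show "ennreal ((max 0 (rearr M f s - m)) powr p) * indicator {0<..<Phi 1} s \<le> ennreal (rearr M g s powr p)"
        by (simp add: indicator_def ennreal_leI)
    qed simp
    also have "\<dots> = ennreal 2 * epowr (Lq_norm (ennreal p) M g) p"
      using p by (simp add: Lq_norm_real epowr_inverse M.nn_integral_powr_rearr)
    finally have n0: "weighted_norm (ennreal p) b1 M' ?g \<le> ennreal (2 powr (1 / p)) * Lq_norm (ennreal p) M g"
      by (rule epowr_le_multI[OF p, rotated]) simp
    have n1: "weighted_norm \<infinity> b2 M' ?h \<le> ennreal m"
      unfolding weighted_norm_def Lq_norm_def
    proof (simp, rule esssup_I)
      have hm: "(\<lambda>x. norm (?h x)) \<in> borel_measurable M'" by (rule measurable_compose[OF rh(1) borel_measurable_norm])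
      have "rearr M' ?h \<in> mplus" by (rule dplus_mplus[OF M'.rearr_dplus[OF hm]])
      then have [measurable]: "rearr M' ?h \<in> borel_measurable unit_measure" by (rule mplus_measurable)
      have [measurable]: "b2 \<in> borel_measurable unit_measure"
        by (intro borel_unit_measurable measurable_restrict_space1) (simp add: b2)
      show "(\<lambda>s. ennreal \<bar>b2 s * rearr M' ?h s\<bar>) \<in> borel_measurable unit_measure" by measurable
      show "AE s in unit_measure. ennreal \<bar>b2 s * rearr M' ?h s\<bar> \<le> ennreal m"
      proof (rule AE_mp[OF rd1], intro AE_unitI impI)
        fix s :: real assume s: "0 < s" "s < 1" and eq: "rearr M' ?h s = d1 s"
        have "b2 s * d1 s = min (rearr M f (Phi s)) m"
          using ell_pos[OF s] by (simp add: b2 d1_def powr_minus)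
        moreover have "0 \<le> rearr M f (Phi s)" using dplus_nonneg[OF fd] Phi_range[OF s] by simp
        ultimately have "\<bar>b2 s * d1 s\<bar> \<le> m" using m(2) by (auto simp: min_def)
        then show "ennreal \<bar>b2 s * rearr M' ?h s\<bar> \<le> ennreal m" by (simp add: eq ennreal_leI)
      qed
    qed
    have "Lq_norm (ennreal p) M g < \<infinity>" using g by (simp add: fspace_def)
    then have "weighted_norm (ennreal p) b1 M' ?g < \<infinity>"
      using n0 by (auto simp: ennreal_mult_less_top intro: le_less_trans)
    moreover have "weighted_norm \<infinity> b2 M' ?h < \<infinity>" using n1 by (auto intro: le_less_trans)
    moreover have "complex_of_real (rearr M f (Phi (V x)) * ell (V x) powr \<beta>) = ?g x + ?h x" for x
    proof -
      have "rearr M f (Phi (V x)) = max 0 (rearr M f (Phi (V x)) - m) + min (rearr M f (Phi (V x))) m" by auto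
      then have "rearr M f (Phi (V x)) * ell (V x) powr \<beta> = d0 (V x) + d1 (V x)"
        unfolding d0_def d1_def by (metis distrib_right)
      then show ?thesis by (simp only: of_real_add)
    qed
    ultimately have "K_weighted M'
        (\<lambda>x. complex_of_real (rearr M f (Phi (V x)) * ell (V x) powr \<beta>)) t \<le>
        weighted_norm (ennreal p) b1 M' ?g + ennreal t * weighted_norm \<infinity> b2 M' ?h"
      unfolding K_functional_def using rg(1) rh(1) by (intro Inf_lower) (auto simp: fspace_def)
    also have "\<dots> \<le> ennreal (2 powr (1 / p)) * Lq_norm (ennreal p) M g + ennreal (2 powr (1 / p)) * (ennreal t * ennreal m)"
    proof (intro add_mono n0)
      have "1 \<le> 2 powr (1 / p)" using p by (simp add: ge_one_powr_ge_zero)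
      then have "1 * (ennreal t * weighted_norm \<infinity> b2 M' ?h) \<le> ennreal (2 powr (1 / p)) * (ennreal t * ennreal m)"
        using n1 by (intro mult_mono) auto
      then show "ennreal t * weighted_norm \<infinity> b2 M' ?h \<le> ennreal (2 powr (1 / p)) * (ennreal t * ennreal m)" by simp
    qed
    also have "\<dots> = ennreal (2 powr (1 / p)) * v" unfolding v m(1) by (simp only: distrib_left)
    finally show "K_weighted M'
        (\<lambda>x. complex_of_real (rearr M f (Phi (V x)) * ell (V x) powr \<beta>)) t \<le> ennreal (2 powr (1 / p)) * v" .
  qed simp
qed

end

section \<open>Decreasing majorants\<close>

text \<open>The bound \<open>D\<close> makes the real suprema genuine ones.\<close>

lemma decreasing_majorant:
  assumes D: "D \<in> dplus" and F: "\<forall>s\<in>{0<..<1}. 0 \<le> F s \<and> F s \<le> D s"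
  shows "(\<lambda>t. SUP s\<in>{t..<1}. F s) \<in> dplus" (is "?S \<in> _")
    and "\<And>s t. 0 < t \<Longrightarrow> t \<le> s \<Longrightarrow> s < 1 \<Longrightarrow> F s \<le> (SUP s\<in>{t..<1}. F s)"
    and "\<And>t a. 0 < t \<Longrightarrow> t < 1 \<Longrightarrow> a < (SUP s\<in>{t..<1}. F s) \<Longrightarrow> \<exists>s. t \<le> s \<and> s < 1 \<and> a < F s"
    and "\<And>t c. 0 < t \<Longrightarrow> t < 1 \<Longrightarrow> (\<And>s. t \<le> s \<Longrightarrow> s < 1 \<Longrightarrow> F s \<le> c) \<Longrightarrow> (SUP s\<in>{t..<1}. F s) \<le> c"
proof -
  have bdd: "bdd_above (F ` {t..<1})" if "0 < t" for t
  proof (intro bdd_aboveI2)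
    fix s assume "s \<in> {t..<1}"
    then show "F s \<le> D t" using bspec[OF F, of s] dplus_antimono[OF D that, of s] that by auto
  qed
  show up: "F s \<le> (SUP s\<in>{t..<1}. F s)" if "0 < t" "t \<le> s" "s < 1" for s t
    using that by (intro cSUP_upper bdd) auto
  show "\<exists>s. t \<le> s \<and> s < 1 \<and> a < F s" if t: "0 < t" "t < 1" and a: "a < (SUP s\<in>{t..<1}. F s)" for t a
  proof -
    have "{t..<1} \<noteq> {}" using t by auto
    then show ?thesis using a less_cSUP_iff[OF _ bdd[OF t(1)], of a] by auto
  qed
  show "(SUP s\<in>{t..<1}. F s) \<le> c" if "0 < t" "t < 1" "\<And>s. t \<le> s \<Longrightarrow> s < 1 \<Longrightarrow> F s \<le> c" for t c
    using that by (intro cSUP_least) auto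
  show "?S \<in> dplus"
  proof (rule dplusI)
    fix s t :: real assume "0 < s" "s \<le> t" "t < 1"
    then show "?S t \<le> ?S s" by (intro cSUP_subset_mono bdd) auto
  next
    fix t :: real assume t: "0 < t" "t < 1"
    then show "0 \<le> ?S t" using bspec[OF F, of t] up[OF t(1) order_refl t(2)] by simp
  qed
qed

text \<open>The means of a decreasing function over \<open>(0,a)\<close> and \<open>(0,b)\<close>, multiplied out: on \<open>(a,b)\<close> the
  function is at most \<open>f a\<close>, which is at most its mean over \<open>(0,a)\<close>.\<close>

lemma average_antimono:
  assumes f: "f \<in> dplus" and ab: "0 < a" "a \<le> b" "b < 1"
  shows "ennreal a * (\<integral>\<^sub>1s. ennreal (f s) * indicator {0<..<b} s) \<le>
    ennreal b * (\<integral>\<^sub>1s. ennreal (f s) * indicator {0<..<a} s)"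
proof -
  note [measurable] = mplus_measurable[OF dplus_mplus[OF f]]
  let ?A = "\<integral>\<^sub>1s. ennreal (f s) * indicator {0<..<a} s"
  have fa: "0 \<le> f a" using dplus_nonneg[OF f, of a] ab by simp
  have const: "(\<integral>\<^sub>1s. ennreal (f a) * indicator {0<..<a} s) = ennreal (f a) * ennreal a"
    using ab by (subst nn_integral_cmult_indicator) (simp_all add: interval_unit_sets emeasure_unit_interval)
  have 1: "ennreal (f a) * ennreal a \<le> ?A"
    unfolding const[symmetric]
  proof (rule nn_integral_mono)
    fix s show "ennreal (f a) * indicator {0<..<a} s \<le> ennreal (f s) * indicator {0<..<a} s"
      using dplus_antimono[OF f, of s a] ab by (auto simp: indicator_def ennreal_leI)
  qed
  have set: "{a<..<b} \<in> sets unit_measure" using ab by (subst sets_restrict_space_iff) auto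
  have meas: "emeasure unit_measure {a<..<b} = ennreal (b - a)"
    using ab by (subst emeasure_restrict_space) auto
  have "(\<integral>\<^sub>1s. ennreal (f s) * indicator {0<..<b} s) \<le>
      (\<integral>\<^sub>1s. ennreal (f s) * indicator {0<..<a} s + ennreal (f a) * indicator {a<..<b} s)"
  proof (rule nn_integral_mono_AE, rule AE_mp[OF AE_unit_neq[of a]], intro AE_unitI impI)
    fix s :: real assume "0 < s" "s < 1" "s \<noteq> a"
    then show "ennreal (f s) * indicator {0<..<b} s \<le> ennreal (f s) * indicator {0<..<a} s + ennreal (f a) * indicator {a<..<b} s"
      using dplus_antimono[OF f ab(1), of s] by (auto simp: indicator_def ennreal_leI)
  qed
  also have "\<dots> = ?A + ennreal (f a) * ennreal (b - a)"
    using meas set by (simp add: nn_integral_add nn_integral_cmult_indicator)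
  finally have "ennreal a * (\<integral>\<^sub>1s. ennreal (f s) * indicator {0<..<b} s) \<le> ennreal a * (?A + ennreal (f a) * ennreal (b - a))"
    by (intro mult_left_mono) auto
  also have "\<dots> = ennreal a * ?A + ennreal (b - a) * (ennreal (f a) * ennreal a)"
    by (simp add: distrib_left mult_ac)
  also have "\<dots> \<le> ennreal a * ?A + ennreal (b - a) * ?A"
    by (intro add_mono mult_left_mono 1) auto
  also have "\<dots> = ennreal b * ?A"
    using ab by (simp flip: distrib_right ennreal_plus)
  finally show ?thesis .
qed

context gauss_weights
begin

text \<open>The \<open>p\<close>-th power of \<open>U\<close>, as an operator on the \<open>p\<close>-th power of the decreasing rearrangement. Correspondingly,
  \<open>Sup_op\<close> is \<open>T\<close> on decreasing functions.\<close>

definition S_op :: "(real \<Rightarrow> real) \<Rightarrow> real \<Rightarrow> real" where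
  "S_op f t = f (Phi t) * u t"

definition Sup_op :: "(real \<Rightarrow> real) \<Rightarrow> real \<Rightarrow> real" where
  "Sup_op k t = (SUP s\<in>{t..<1}. k (tau s) / w (tau s))"

lemma S_op_dplus: "f \<in> dplus \<Longrightarrow> S_op f \<in> dplus"
  unfolding S_op_def u_def using dplus_compose_Phi[of f "\<beta> * p"] exponents by simp

lemma inverse_u_deriv:
  assumes "0 < r" "r < 1"
  shows "((\<lambda>r. 1 / u r) has_real_derivative (\<beta> * p) / (u r * ell r * r)) (at r)"
proof -
  have e: "0 < ell r" using ell_pos assms by simp
  have "((\<lambda>r. ell r powr (- (\<beta> * p))) has_real_derivative ((- (\<beta> * p)) * ell r powr (- (\<beta> * p) - 1) * (- (1 / r)))) (at r)"
    using assms e unfolding ell_def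
    by (auto intro!: derivative_eq_intros simp: field_simps ell_def)
  moreover have "(- (\<beta> * p)) * ell r powr (- (\<beta> * p) - 1) * (- (1 / r)) = (\<beta> * p) / (u r * ell r * r)"
    using e by (simp add: u_def powr_diff powr_minus field_simps)
  moreover have "(\<lambda>r. ell r powr (- (\<beta> * p))) = (\<lambda>r. 1 / u r)"
    by (auto simp: u_def powr_minus inverse_eq_divide)
  ultimately show ?thesis by simp
qed

text \<open>The quotient \<open>G / u\<close> need not decrease, but \<open>G\<close> does, so \<open>G r / u r \<le> G s / u s + J\<close> for
  \<open>s \<le> r < t\<close>, where \<open>J\<close> is the integral of \<open>G (1 / u)'\<close> over \<open>(s,t)\<close>. Integrated against \<open>ell\<close>, the first term
  gives the integral of \<open>G w\<close>, as \<open>ell = w u\<close>. By Tonelli's theorem the second gives the integral of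
  \<open>2 G (1 / u)' Phi\<close>, and \<open>(1 / u)' Phi\<close> is at most \<open>\<beta> p / u \<le> 1 \<le> w\<close>. Arguments beyond \<open>t\<close> are covered by
  the value of the majorant at \<open>t\<close>.\<close>

lemma majorant_integral_le:
  assumes G: "G \<in> dplus" and t: "0 < t" "t < 1"
  shows "(\<integral>\<^sub>1s. ennreal (SUP r\<in>{s..<1}. G r / u r) * ennreal (ell s) * indicator {0<..<t} s) \<le>
    3 * (\<integral>\<^sub>1s. ennreal (G s * w s) * indicator {0<..<t} s) +
    2 * (ennreal (SUP r\<in>{t..<1}. G r / u r) * ennreal (Phi t))"
proof -
  define \<psi> where "\<psi> s = (SUP r\<in>{s..<1}. G r / u r)" for s
  have Fb: "0 \<le> G s / u s \<and> G s / u s \<le> G s" if "0 < s" "s < 1" for s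
    using dplus_nonneg[OF G that] u_ge_1[OF that] by (auto simp: divide_le_eq mult_le_cancel_left1)
  have "\<forall>s\<in>{0<..<1}. 0 \<le> G s / u s \<and> G s / u s \<le> G s" using Fb by simp
  note maj = decreasing_majorant[OF G this]
  define e where "e r = (\<beta> * p) / (u r * ell r * r)" for r
  have e_meas[measurable]: "e \<in> borel_measurable borel" unfolding e_def by measurable
  have e0: "0 \<le> e r" if "0 < r" "r < 1" for r
    unfolding e_def using that ell_pos[OF that] u_ge_1[OF that] exponents by (intro divide_nonneg_pos mult_pos_pos) auto
  define g where "g r = indicator {0<..<1} r * G r" for r :: real
  have g_meas[measurable]: "g \<in> borel_measurable borel" unfolding g_def by (rule dplus_borel_indicator[OF G])
  define J where "J s = (\<integral>\<^sup>+r. ennreal (g r * e r) * indicator {s<..<t} r \<partial>lborel)" for s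
  have pt: "ennreal (\<psi> s) \<le> ennreal (G s / u s) + J s + ennreal (\<psi> t)" if s: "0 < s" "s < t" for s
  proof (cases "J s")
    case (real j)
    have s1: "s < 1" using s t by simp
    have step: "G r / u r \<le> G s / u s + j" if r: "s \<le> r" "r < t" for r
    proof -
      have r1: "0 < r" "r < 1" using r s t by auto
      have "(\<integral>\<^sup>+x. ennreal (e x) * indicator {s..r} x \<partial>lborel) = 1 / u r - 1 / u s"
        unfolding e_def
      proof (rule nn_integral_FTC_Icc)
        fix x assume "x \<in> {s..r}"
        then have x: "0 < x" "x < 1" using s r1 by auto
        show "((\<lambda>r. 1 / u r) has_real_derivative \<beta> * p / (u x * ell x * x)) (at x)" by (rule inverse_u_deriv[OF x])
        show "0 \<le> \<beta> * p / (u x * ell x * x)" using e0[OF x] by (simp add: e_def)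
      qed (use r in \<open>auto simp: e_def[abs_def, symmetric]\<close>)
      then have "ennreal (G r * (1 / u r - 1 / u s)) = ennreal (G r) * (\<integral>\<^sup>+x. ennreal (e x) * indicator {s..r} x \<partial>lborel)"
        using dplus_nonneg[OF G r1] by (simp add: ennreal_mult')
      also have "\<dots> = (\<integral>\<^sup>+x. ennreal (G r) * (ennreal (e x) * indicator {s..r} x) \<partial>lborel)"
        by (intro nn_integral_cmult[symmetric]) measurable
      also have "\<dots> \<le> J s"
        unfolding J_def
      proof (rule nn_integral_mono_AE, rule AE_mp[OF AE_lborel_singleton[of s]], intro AE_I2 impI)
        fix x :: real assume "x \<noteq> s"
        show "ennreal (G r) * (ennreal (e x) * indicator {s..r} x) \<le> ennreal (g x * e x) * indicator {s<..<t} x"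
        proof (cases "x \<in> {s..r}")
          case True
          then have x: "0 < x" "x < 1" "s < x" "x < t" "x \<le> r" using s r r1 \<open>x \<noteq> s\<close> by auto
          have "G r \<le> G x" using dplus_antimono[OF G x(1,5) r1(2)] .
          then have "G r * e x \<le> g x * e x" using x e0[OF x(1,2)] by (simp add: g_def mult_right_mono)
          then show ?thesis using x True dplus_nonneg[OF G r1] by (simp add: ennreal_leI flip: ennreal_mult')
        qed simp
      qed
      finally have "G r * (1 / u r - 1 / u s) \<le> j" using real by simp
      moreover have "G r / u s \<le> G s / u s"
        using dplus_antimono[OF G s(1) r(1) r1(2)] u_ge_1[OF s(1) s1] by (intro divide_right_mono) auto
      ultimately show ?thesis by (simp add: right_diff_distrib)
    qed
    have "\<psi> s \<le> G s / u s + j + \<psi> t"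
      unfolding \<psi>_def[of s]
    proof (rule maj(4)[OF s(1) s1])
      fix r assume r: "s \<le> r" "r < 1"
      show "G r / u r \<le> G s / u s + j + \<psi> t"
      proof (cases "r < t")
        case True
        have "0 \<le> \<psi> t" unfolding \<psi>_def using dplus_nonneg[OF maj(1) t] .
        then show ?thesis using step[OF r(1) True] by simp
      next
        case False
        then have "G r / u r \<le> \<psi> t" unfolding \<psi>_def using r by (intro maj(2)) (use t in auto)
        then show ?thesis using Fb[OF s(1) s1] real by simp
      qed
    qed
    then have "ennreal (\<psi> s) \<le> ennreal (G s / u s + j + \<psi> t)" by (rule ennreal_leI)
    also have "\<dots> = ennreal (G s / u s) + J s + ennreal (\<psi> t)"
      using Fb[OF s(1) s1] real dplus_nonneg[OF maj(1) t] by (simp add: \<psi>_def)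
    finally show ?thesis .
  qed simp
  let ?W = "\<integral>\<^sub>1s. ennreal (G s * w s) * indicator {0<..<t} s"
  have Jm[measurable]: "J \<in> borel_measurable borel"
  proof -
    have "(\<lambda>s. \<integral>\<^sup>+r. ennreal (g r * e r) * indicator {x. fst x < snd x \<and> snd x < t} (s, r) \<partial>lborel) \<in> borel_measurable borel"
      by measurable
    also have "(\<lambda>s. \<integral>\<^sup>+r. ennreal (g r * e r) * indicator {x. fst x < snd x \<and> snd x < t} (s, r) \<partial>lborel) = J"
      unfolding J_def by (intro ext nn_integral_cong) (auto simp: indicator_def)
    finally show ?thesis .
  qed
  have ind[measurable]: "(\<lambda>s. indicator {0<..<t} s :: ennreal) \<in> borel_measurable unit_measure" by measurable
  have [measurable]: "(\<lambda>s. ennreal (G s)) \<in> borel_measurable unit_measure"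
    using mplus_measurable[OF dplus_mplus[OF G]] by measurable
  have borel_unit: "f \<in> borel_measurable unit_measure" if "f \<in> borel_measurable borel" for f :: "real \<Rightarrow> ennreal"
    using that by (intro measurable_restrict_space1 measurable_completion) simp
  have borel_unit': "f \<in> borel_measurable unit_measure" if "f \<in> borel_measurable borel" for f :: "real \<Rightarrow> real"
    using that by (intro measurable_restrict_space1 measurable_completion) simp
  note [measurable] = borel_unit[OF Jm] borel_unit'[OF ell_measurable] borel_unit'[OF u_measurable] borel_unit'[OF w_measurable]
     mplus_measurable[OF dplus_mplus[OF G]]
  have "(\<integral>\<^sub>1s. ennreal (\<psi> s) * ennreal (ell s) * indicator {0<..<t} s) \<le>
      (\<integral>\<^sub>1s. ennreal (G s * w s) * indicator {0<..<t} s + (J s * ennreal (ell s) * indicator {0<..<t} s +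
        ennreal (\<psi> t) * (1 * ennreal (ell s) * indicator {0<..<t} s)))"
  proof (rule nn_integral_mono)
    fix s assume "s \<in> space unit_measure"
    then have s: "0 < s" "s < 1" by auto
    show "ennreal (\<psi> s) * ennreal (ell s) * indicator {0<..<t} s \<le>
        ennreal (G s * w s) * indicator {0<..<t} s + (J s * ennreal (ell s) * indicator {0<..<t} s +
        ennreal (\<psi> t) * (1 * ennreal (ell s) * indicator {0<..<t} s))"
    proof (cases "s < t")
      case True
      have "G s / u s * ell s = G s * w s" using w_u[OF s] u_ge_1[OF s] by (simp add: field_simps flip: w_u[OF s])
      then have gw: "ennreal (G s / u s) * ennreal (ell s) = ennreal (G s * w s)"
        using Fb[OF s] by (simp flip: ennreal_mult')
      have "ennreal (\<psi> s) * ennreal (ell s) \<le> (ennreal (G s / u s) + J s + ennreal (\<psi> t)) * ennreal (ell s)"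
        by (intro mult_right_mono pt s(1) True) auto
      then show ?thesis using True s by (simp add: distrib_right gw add.assoc)
    qed simp
  qed
  also have "\<dots> = ?W + ((\<integral>\<^sub>1s. J s * ennreal (ell s) * indicator {0<..<t} s) +
      ennreal (\<psi> t) * (\<integral>\<^sub>1s. 1 * ennreal (ell s) * indicator {0<..<t} s))"
    by (simp add: nn_integral_add nn_integral_cmult)
  also have "(\<integral>\<^sub>1s. 1 * ennreal (ell s) * indicator {0<..<t} s) = 2 * ennreal (Phi t)"
    using nn_integral_Phi[of "\<lambda>_. 1" t] t Phi_range[OF t] by (simp add: interval_unit_sets emeasure_unit_interval)
  finally have 1: "(\<integral>\<^sub>1s. ennreal (\<psi> s) * ennreal (ell s) * indicator {0<..<t} s) \<le>
      ?W + ((\<integral>\<^sub>1s. J s * ennreal (ell s) * indicator {0<..<t} s) + ennreal (\<psi> t) * (2 * ennreal (Phi t)))" .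
  have J2: "(\<integral>\<^sub>1s. J s * ennreal (ell s) * indicator {0<..<t} s) \<le> 2 * ?W"
  proof -
    have "(\<integral>\<^sub>1s. J s * ennreal (ell s) * indicator {0<..<t} s) =
        (\<integral>\<^sup>+s. J s * ennreal (ell s) * indicator {0<..<t} s * indicator {0<..<1} s \<partial>lborel)"
      by (intro nn_integral_unit_lborel measurable_restrict_space1) measurable
    also have "\<dots> = (\<integral>\<^sup>+s. (\<integral>\<^sup>+r. ennreal (g r * e r) * indicator {0<..<t} r * (ennreal (ell s) * indicator {0<..<r} s) \<partial>lborel) \<partial>lborel)"
    proof (rule nn_integral_cong)
      fix s :: real
      have "J s * ennreal (ell s) * indicator {0<..<t} s * indicator {0<..<1} s = J s * (ennreal (ell s) * indicator {0<..<t} s)"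
        using t by (auto simp: indicator_def)
      also have "\<dots> = (\<integral>\<^sup>+r. ennreal (g r * e r) * indicator {s<..<t} r * (ennreal (ell s) * indicator {0<..<t} s) \<partial>lborel)"
        unfolding J_def by (rule nn_integral_multc[symmetric]) measurable
      also have "\<dots> = (\<integral>\<^sup>+r. ennreal (g r * e r) * indicator {0<..<t} r * (ennreal (ell s) * indicator {0<..<r} s) \<partial>lborel)"
        by (intro nn_integral_cong) (auto simp: indicator_def)
      finally show "J s * ennreal (ell s) * indicator {0<..<t} s * indicator {0<..<1} s = \<dots>" .
    qed
    also have "\<dots> = (\<integral>\<^sup>+r. (\<integral>\<^sup>+s. ennreal (g r * e r) * indicator {0<..<t} r * (ennreal (ell s) * indicator {0<..<r} s) \<partial>lborel) \<partial>lborel)"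
    proof (rule lborel_pair.Fubini')
      have "(\<lambda>(r, s). ennreal (g r * e r) * indicator {0<..<t} r * (ennreal (ell s) * indicator {x. 0 < snd x \<and> snd x < fst x} (r, s)))
          \<in> borel_measurable (lborel \<Otimes>\<^sub>M lborel)" by measurable
      also have "(\<lambda>(r, s). ennreal (g r * e r) * indicator {0<..<t} r * (ennreal (ell s) * indicator {x. 0 < snd x \<and> snd x < fst x} (r, s))) =
          (\<lambda>(r, s). ennreal (g r * e r) * indicator {0<..<t} r * (ennreal (ell s) * indicator {0<..<r} s))"
        by (auto simp: indicator_def fun_eq_iff)
      finally show "(\<lambda>(r, s). ennreal (g r * e r) * indicator {0<..<t} r * (ennreal (ell s) * indicator {0<..<r} s))
          \<in> borel_measurable (lborel \<Otimes>\<^sub>M lborel)" .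
    qed
    also have "\<dots> \<le> (\<integral>\<^sup>+r. 2 * (ennreal (g r * w r) * indicator {0<..<t} r * indicator {0<..<1} r) \<partial>lborel)"
    proof (rule nn_integral_mono)
      fix r :: real
      show "(\<integral>\<^sup>+s. ennreal (g r * e r) * indicator {0<..<t} r * (ennreal (ell s) * indicator {0<..<r} s) \<partial>lborel) \<le>
          2 * (ennreal (g r * w r) * indicator {0<..<t} r * indicator {0<..<1} r)"
      proof (cases "0 < r \<and> r < t")
        case True
        then have r: "0 < r" "r < 1" using t by auto
        have "(\<integral>\<^sup>+s. ennreal (ell s) * indicator {0<..<r} s \<partial>lborel) = (\<integral>\<^sup>+s. ennreal (ell s) * indicator {0<..<r} s * indicator {0<..<1} s \<partial>lborel)"
          using r by (intro nn_integral_cong) (auto simp: indicator_def)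
        also have "\<dots> = (\<integral>\<^sub>1s. 1 * ennreal (ell s) * indicator {0<..<r} s)"
          by (subst nn_integral_unit_lborel) (auto intro!: measurable_restrict_space1)
        also have "\<dots> = 2 * ennreal (Phi r)"
          using nn_integral_Phi[of "\<lambda>_. 1" r] r Phi_range[OF r] by (simp add: interval_unit_sets emeasure_unit_interval)
        finally have ell_int: "(\<integral>\<^sup>+s. ennreal (ell s) * indicator {0<..<r} s \<partial>lborel) = ennreal (2 * Phi r)"
          using Phi_range[OF r] by (simp add: ennreal_mult')
        have "(\<integral>\<^sup>+s. ennreal (g r * e r) * indicator {0<..<t} r * (ennreal (ell s) * indicator {0<..<r} s) \<partial>lborel) =
            ennreal (g r * e r) * ennreal (2 * Phi r)"
          using True by (simp add: nn_integral_cmult ell_int)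
        also have "\<dots> = ennreal (g r * e r * (2 * Phi r))"
          using Phi_range[OF r] by (intro ennreal_mult''[symmetric]) auto
        also have "\<dots> \<le> ennreal (2 * (g r * w r))"
        proof (rule ennreal_leI)
          have rl: "0 < r * ell r" using r ell_pos[OF r] by simp
          have "e r * Phi r \<le> e r * (r * ell r)" using e0[OF r] Phi_le[of r] r by (intro mult_left_mono) auto
          also have "\<dots> = (\<beta> * p) / u r" using r ell_pos[OF r] u_ge_1[OF r] by (simp add: e_def)
          also have "\<dots> \<le> 1 / 1" using exponents u_ge_1[OF r] by (intro frac_le) auto
          finally have "e r * Phi r \<le> w r" using w_ge_1[OF r] by simp
          then have "g r * (e r * Phi r) \<le> g r * w r"
            using dplus_nonneg[OF G r] by (intro mult_left_mono) (auto simp: g_def)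
          then show "g r * e r * (2 * Phi r) \<le> 2 * (g r * w r)" by (simp add: mult_ac)
        qed
        also have "\<dots> = 2 * (ennreal (g r * w r) * indicator {0<..<t} r * indicator {0<..<1} r)"
          using True r by (simp add: ennreal_mult')
        finally show ?thesis .
      qed (auto simp: indicator_def)
    qed
    also have "\<dots> = 2 * (\<integral>\<^sup>+r. ennreal (g r * w r) * indicator {0<..<t} r * indicator {0<..<1} r \<partial>lborel)"
      by (intro nn_integral_cmult) measurable
    also have "(\<integral>\<^sup>+r. ennreal (g r * w r) * indicator {0<..<t} r * indicator {0<..<1} r \<partial>lborel) =
        (\<integral>\<^sub>1r. ennreal (g r * w r) * indicator {0<..<t} r)"
      by (intro nn_integral_unit_lborel[symmetric] measurable_restrict_space1) measurable
    also have "\<dots> = ?W"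
      by (intro nn_integral_cong) (auto simp: g_def)
    finally show ?thesis .
  qed
  have "?W + ((\<integral>\<^sub>1s. J s * ennreal (ell s) * indicator {0<..<t} s) + ennreal (\<psi> t) * (2 * ennreal (Phi t))) \<le>
      ?W + (2 * ?W + ennreal (\<psi> t) * (2 * ennreal (Phi t)))"
    by (intro add_mono J2) auto
  also have "\<dots> = (1 + 2) * ?W + 2 * (ennreal (\<psi> t) * ennreal (Phi t))"
    by (simp only: distrib_right mult_1 add.assoc mult.left_commute)
  also have "(1 + 2 :: ennreal) = 3" by simp
  finally show ?thesis using 1 unfolding \<psi>_def by (rule order_trans[rotated])
qed

section \<open>Functions dominated in the weighted mean\<close>

text \<open>From \<open>G\<close>, which is dominated only in the weighted mean, pass to the smallest decreasing
  function \<open>\<phi>\<close> with \<open>G \<le> S_op \<phi>\<close>. By the estimate for decreasing majorants it is still dominated by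
  \<open>f\<close> in the ordinary mean, with the constant \<open>(3 + 2) / 2\<close>, rounded up to \<open>3\<close>; so the
  Hardy--Littlewood--Polya principle bounds its norm.\<close>

proposition S_bounded_imp_dominated:
  assumes NX: "ri_banach NX" and NY: "ri_banach NY" and C: "0 < C" and D: "0 < D"
    and S: "\<And>f. f \<in> dplus \<Longrightarrow> NX f < \<infinity> \<Longrightarrow> NY (S_op f) \<le> ennreal C * NX f"
    and G: "G \<in> dplus" and f: "f \<in> dplus"
    and dom: "\<And>t. 0 < t \<Longrightarrow> t < 1 \<Longrightarrow> (\<integral>\<^sub>1s. ennreal (G s * w s) * indicator {0<..<t} s) \<le>
      ennreal D * (\<integral>\<^sub>1s. ennreal (f s) * indicator {0<..<Phi t} s)"
  shows "NY G \<le> ennreal (C * (3 * D)) * NX f"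
proof (cases "NX f < \<infinity>")
  case False
  then have "NX f = \<top>" by (simp add: less_top[symmetric])
  then show ?thesis using C D by (simp add: ennreal_mult_top)
next
  case fin: True
  interpret NX: ri_banach NX by fact
  interpret NY: ri_banach NY by fact
  define \<psi> where "\<psi> s = (SUP r\<in>{s..<1}. G r / u r)" for s
  have Fb: "0 \<le> G s / u s \<and> G s / u s \<le> G s" if "0 < s" "s < 1" for s
    using dplus_nonneg[OF G that] u_ge_1[OF that] by (auto simp: divide_le_eq mult_le_cancel_left1)
  have "\<forall>s\<in>{0<..<1}. 0 \<le> G s / u s \<and> G s / u s \<le> G s" using Fb by simp
  note maj = decreasing_majorant[OF G this]
  have \<psi>: "\<psi> \<in> dplus" unfolding \<psi>_def[abs_def] by (rule maj(1))
  define \<phi> where "\<phi> v = \<psi> (tau v)" for v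
  have \<phi>: "\<phi> \<in> dplus"
  proof (rule dplusI)
    fix s t :: real assume st: "0 < s" "s \<le> t" "t < 1"
    then show "\<phi> t \<le> \<phi> s"
      unfolding \<phi>_def using tau_range[of s] tau_range[of t] tau_le_iff[of s t] by (intro dplus_antimono[OF \<psi>]) auto
  qed (use dplus_nonneg[OF \<psi>] tau_range in \<open>auto simp: \<phi>_def\<close>)
  let ?I = "\<lambda>v. \<integral>\<^sub>1s. ennreal (f s) * indicator {0<..<v} s"
  have mean: "(\<integral>\<^sub>1s. ennreal (\<phi> s) * indicator {0<..<v} s) \<le> ennreal (3 * D) * ?I v"
    if v: "0 < v" "v < 1" for v
  proof -
    define t where "t = tau v"
    have t: "0 < t" "t < 1" and Pt: "Phi t = v" using tau_range[OF v] Phi_tau[of v] v by (auto simp: t_def)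
    \<comment> \<open>A value \<open>G r / u r\<close> with \<open>r \<ge> t\<close> is at most \<open>D\<close> times the mean of \<open>f\<close> over \<open>(0, Phi r)\<close>, since \<open>G w\<close>
      decreases and \<open>Phi r \<le> r ell r\<close>; and the means of \<open>f\<close> decrease.\<close>
    have tail: "ennreal (\<psi> t) * ennreal v \<le> ennreal D * ?I v"
    proof (rule ccontr)
      assume "\<not> ?thesis"
      then have less: "ennreal D * ?I v < ennreal (\<psi> t) * ennreal v" by simp
      also have "\<dots> = ennreal (\<psi> t * v)" using v by (simp add: ennreal_mult'')
      finally have "ennreal D * ?I v < ennreal (\<psi> t * v)" .
      then obtain c where c: "ennreal D * ?I v = ennreal c" "0 \<le> c" "c < \<psi> t * v"
        by (cases "ennreal D * ?I v") (auto simp: ennreal_less_iff)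
      then have "c / v < \<psi> t" using v by (simp add: pos_divide_less_eq)
      then obtain r where r: "t \<le> r" "r < 1" "c / v < G r / u r"
        using maj(3)[OF t, of "c / v"] unfolding \<psi>_def by blast
      have r0: "0 < r" using t r by simp
      have "ennreal (G r * w r * r) \<le> (\<integral>\<^sub>1s. ennreal (G s * w s) * indicator {0<..<r} s)"
      proof -
        have "ennreal (G r * w r * r) = (\<integral>\<^sub>1s. ennreal (G r * w r) * indicator {0<..<r} s)"
          using r r0 by (subst nn_integral_cmult_indicator) (simp_all add: interval_unit_sets emeasure_unit_interval ennreal_mult'')
        also have "\<dots> \<le> (\<integral>\<^sub>1s. ennreal (G s * w s) * indicator {0<..<r} s)"
        proof (rule nn_integral_mono)
          fix s show "ennreal (G r * w r) * indicator {0<..<r} s \<le> ennreal (G s * w s) * indicator {0<..<r} s"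
            using dplus_antimono[OF G, of s r] dplus_nonneg[OF G, of s] w_antimono[of s r] w_ge_1[OF r0 r(2)] r
            by (auto simp: indicator_def intro!: ennreal_leI mult_mono)
        qed
        finally show ?thesis .
      qed
      also have "\<dots> \<le> ennreal D * ?I (Phi r)" by (rule dom[OF r0 r(2)])
      finally have "ennreal v * ennreal (G r * w r * r) \<le> ennreal v * (ennreal D * ?I (Phi r))"
        by (intro mult_left_mono) auto
      also have "\<dots> \<le> ennreal D * (ennreal (Phi r) * ?I v)"
        using average_antimono[OF f, of v "Phi r"] v Pt Phi_le_iff[of t r] Phi_range[OF r0 r(2)] t r
        by (simp add: mult.left_commute mult_left_mono)
      also have "\<dots> = ennreal (Phi r) * ennreal c" unfolding c(1)[symmetric] by (simp only: mult.left_commute)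
      finally have "ennreal (v * (G r * w r * r)) \<le> ennreal (Phi r * c)"
        using v Phi_range[OF r0 r(2)] by (simp add: ennreal_mult')
      then have le: "v * (G r * w r * r) \<le> Phi r * c"
        using c(2) Phi_range[OF r0 r(2)] by (simp add: ennreal_le_iff)
      have "c * u r < G r * v" using r(3) v u_ge_1[OF r0 r(2)] by (simp add: field_simps)
      then have "c * u r * (w r * r) < G r * v * (w r * r)"
        using w_ge_1[OF r0 r(2)] r0 by (intro mult_strict_right_mono) auto
      moreover have "c * u r * (w r * r) = c * (r * ell r)" unfolding w_u[OF r0 r(2), symmetric] by (simp only: mult_ac)
      moreover have "Phi r * c \<le> r * ell r * c" using Phi_le[OF r0] r c(2) by (intro mult_right_mono) auto
      moreover have "v * (G r * w r * r) = G r * v * (w r * r)" "r * ell r * c = c * (r * ell r)"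
        by (simp_all only: mult_ac)
      ultimately show False using le by linarith
    qed
    have "2 * (\<integral>\<^sub>1s. ennreal (\<phi> s) * indicator {0<..<Phi t} s) =
        (\<integral>\<^sub>1s. ennreal (\<phi> (Phi s)) * ennreal (ell s) * indicator {0<..<t} s)"
      using t dplus_borel[OF \<phi>]
      by (intro nn_integral_Phi[where h="\<lambda>s. ennreal (\<phi> s)", symmetric] measurable_compose[OF _ measurable_ennreal]) auto
    also have "\<dots> = (\<integral>\<^sub>1s. ennreal (\<psi> s) * ennreal (ell s) * indicator {0<..<t} s)"
      by (intro nn_integral_cong) (simp add: \<phi>_def tau_Phi)
    also have "\<dots> \<le> 3 * (\<integral>\<^sub>1s. ennreal (G s * w s) * indicator {0<..<t} s) + 2 * (ennreal (\<psi> t) * ennreal (Phi t))"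
      unfolding \<psi>_def by (rule majorant_integral_le[OF G t])
    also have "\<dots> \<le> 3 * (ennreal D * ?I v) + 2 * (ennreal D * ?I v)"
      using dom[OF t] tail unfolding Pt by (intro add_mono mult_left_mono) auto
    also have "\<dots> = 5 * (ennreal D * ?I v)" by (simp flip: distrib_right)
    also have "\<dots> \<le> 6 * (ennreal D * ?I v)" by (intro mult_right_mono) auto
    also have "\<dots> = 2 * (ennreal (3 * D) * ?I v)"
      using D by (simp add: ennreal_mult' mult.assoc[symmetric])
    finally have "2 * (\<integral>\<^sub>1s. ennreal (\<phi> s) * indicator {0<..<v} s) \<le> 2 * (ennreal (3 * D) * ?I v)"
      unfolding Pt .
    then show ?thesis by (subst (asm) ennreal_mult_le_mult_iff) auto
  qed
  have N\<phi>: "NX \<phi> \<le> ennreal (3 * D) * NX f"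
    using D by (intro NX.hardy_littlewood_polya \<phi> dplus_mplus f mean) auto
  then have "NX \<phi> < \<infinity>" using fin by (auto simp: ennreal_mult_less_top intro: le_less_trans)
  have "NY G \<le> NY (S_op \<phi>)"
  proof (rule NY.norm_mono[OF dplus_mplus[OF G] dplus_mplus[OF S_op_dplus[OF \<phi>]] AE_unitI])
    fix t :: real assume t: "0 < t" "t < 1"
    have "G t = G t / u t * u t" using u_ge_1[OF t] by simp
    also have "\<dots> \<le> \<psi> t * u t"
      unfolding \<psi>_def using maj(2)[OF t(1) order_refl t(2)] u_ge_1[OF t] by (intro mult_right_mono) auto
    also have "\<dots> = S_op \<phi> t" using t by (simp add: S_op_def \<phi>_def tau_Phi)
    finally show "G t \<le> S_op \<phi> t" .
  qed
  also have "\<dots> \<le> ennreal C * NX \<phi>" by (rule S[OF \<phi> \<open>NX \<phi> < \<infinity>\<close>])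
  also have "\<dots> \<le> ennreal C * (ennreal (3 * D) * NX f)" using N\<phi> by (intro mult_left_mono) auto
  also have "\<dots> = ennreal (C * (3 * D)) * NX f" using C by (simp add: ennreal_mult' mult.assoc)
  finally show ?thesis .
qed

end

section \<open>Averaging over blocks\<close>

text \<open>A partition of the unit interval is encoded by a labelling of its points; the blocks are the
  level sets.\<close>

definition block :: "(real \<Rightarrow> nat) \<Rightarrow> nat \<Rightarrow> real set" where
  "block c n = {v\<in>{0<..<1}. c v = n}"

text \<open>A null block may still contain a point; there the function is kept, so that the average
  always lies between the values of the function on the block.\<close>

definition block_average :: "(real \<Rightarrow> nat) \<Rightarrow> (real \<Rightarrow> real) \<Rightarrow> real \<Rightarrow> real" where
  "block_average c f v = (let B = block c (c v) in
     if measure unit_measure B = 0 then f v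
     else enn2real (\<integral>\<^sub>1s. ennreal (f s) * indicator B s) / measure unit_measure B)"

locale order_convex_labelling =
  fixes c :: "real \<Rightarrow> nat"
  assumes convex: "\<And>x y z. 0 < x \<Longrightarrow> x \<le> y \<Longrightarrow> y \<le> z \<Longrightarrow> z < 1 \<Longrightarrow> c x = c z \<Longrightarrow> c y = c x"
begin

lemma block_borel: "block c n \<in> sets borel"
proof (rule real_interval_borel_measurable)
  show "is_interval (block c n)"
    unfolding is_interval_1
  proof (intro ballI allI impI)
    fix a b x assume "a \<in> block c n" "b \<in> block c n" "a \<le> x \<and> x \<le> b"
    then show "x \<in> block c n" using convex[of a x b] by (auto simp: block_def)
  qed
qed

lemma block_sets: "block c n \<in> sets unit_measure"
proof -
  have "block c n \<in> sets lebesgue" using block_borel[of n] by simp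
  moreover have "block c n \<subseteq> {0<..<1}" by (auto simp: block_def)
  ultimately show ?thesis by (subst sets_restrict_space_iff) auto
qed

lemma nn_integral_blocks:
  assumes [measurable]: "f \<in> borel_measurable unit_measure"
  shows "(\<integral>\<^sub>1s. f s) = (\<Sum>n. \<integral>\<^sub>1s. f s * indicator (block c n) s)"
proof -
  have "(\<integral>\<^sub>1s. f s) = (\<integral>\<^sub>1s. (\<Sum>n. f s * indicator (block c n) s))"
  proof (rule nn_integral_cong)
    fix s assume "s \<in> space unit_measure"
    then have "(\<lambda>n. f s * indicator (block c n) s) = (\<lambda>n. if n = c s then f s else 0)"
      by (auto simp: block_def fun_eq_iff)
    moreover have "(\<Sum>n. if n = c s then f s else 0) = f s" by (intro sums_unique[symmetric] sums_single)
    ultimately show "f s = (\<Sum>n. f s * indicator (block c n) s)" by simp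
  qed
  also have "\<dots> = (\<Sum>n. \<integral>\<^sub>1s. f s * indicator (block c n) s)"
    by (intro nn_integral_suminf borel_measurable_times_ennreal assms borel_measurable_indicator block_sets)
  finally show ?thesis .
qed

context
  fixes f :: "real \<Rightarrow> real"
  assumes f: "f \<in> dplus" and fin: "(\<integral>\<^sub>1s. ennreal (f s)) < \<infinity>"
begin

lemma f_measurable: "f \<in> borel_measurable unit_measure"
  by (rule mplus_measurable[OF dplus_mplus[OF f]])

lemma block_integral_finite:
  "(\<integral>\<^sub>1s. ennreal (f s) * indicator A s) < \<infinity>"
proof -
  have "(\<integral>\<^sub>1s. ennreal (f s) * indicator A s) \<le> (\<integral>\<^sub>1s. ennreal (f s))"
    by (intro nn_integral_mono) (auto simp: indicator_def)
  then show ?thesis using fin by (rule le_less_trans)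
qed

lemma block_average_eq:
  assumes v: "v \<in> block c n" and m: "0 < measure unit_measure (block c n)"
  shows "ennreal (block_average c f v) * emeasure unit_measure (block c n) =
    (\<integral>\<^sub>1s. ennreal (f s) * indicator (block c n) s)"
proof -
  let ?I = "\<integral>\<^sub>1s. ennreal (f s) * indicator (block c n) s"
  have cv: "c v = n" using v by (simp add: block_def)
  have "ennreal (block_average c f v) * emeasure unit_measure (block c n) =
      ennreal (block_average c f v * measure unit_measure (block c n))"
    by (simp add: unit.emeasure_eq_measure ennreal_mult'')
  also have "block_average c f v * measure unit_measure (block c n) = enn2real ?I"
    using m by (simp add: block_average_def cv Let_def)
  also have "ennreal (enn2real ?I) = ?I"
    using block_integral_finite by (simp add: less_top)
  finally show ?thesis .
qed

lemma block_average_const: "v \<in> block c n \<Longrightarrow> v' \<in> block c n \<Longrightarrow> 0 < measure unit_measure (block c n) \<Longrightarrow>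
    block_average c f v = block_average c f v'"
  by (simp add: block_average_def block_def)

lemma block_average_lower:
  assumes v: "v \<in> {0<..<1}" and z: "\<And>x. x \<in> block c (c v) \<Longrightarrow> a \<le> f x" and a: "0 \<le> a"
  shows "a \<le> block_average c f v"
proof (cases "measure unit_measure (block c (c v)) = 0")
  case True
  then show ?thesis using z[of v] v by (simp add: block_average_def block_def)
next
  case False
  then have m: "0 < measure unit_measure (block c (c v))" by (simp add: zero_less_measure_iff)
  have vb: "v \<in> block c (c v)" using v by (simp add: block_def)
  have "ennreal a * emeasure unit_measure (block c (c v)) = (\<integral>\<^sub>1s. ennreal a * indicator (block c (c v)) s)"
    by (simp add: nn_integral_cmult_indicator block_sets)
  also have "\<dots> \<le> (\<integral>\<^sub>1s. ennreal (f s) * indicator (block c (c v)) s)"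
    using z by (intro nn_integral_mono) (auto simp: indicator_def ennreal_leI)
  also have "\<dots> = ennreal (block_average c f v) * emeasure unit_measure (block c (c v))"
    by (rule block_average_eq[OF vb m, symmetric])
  finally have "ennreal (a * measure unit_measure (block c (c v))) \<le> ennreal (block_average c f v * measure unit_measure (block c (c v)))"
    by (simp add: unit.emeasure_eq_measure ennreal_mult'')
  moreover have "0 \<le> block_average c f v" using m by (simp add: block_average_def Let_def)
  ultimately show ?thesis using m by (subst (asm) ennreal_le_iff) auto
qed

lemma block_average_upper:
  assumes v: "v \<in> {0<..<1}" and z: "\<And>x. x \<in> block c (c v) \<Longrightarrow> f x \<le> a" and a: "0 \<le> a"
  shows "block_average c f v \<le> a"
proof (cases "measure unit_measure (block c (c v)) = 0")
  case True
  then show ?thesis using z[of v] v by (simp add: block_average_def block_def)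
next
  case False
  then have m: "0 < measure unit_measure (block c (c v))" by (simp add: zero_less_measure_iff)
  have vb: "v \<in> block c (c v)" using v by (simp add: block_def)
  have "ennreal (block_average c f v) * emeasure unit_measure (block c (c v)) = (\<integral>\<^sub>1s. ennreal (f s) * indicator (block c (c v)) s)"
    by (rule block_average_eq[OF vb m])
  also have "\<dots> \<le> (\<integral>\<^sub>1s. ennreal a * indicator (block c (c v)) s)"
    using z by (intro nn_integral_mono) (auto simp: indicator_def ennreal_leI)
  also have "\<dots> = ennreal a * emeasure unit_measure (block c (c v))"
    by (simp add: nn_integral_cmult_indicator block_sets)
  finally have "ennreal (block_average c f v * measure unit_measure (block c (c v))) \<le> ennreal (a * measure unit_measure (block c (c v)))"
    by (simp add: unit.emeasure_eq_measure ennreal_mult'')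
  then show ?thesis using m a by (subst (asm) ennreal_le_iff) auto
qed

text \<open>Distinct order-convex blocks lie entirely to the left or to the right of each other, and an
  average lies between the values on its block.\<close>

lemma block_average_dplus: "block_average c f \<in> dplus"
proof (rule dplusI)
  fix s t :: real assume st: "0 < s" "s \<le> t" "t < 1"
  have t0: "0 \<le> f t" using dplus_nonneg[OF f, of t] st by simp
  show "block_average c f t \<le> block_average c f s"
  proof (cases "c s = c t")
    case True
    have b: "s \<in> block c (c t)" "t \<in> block c (c t)" using st True by (auto simp: block_def)
    show ?thesis
    proof (cases "measure unit_measure (block c (c t)) = 0")
      case True
      then show ?thesis using dplus_antimono[OF f st] \<open>c s = c t\<close> by (simp add: block_average_def)
    next
      case False
      then have "0 < measure unit_measure (block c (c t))" by (simp add: zero_less_measure_iff)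
      then show ?thesis using block_average_const[OF b] by simp
    qed
  next
    case False
    then have "s < t" using st by (cases "s = t") auto
    have left: "x < y" if x: "x \<in> block c (c s)" and y: "y \<in> block c (c t)" for x y
    proof (rule ccontr)
      assume "\<not> x < y"
      have xs: "0 < x" "x < 1" "c x = c s" and yt: "0 < y" "y < 1" "c y = c t" using x y by (auto simp: block_def)
      have "x < t"
      proof (rule ccontr)
        assume "\<not> x < t"
        then have "c t = c s" using convex[of s t x] st xs by simp
        with False show False by simp
      qed
      then have "c x = c y" using convex[of y x t] \<open>\<not> x < y\<close> st yt by simp
      with False xs yt show False by simp
    qed
    show ?thesis
    proof (rule block_average_upper)
      fix y assume y: "y \<in> block c (c t)"
      then have y01: "0 < y" "y < 1" by (auto simp: block_def)
      show "f y \<le> block_average c f s"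
      proof (rule block_average_lower)
        fix x assume x: "x \<in> block c (c s)"
        then show "f y \<le> f x" using left[OF x y] y01 by (intro dplus_antimono[OF f]) (auto simp: block_def)
      qed (use st dplus_nonneg[OF f y01] in auto)
    next
      show "0 \<le> block_average c f s"
        by (rule block_average_lower) (use st dplus_nonneg[OF f] in \<open>auto simp: block_def\<close>)
    qed (use st in auto)
  qed
next
  fix t :: real assume "0 < t" "t < 1"
  then show "0 \<le> block_average c f t"
    by (intro block_average_lower) (use dplus_nonneg[OF f] in \<open>auto simp: block_def\<close>)
qed

text \<open>Block by block: \<open>f\<close> is at least \<open>f t\<close> on the part of the block to the left of \<open>t\<close> and at most
  \<open>f t\<close> on the rest, so the mean over the block is at most the mean over the left part. Together with
  the Hardy--Littlewood--Polya principle this bounds the norm of the average.\<close>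

lemma block_average_mean_le:
  assumes t: "0 < t" "t < 1"
  shows "(\<integral>\<^sub>1s. ennreal (block_average c f s) * indicator {0<..<t} s) \<le>
    (\<integral>\<^sub>1s. ennreal (f s) * indicator {0<..<t} s)"
proof -
  note [measurable] = f_measurable mplus_measurable[OF dplus_mplus[OF block_average_dplus]]
  have "(\<integral>\<^sub>1s. ennreal (block_average c f s) * indicator {0<..<t} s * indicator (block c n) s) \<le>
      (\<integral>\<^sub>1s. ennreal (f s) * indicator {0<..<t} s * indicator (block c n) s)" (is "?L \<le> ?R") for n
  proof (cases "measure unit_measure (block c n) = 0")
    case True
    then have "block c n \<in> null_sets unit_measure"
      using block_sets by (auto simp: unit.emeasure_eq_measure)
    then have "AE s in unit_measure. s \<notin> block c n" by (rule AE_not_in)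
    then have "?L = (\<integral>\<^sub>1s. 0)" by (intro nn_integral_cong_AE) (auto elim: eventually_mono)
    then show ?thesis by simp
  next
    case False
    then have m: "0 < measure unit_measure (block c n)" by (simp add: zero_less_measure_iff)
    then obtain v where v: "v \<in> block c n" by (metis equals0I measure_empty less_irrefl)
    define a where "a = block_average c f v"
    have a: "block_average c f s = a" if "s \<in> block c n" for s
      unfolding a_def using block_average_const[OF that v m] .
    have v01: "0 < v" "v < 1" using v by (auto simp: block_def)
    have a0: "0 \<le> a" unfolding a_def using dplus_nonneg[OF block_average_dplus v01] .
    let ?B1 = "block c n \<inter> {0<..<t}" and ?B2 = "block c n - {0<..<t}"
    let ?m1 = "measure unit_measure ?B1" and ?m2 = "measure unit_measure ?B2"
    have tset: "{0<..<t} \<in> sets unit_measure" using t by (intro interval_unit_sets) simp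
    have B1: "?B1 \<in> sets unit_measure" and B2: "?B2 \<in> sets unit_measure"
      using block_sets[of n] tset by auto
    have msum: "measure unit_measure (block c n) = ?m1 + ?m2"
      using unit.finite_measure_Union[OF B1 B2] by (simp add: Int_Diff_Un) (metis Int_Diff_Un Int_Diff_disjoint)
    define I1 where "I1 = enn2real (\<integral>\<^sub>1s. ennreal (f s) * indicator ?B1 s)"
    define I2 where "I2 = enn2real (\<integral>\<^sub>1s. ennreal (f s) * indicator ?B2 s)"
    have I1: "(\<integral>\<^sub>1s. ennreal (f s) * indicator ?B1 s) = ennreal I1"
      and I2: "(\<integral>\<^sub>1s. ennreal (f s) * indicator ?B2 s) = ennreal I2"
      using block_integral_finite by (simp_all add: I1_def I2_def less_top)
    have I0: "0 \<le> I1" "0 \<le> I2" by (simp_all add: I1_def I2_def)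
    have ft: "0 \<le> f t" using dplus_nonneg[OF f t] .
    have "ennreal (f t * ?m1) = (\<integral>\<^sub>1s. ennreal (f t) * indicator ?B1 s)"
      using B1 by (simp add: nn_integral_cmult_indicator unit.emeasure_eq_measure ennreal_mult'')
    also have "\<dots> \<le> ennreal I1" unfolding I1[symmetric]
      using dplus_antimono[OF f, of _ t] t by (intro nn_integral_mono) (auto simp: indicator_def ennreal_leI)
    finally have 1: "f t * ?m1 \<le> I1" using I0 by simp
    have "ennreal I2 \<le> (\<integral>\<^sub>1s. ennreal (f t) * indicator ?B2 s)" unfolding I2[symmetric]
      using dplus_antimono[OF f t(1)] by (intro nn_integral_mono) (auto simp: indicator_def block_def intro!: ennreal_leI)
    also have "\<dots> = ennreal (f t * ?m2)"
      using B2 by (simp add: nn_integral_cmult_indicator unit.emeasure_eq_measure ennreal_mult'')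
    finally have 2: "I2 \<le> f t * ?m2" using ft by (simp add: ennreal_le_iff)
    have "ennreal (a * (?m1 + ?m2)) = (\<integral>\<^sub>1s. ennreal (f s) * indicator (block c n) s)"
      using block_average_eq[OF v m] by (simp add: a_def unit.emeasure_eq_measure msum ennreal_mult'')
    also have "\<dots> = (\<integral>\<^sub>1s. ennreal (f s) * indicator ?B1 s + ennreal (f s) * indicator ?B2 s)"
      by (intro nn_integral_cong) (auto simp: indicator_def)
    also have "\<dots> = ennreal (I1 + I2)"
      using B1 B2 I0 by (subst nn_integral_add) (auto simp: I1 I2)
    finally have e: "ennreal (a * (?m1 + ?m2)) = ennreal (I1 + I2)" .
    have 3: "a * (?m1 + ?m2) = I1 + I2" by (rule ennreal_inj[THEN iffD1, OF _ _ e]) (use a0 I0 in auto)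
    have "I2 * ?m1 \<le> (f t * ?m2) * ?m1" using 2 by (intro mult_right_mono) auto
    also have "\<dots> = (f t * ?m1) * ?m2" by simp
    also have "\<dots> \<le> I1 * ?m2" using 1 by (intro mult_right_mono) auto
    finally have "(I1 + I2) * ?m1 \<le> I1 * (?m1 + ?m2)" by (simp add: algebra_simps)
    then have "(a * ?m1) * (?m1 + ?m2) \<le> I1 * (?m1 + ?m2)" unfolding 3[symmetric] by (simp add: mult_ac)
    then have am: "a * ?m1 \<le> I1" using m msum by simp
    have "?L = (\<integral>\<^sub>1s. ennreal a * indicator ?B1 s)"
      using a by (intro nn_integral_cong) (auto simp: indicator_def)
    also have "\<dots> = ennreal (a * ?m1)"
      using B1 by (simp add: nn_integral_cmult_indicator unit.emeasure_eq_measure ennreal_mult'')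
    also have "\<dots> \<le> ennreal I1" using am by (rule ennreal_leI)
    also have "\<dots> = ?R" unfolding I1[symmetric] by (intro nn_integral_cong) (auto simp: indicator_def)
    finally show ?thesis .
  qed
  then show ?thesis
    by (subst (1 2) nn_integral_blocks) (measurable, auto intro!: suminf_le)
qed

end

end

section \<open>The supremum operator\<close>

context gauss_weights
begin

lemma w_tau_ge_1: "0 < v \<Longrightarrow> v < 1 \<Longrightarrow> 1 \<le> w (tau v)"
  using w_ge_1[of "tau v"] tau_range[of v] by simp

lemma w_tau_antimono: "0 < v \<Longrightarrow> v \<le> v' \<Longrightarrow> v' \<le> 1 \<Longrightarrow> w (tau v') \<le> w (tau v)"
proof -
  assume v: "0 < v" "v \<le> v'" "v' \<le> 1"
  then have "0 < tau v" "tau v \<le> tau v'" "tau v' \<le> 1"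
    using tau_less_iff[of 0 v] tau_le_iff[of v v'] tau_range_closed[of v'] tau_Phi[of 0] by auto
  then show ?thesis
    unfolding w_def using ell_ge_1[of "tau v'"] ell_antimono[of "tau v" "tau v'"] exponents by (intro powr_mono2) auto
qed

text \<open>The weight varies slowly. For \<open>y = tau b\<close>, the inequality \<open>Phi (y / 4) \<le> Phi y / 2\<close> gives
  \<open>y / 4 \<le> tau (b / 2)\<close>, and \<open>ell (y / 4) = ell y + ln 4\<close> is at most \<open>3 ell y\<close>; the exponent of \<open>ell\<close> in \<open>w\<close>
  is below 1.\<close>

lemma w_tau_half:
  assumes b: "0 < b" "b \<le> 1"
  shows "w (tau (b / 2)) \<le> 3 * w (tau b)"
proof -
  define y where "y = tau b"
  have y: "0 < y" "y \<le> 1" "Phi y = b"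
    unfolding y_def using tau_less_iff[of 0 b] tau_range_closed[of b] tau_Phi[of 0] Phi_tau[of b] b by auto
  have ln4: "ln (4::real) = 2 * ln 2" using ln_realpow[of 2 2] by simp
  have ln2: "ln (2::real) \<le> 1" using ln_le_minus_one[of 2] by simp
  have ly: "ln (y / 4) = ln y - 2 * ln 2" using y by (simp add: ln_div ln4)
  have "ln y \<le> 0" using y by simp
  then have "2 - ln (y / 4) \<le> 2 * (2 - ln y)" unfolding ly using ln2 by (simp add: algebra_simps)
  then have "(y / 8) * (2 - ln (y / 4)) \<le> (y / 8) * (2 * (2 - ln y))" using y by (intro mult_left_mono) auto
  moreover have "Phi (y / 4) = (y / 8) * (2 - ln (y / 4))" by (simp add: Phi_def)
  moreover have "b / 2 = (y / 8) * (2 * (2 - ln y))" unfolding y(3)[symmetric] by (simp add: Phi_def field_simps)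
  ultimately have "Phi (y / 4) \<le> b / 2" by simp
  then have "tau (Phi (y / 4)) \<le> tau (b / 2)"
    using b y Phi_le_iff[of 0 "y / 4"] by (subst tau_le_iff) auto
  then have le: "y / 4 \<le> tau (b / 2)" using y by (simp add: tau_Phi)
  have th: "tau (b / 2) \<le> 1" using tau_range_closed[of "b / 2"] b by simp
  have e1: "1 \<le> ell y" using y by (intro ell_ge_1) auto
  have "ell (tau (b / 2)) \<le> ell (y / 4)" using le y by (intro ell_antimono) auto
  also have "\<dots> = ell y + 2 * ln 2" unfolding ell_def ly by simp
  also have "\<dots> \<le> 3 * ell y" using ln2 e1 by simp
  finally have "ell (tau (b / 2)) powr (\<alpha> * p) \<le> (3 * ell y) powr (\<alpha> * p)"
    using exponents le y th ell_ge_1[of "tau (b / 2)"] by (intro powr_mono2) auto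
  also have "\<dots> = 3 powr (\<alpha> * p) * w y" by (simp add: powr_mult w_def)
  also have "\<dots> \<le> 3 powr 1 * w y" using exponents by (intro mult_right_mono powr_mono) (auto simp: w_def)
  finally show ?thesis by (simp add: w_def y_def)
qed

context
  fixes k :: "real \<Rightarrow> real"
  assumes k: "k \<in> dplus"
begin

lemma quotient_bounds: "\<forall>s\<in>{0<..<1}. 0 \<le> k (tau s) / w (tau s) \<and> k (tau s) / w (tau s) \<le> k (tau s)"
proof
  fix s :: real assume "s \<in> {0<..<1}"
  then have s: "0 < s" "s < 1" by auto
  have "0 \<le> k (tau s)" using dplus_nonneg[OF k] tau_range[OF s] by simp
  then show "0 \<le> k (tau s) / w (tau s) \<and> k (tau s) / w (tau s) \<le> k (tau s)"
    using w_tau_ge_1[OF s] by (auto simp: divide_le_eq mult_le_cancel_left1)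
qed

lemma k_tau_dplus: "(\<lambda>s. k (tau s)) \<in> dplus"
proof (rule dplusI)
  fix s t :: real assume st: "0 < s" "s \<le> t" "t < 1"
  then show "k (tau t) \<le> k (tau s)"
    using tau_range[of s] tau_range[of t] tau_le_iff[of s t] by (intro dplus_antimono[OF k]) auto
qed (use dplus_nonneg[OF k] tau_range in auto)

lemmas Sup_op_maj = decreasing_majorant[OF k_tau_dplus quotient_bounds, folded Sup_op_def]

lemma Sup_op_dplus: "Sup_op k \<in> dplus"
  using Sup_op_maj(1) unfolding Sup_op_def[abs_def, symmetric] .

lemma quotient_measurable: "(\<lambda>s. k (tau s) / w (tau s)) \<in> borel_measurable (restrict_space borel {0<..<1})"
  by (intro borel_measurable_divide dplus_borel[OF k_tau_dplus] measurable_compose[OF tau_measurable] w_measurable)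

text \<open>The adjoint of \<open>S_op\<close>: as \<open>u = ell / w\<close> and \<open>ell\<close> is twice the derivative of \<open>Phi\<close>, the substitution
  \<open>v = Phi s\<close> moves the operator to the other factor.\<close>

lemma pairing_S_op:
  assumes f: "f \<in> dplus"
  shows "(\<integral>\<^sub>1s. ennreal (k s * S_op f s)) = 2 * (\<integral>\<^sub>1v. ennreal (k (tau v) / w (tau v)) * ennreal (f v))"
proof -
  have "(\<integral>\<^sub>1s. ennreal (k s * S_op f s)) =
      (\<integral>\<^sub>1s. (ennreal (k (tau (Phi s)) / w (tau (Phi s))) * ennreal (f (Phi s))) * ennreal (ell s) * indicator {0<..<1} s)"
  proof (rule nn_integral_cong)
    fix s assume "s \<in> space unit_measure"
    then have s: "0 < s" "s < 1" by auto
    have 0: "0 \<le> k s" "0 \<le> f (Phi s)" using dplus_nonneg[OF k s] dplus_nonneg[OF f] Phi_range[OF s] by auto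
    have "k s * S_op f s = k s / w s * f (Phi s) * ell s"
      using w_ge_1[OF s] by (simp add: S_op_def field_simps flip: w_u[OF s])
    then show "ennreal (k s * S_op f s) =
        (ennreal (k (tau (Phi s)) / w (tau (Phi s))) * ennreal (f (Phi s))) * ennreal (ell s) * indicator {0<..<1} s"
      using s 0 w_ge_1[OF s] ell_pos[OF s] by (simp add: tau_Phi ennreal_mult' flip: ennreal_mult')
  qed
  also have "\<dots> = 2 * (\<integral>\<^sub>1v. (ennreal (k (tau v) / w (tau v)) * ennreal (f v)) * indicator {0<..<Phi 1} v)"
    using quotient_measurable dplus_borel[OF f]
    by (intro nn_integral_Phi[where h="\<lambda>v. ennreal (k (tau v) / w (tau v)) * ennreal (f v)"] borel_measurable_times_ennreal measurable_compose[OF _ measurable_ennreal]) auto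
  also have "(\<integral>\<^sub>1v. (ennreal (k (tau v) / w (tau v)) * ennreal (f v)) * indicator {0<..<Phi 1} v) =
      (\<integral>\<^sub>1v. ennreal (k (tau v) / w (tau v)) * ennreal (f v))"
    by (intro nn_integral_cong) (auto simp: indicator_def)
  finally show ?thesis .
qed

text \<open>Points have the same label if the supremum there lies between the same consecutive powers of
  two. The integer exponents are coded as natural numbers, and \<open>0\<close> is left for the points where the
  supremum vanishes.\<close>

definition level :: "real \<Rightarrow> nat" where
  "level v = (if Sup_op k v \<le> 0 then 0 else Suc (int_encode \<lceil>log 2 (Sup_op k v)\<rceil>))"

lemma order_convex_level: "order_convex_labelling level"
proof
  fix x y z assume xyz: "0 < x" "x \<le> y" "y \<le> z" "z < 1" and eq: "level x = level z"
  have d: "Sup_op k z \<le> Sup_op k y" "Sup_op k y \<le> Sup_op k x" "0 \<le> Sup_op k z"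
    using dplus_antimono[OF Sup_op_dplus, of y z] dplus_antimono[OF Sup_op_dplus, of x y] dplus_nonneg[OF Sup_op_dplus, of z] xyz by auto
  show "level y = level x"
  proof (cases "Sup_op k z \<le> 0")
    case True
    then have "level z = 0" by (simp add: level_def)
    then have "Sup_op k x \<le> 0" using eq by (auto simp: level_def split: if_splits)
    then show ?thesis using d by (simp add: level_def)
  next
    case False
    then have pos: "0 < Sup_op k z" "0 < Sup_op k y" "0 < Sup_op k x" using d by auto
    then have "\<lceil>log 2 (Sup_op k x)\<rceil> = \<lceil>log 2 (Sup_op k z)\<rceil>" using eq by (simp add: level_def int_encode_eq)
    moreover have "\<lceil>log 2 (Sup_op k z)\<rceil> \<le> \<lceil>log 2 (Sup_op k y)\<rceil>" "\<lceil>log 2 (Sup_op k y)\<rceil> \<le> \<lceil>log 2 (Sup_op k x)\<rceil>"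
      using d pos by (auto intro!: ceiling_mono)
    ultimately have "\<lceil>log 2 (Sup_op k y)\<rceil> = \<lceil>log 2 (Sup_op k x)\<rceil>" by simp
    then show ?thesis using pos by (simp add: level_def)
  qed
qed

text \<open>Let \<open>b\<close> be the right end of a block on which the supremum lies between \<open>L / 2\<close> and \<open>L\<close>. From each
  point \<open>v\<close> of the block a value of \<open>k / w\<close> above \<open>L / 2\<close> is reached at some later point, which is still in
  the block; there \<open>k\<close> is at most its value at \<open>v\<close>, and \<open>w\<close> at least its value at \<open>b\<close>. So at \<open>v\<close> the numerator is at least
  \<open>L / 2\<close> times the weight at \<open>b\<close>. For \<open>v \<ge> b / 2\<close> the weight at \<open>v\<close> is at most three times the weight at
  \<open>b\<close>, which leaves \<open>L / 6\<close> for \<open>k / w\<close>; and at least half of the block lies beyond \<open>b / 2\<close>.\<close>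

lemma block_mean_lower:
  assumes n: "n \<noteq> 0" and v0: "v0 \<in> block level n"
  shows "\<exists>L>0. (\<forall>v\<in>block level n. Sup_op k v \<le> L) \<and>
    ennreal L * emeasure unit_measure (block level n) \<le>
      12 * (\<integral>\<^sub>1v. ennreal (k (tau v) / w (tau v)) * indicator (block level n) v)"
proof -
  interpret order_convex_labelling level by (rule order_convex_level)
  let ?B = "block level n" and ?q = "\<lambda>v. k (tau v) / w (tau v)"
  define j where "j = \<lceil>log 2 (Sup_op k v0)\<rceil>"
  define L where "L = (2::real) powr j"
  have lev: "v \<in> ?B \<longleftrightarrow> 0 < v \<and> v < 1 \<and> L / 2 < Sup_op k v \<and> Sup_op k v \<le> L" for v
  proof -
    have nj: "n = Suc (int_encode j)" using v0 n by (auto simp: block_def level_def j_def split: if_splits)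
    have "level v = n \<longleftrightarrow> L / 2 < Sup_op k v \<and> Sup_op k v \<le> L"
    proof (cases "Sup_op k v \<le> 0")
      case True
      moreover have "0 < L / 2" by (simp add: L_def)
      ultimately show ?thesis by (auto simp: level_def nj)
    next
      case False
      then have pos: "0 < Sup_op k v" by simp
      have "level v = n \<longleftrightarrow> \<lceil>log 2 (Sup_op k v)\<rceil> = j" using False by (simp add: level_def nj int_encode_eq)
      also have "\<dots> \<longleftrightarrow> j - 1 < log 2 (Sup_op k v) \<and> log 2 (Sup_op k v) \<le> j" by (simp add: ceiling_eq_iff)
      also have "\<dots> \<longleftrightarrow> 2 powr (j - 1) < Sup_op k v \<and> Sup_op k v \<le> 2 powr j"
        using pos by (simp add: less_log_iff log_le_iff)
      also have "2 powr (real_of_int (j - 1)) = L / 2" by (simp add: L_def powr_diff)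
      finally show ?thesis by (simp add: L_def)
    qed
    then show ?thesis by (auto simp: block_def)
  qed
  have L: "0 < L" by (simp add: L_def)
  define b where "b = Sup ?B"
  have B01: "0 < v" "v < 1" if "v \<in> ?B" for v using that by (auto simp: block_def)
  have bdd: "bdd_above ?B" using B01 by (intro bdd_aboveI[of _ 1]) (auto intro: less_imp_le)
  have vb: "v \<le> b" if "v \<in> ?B" for v unfolding b_def using that bdd by (rule cSup_upper)
  have b: "0 < b" "b \<le> 1"
  proof -
    show "0 < b" using vb[OF v0] B01[OF v0] by simp
    show "b \<le> 1" unfolding b_def using v0 B01 by (intro cSup_least) (auto intro: less_imp_le)
  qed
  have k_lower: "L / 2 * w (tau b) \<le> k (tau v)" if v: "v \<in> ?B" for v
  proof -
    have "L / 2 < Sup_op k v" using v lev by simp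
    then obtain s where s: "v \<le> s" "s < 1" "L / 2 < ?q s" using Sup_op_maj(3)[of v "L / 2"] B01[OF v] by auto
    have s0: "0 < s" using s B01[OF v] by simp
    have "?q s \<le> Sup_op k s" using Sup_op_maj(2)[of s s] s s0 by simp
    then have "L / 2 < Sup_op k s" by (rule less_le_trans[OF s(3)])
    moreover have "Sup_op k s \<le> Sup_op k v" using dplus_antimono[OF Sup_op_dplus B01(1)[OF v] s(1,2)] .
    moreover have "Sup_op k v \<le> L" using v lev by simp
    ultimately have "s \<in> ?B" using s s0 lev[of s] by simp
    then have "w (tau b) \<le> w (tau s)" using vb b by (intro w_tau_antimono s0) auto
    then have "L / 2 * w (tau b) \<le> L / 2 * w (tau s)" using L by (intro mult_left_mono) auto
    also have "\<dots> \<le> k (tau s)" using s(3) w_tau_ge_1[OF s0 s(2)] by (simp add: field_simps)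
    also have "\<dots> \<le> k (tau v)" using dplus_antimono[OF k_tau_dplus B01(1)[OF v] s(1,2)] .
    finally show ?thesis .
  qed
  have q_lower: "L / 6 \<le> ?q v" if v: "v \<in> ?B" "b / 2 \<le> v" for v
  proof -
    have "w (tau v) \<le> 3 * w (tau b)"
      using w_tau_antimono[of "b / 2" v] w_tau_half[OF b] v B01[OF v(1)] b by auto
    then have "L / 6 * w (tau v) \<le> L / 6 * (3 * w (tau b))" using L by (intro mult_left_mono) auto
    also have "\<dots> \<le> k (tau v)" using k_lower[OF v(1)] by simp
    finally show ?thesis using w_tau_ge_1[OF B01[OF v(1)]] by (simp add: pos_le_divide_eq)
  qed
  let ?R = "?B \<inter> {b / 2<..}"
  have R_sets: "?R \<in> sets unit_measure"
  proof -
    have "?R \<in> sets borel" using block_borel[of n] by simp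
    then have "?R \<in> sets lebesgue" by simp
    moreover have "?R \<subseteq> {0<..<1}" using B01 by auto
    ultimately show ?thesis by (subst sets_restrict_space_iff) auto
  qed
  have half: "unit.prob ?B \<le> 2 * unit.prob ?R"
  proof (cases "\<exists>y\<in>?B. y \<le> b / 2")
    case True
    then obtain y where y: "y \<in> ?B" "y \<le> b / 2" by auto
    have sub: "{b / 2<..<b} \<subseteq> ?R"
    proof
      fix x assume x: "x \<in> {b / 2<..<b}"
      then obtain z where z: "z \<in> ?B" "x < z" using less_cSup_iff[of ?B x] v0 bdd by (auto simp: b_def)
      have yz: "0 < y" "z < 1" "level y = n" "level z = n" using y z by (simp_all add: block_def)
      have yx: "y \<le> x" "x \<le> z" "b / 2 < x" using x y z by simp_all
      have "level x = level y" using convex[of y x z] yz yx by simp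
      then show "x \<in> ?R" using yz yx by (simp add: block_def)
    qed
    have "unit.prob ?B \<le> b"
    proof -
      have "emeasure unit_measure ?B = emeasure lebesgue ?B"
        using B01 by (intro emeasure_restrict_space) auto
      also have "\<dots> \<le> emeasure lebesgue {0<..b}"
        using vb B01 by (intro emeasure_mono) auto
      also have "\<dots> = ennreal b" using b by simp
      finally have "emeasure unit_measure ?B \<le> ennreal b" .
      then show ?thesis using b by (simp add: unit.emeasure_eq_measure)
    qed
    also have "b = 2 * unit.prob {b / 2<..<b}"
    proof -
      have "emeasure unit_measure {b / 2<..<b} = ennreal (b / 2)"
        using b by (subst emeasure_restrict_space) auto
      then have "unit.prob {b / 2<..<b} = b / 2" using b by (simp add: measure_def)
      then show ?thesis by simp
    qed
    also have "\<dots> \<le> 2 * unit.prob ?R" using unit.finite_measure_mono[OF sub R_sets] by simp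
    finally show ?thesis .
  next
    case False
    then have "?R = ?B" by (auto simp: not_le)
    then show ?thesis by simp
  qed
  have "ennreal L * emeasure unit_measure ?B \<le> ennreal (12 * (L / 6 * unit.prob ?R))"
    using half L by (simp add: unit.emeasure_eq_measure flip: ennreal_mult') 
  also have "\<dots> = 12 * (ennreal (L / 6) * emeasure unit_measure ?R)"
    using L by (simp only: ennreal_mult' unit.emeasure_eq_measure ennreal_numeral zero_le_numeral less_imp_le divide_nonneg_pos zero_less_numeral)
  also have "ennreal (L / 6) * emeasure unit_measure ?R = (\<integral>\<^sub>1v. ennreal (L / 6) * indicator ?R v)"
    using R_sets by (simp only: nn_integral_cmult_indicator)
  also have "12 * \<dots> \<le> 12 * (\<integral>\<^sub>1v. ennreal (?q v) * indicator ?B v)"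
    using q_lower by (intro mult_left_mono nn_integral_mono) (auto simp: indicator_def ennreal_leI)
  finally show ?thesis using L lev by (intro exI[of _ L]) auto
qed

text \<open>On a block the supremum is at most \<open>L\<close>, which is bounded by twelve times the mean of \<open>k / w\<close>; and
  multiplying this mean by the integral of \<open>f\<close> is the same as integrating \<open>k / w\<close> against the mean of \<open>f\<close>.\<close>

lemma Sup_op_pairing_le:
  assumes f: "f \<in> dplus" and fin: "(\<integral>\<^sub>1s. ennreal (f s)) < \<infinity>"
  shows "(\<integral>\<^sub>1v. ennreal (Sup_op k v) * ennreal (f v)) \<le>
    12 * (\<integral>\<^sub>1v. ennreal (k (tau v) / w (tau v)) * ennreal (block_average level f v))"
proof -
  interpret order_convex_labelling level by (rule order_convex_level)
  note avg = block_average_dplus[OF f fin]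
  note [measurable] = mplus_measurable[OF dplus_mplus[OF f]] mplus_measurable[OF dplus_mplus[OF avg]]
    mplus_measurable[OF dplus_mplus[OF Sup_op_dplus]] borel_unit_measurable[OF quotient_measurable]
  let ?q = "\<lambda>v. k (tau v) / w (tau v)"
  have "(\<integral>\<^sub>1v. ennreal (Sup_op k v) * ennreal (f v) * indicator (block level n) v) \<le>
      12 * (\<integral>\<^sub>1v. ennreal (?q v) * ennreal (block_average level f v) * indicator (block level n) v)"
    (is "?l \<le> 12 * ?r") for n
  proof -
    consider "n = 0" | "measure unit_measure (block level n) = 0" | "n \<noteq> 0" "0 < measure unit_measure (block level n)"
      by (auto simp: zero_less_measure_iff)
    then show ?thesis
    proof cases
      case 1
      then have "?l = (\<integral>\<^sub>1v. 0)"
        by (intro nn_integral_cong) (auto simp: block_def level_def indicator_def ennreal_neg split: if_splits)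
      then show ?thesis by simp
    next
      case 2
      then have "block level n \<in> null_sets unit_measure"
        using block_sets by (auto simp: unit.emeasure_eq_measure)
      then have "AE s in unit_measure. s \<notin> block level n" by (rule AE_not_in)
      then have "?l = (\<integral>\<^sub>1s. 0)" by (intro nn_integral_cong_AE) (auto elim: eventually_mono)
      then show ?thesis by simp
    next
      case 3
      then obtain v0 where v0: "v0 \<in> block level n" by (metis equals0I measure_empty less_irrefl)
      obtain L where L: "0 < L" "\<forall>v\<in>block level n. Sup_op k v \<le> L"
        "ennreal L * emeasure unit_measure (block level n) \<le> 12 * (\<integral>\<^sub>1v. ennreal (?q v) * indicator (block level n) v)"
        using block_mean_lower[OF 3(1) v0] by blast
      let ?a = "ennreal (block_average level f v0)"
      have "?l \<le> (\<integral>\<^sub>1v. ennreal L * (ennreal (f v) * indicator (block level n) v))"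
        using L(2) by (intro nn_integral_mono) (auto simp: indicator_def intro!: mult_right_mono ennreal_leI)
      also have "\<dots> = ennreal L * (\<integral>\<^sub>1v. ennreal (f v) * indicator (block level n) v)"
        by (intro nn_integral_cmult borel_measurable_times_ennreal borel_measurable_indicator block_sets) measurable
      also have "\<dots> = ennreal L * (?a * emeasure unit_measure (block level n))"
        by (simp only: block_average_eq[OF f fin v0 3(2)])
      also have "\<dots> = ?a * (ennreal L * emeasure unit_measure (block level n))" by (simp only: mult.left_commute)
      also have "\<dots> \<le> ?a * (12 * (\<integral>\<^sub>1v. ennreal (?q v) * indicator (block level n) v))"
        by (intro mult_left_mono L(3)) auto
      also have "\<dots> = 12 * (?a * (\<integral>\<^sub>1v. ennreal (?q v) * indicator (block level n) v))"
        by (simp only: mult.left_commute)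
      also have "?a * (\<integral>\<^sub>1v. ennreal (?q v) * indicator (block level n) v) =
          (\<integral>\<^sub>1v. ?a * (ennreal (?q v) * indicator (block level n) v))"
        by (intro nn_integral_cmult[symmetric] borel_measurable_times_ennreal borel_measurable_indicator block_sets) measurable
      also have "\<dots> = ?r"
      proof (rule nn_integral_cong)
        fix v show "?a * (ennreal (?q v) * indicator (block level n) v) =
            ennreal (?q v) * ennreal (block_average level f v) * indicator (block level n) v"
          using block_average_const[OF f fin _ v0 3(2), of v] by (auto simp: indicator_def mult.commute)
      qed
      finally show ?thesis .
    qed
  qed
  then have "(\<Sum>n. \<integral>\<^sub>1v. ennreal (Sup_op k v) * ennreal (f v) * indicator (block level n) v) \<le>
      (\<Sum>n. 12 * (\<integral>\<^sub>1v. ennreal (?q v) * ennreal (block_average level f v) * indicator (block level n) v))"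
    by (intro suminf_le) auto
  also have "\<dots> = 12 * (\<Sum>n. \<integral>\<^sub>1v. ennreal (?q v) * ennreal (block_average level f v) * indicator (block level n) v)"
    by (rule ennreal_suminf_cmult)
  finally show ?thesis
    by (subst (1 2) nn_integral_blocks) simp_all
qed

end

text \<open>Replace \<open>f\<close> by its block averages, which removes the supremum and does not increase the norm;
  what remains is the pairing of \<open>k\<close> with \<open>S_op\<close> of the average. The constant is \<open>6 = 12 / 2\<close>, the half
  coming from the adjoint formula.\<close>

proposition S_bounded_imp_Sup_dual:
  assumes NX: "ri_banach NX" and NY: "ri_banach NY" and C: "0 < C" and K: "0 \<le> K"
    and S: "\<And>f. f \<in> dplus \<Longrightarrow> NX f < \<infinity> \<Longrightarrow> NY (S_op f) \<le> ennreal C * NX f"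
    and k: "k \<in> dplus" and dual: "\<And>g. g \<in> mplus \<Longrightarrow> NY g < \<infinity> \<Longrightarrow> (\<integral>\<^sub>1s. ennreal (k s * g s)) \<le> ennreal K * NY g"
    and f: "f \<in> dplus" "NX f < \<infinity>"
  shows "(\<integral>\<^sub>1v. ennreal (Sup_op k v) * ennreal (f v)) \<le> ennreal (6 * K * C) * NX f"
proof -
  interpret NX: ri_banach NX by fact
  interpret order_convex_labelling "level k" by (rule order_convex_level[OF k])
  obtain c where c: "0 < c" "(\<integral>\<^sub>1s. ennreal (f s)) \<le> ennreal c * NX f"
    using NX.norm_L1[of thesis] dplus_mplus[OF f(1)] by blast
  then have fin: "(\<integral>\<^sub>1s. ennreal (f s)) < \<infinity>"
    using f(2) by (auto simp: ennreal_mult_less_top intro: le_less_trans)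
  let ?f = "block_average (level k) f" and ?q = "\<lambda>v. k (tau v) / w (tau v)"
  note avg = block_average_dplus[OF f(1) fin]
  have "NX ?f \<le> ennreal 1 * NX f"
    using block_average_mean_le[OF f(1) fin] by (intro NX.hardy_littlewood_polya avg dplus_mplus f(1)) auto
  then have Nf: "NX ?f \<le> NX f" by simp
  then have Nfin: "NX ?f < \<infinity>" using f(2) by (rule le_less_trans)
  have Sf: "NY (S_op ?f) \<le> ennreal C * NX ?f" by (rule S[OF avg Nfin])
  then have Sfin: "NY (S_op ?f) < \<infinity>" using Nfin by (auto simp: ennreal_mult_less_top intro: le_less_trans)
  have "2 * (\<integral>\<^sub>1v. ennreal (?q v) * ennreal (?f v)) = (\<integral>\<^sub>1s. ennreal (k s * S_op ?f s))"
    by (rule pairing_S_op[OF k avg, symmetric])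
  also have "\<dots> \<le> ennreal K * NY (S_op ?f)" by (rule dual[OF dplus_mplus[OF S_op_dplus[OF avg]] Sfin])
  also have "\<dots> \<le> ennreal K * (ennreal C * NX f)"
    by (intro mult_left_mono order_trans[OF Sf mult_left_mono[OF Nf]]) auto
  finally have 1: "2 * (\<integral>\<^sub>1v. ennreal (?q v) * ennreal (?f v)) \<le> ennreal K * (ennreal C * NX f)" .
  have "(\<integral>\<^sub>1v. ennreal (Sup_op k v) * ennreal (f v)) \<le> 12 * (\<integral>\<^sub>1v. ennreal (?q v) * ennreal (?f v))"
    by (rule Sup_op_pairing_le[OF k f(1) fin])
  also have "\<dots> = 6 * (2 * (\<integral>\<^sub>1v. ennreal (?q v) * ennreal (?f v)))"
    by (simp flip: mult.assoc)
  also have "\<dots> \<le> 6 * (ennreal K * (ennreal C * NX f))" by (intro mult_left_mono 1) auto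
  also have "\<dots> = ennreal (6 * K * C) * NX f" using K C by (simp add: ennreal_mult' mult.assoc)
  finally show ?thesis .
qed

text \<open>A decreasing functional \<open>k\<close> that witnessed a large norm of \<open>S_op f\<close> would be moved to \<open>f\<close> by the
  adjoint formula, and \<open>k / w\<close> is at most its decreasing majorant. The assumption is restricted to
  functions that equal their rearrangement, since these are the arguments to which \<open>T\<close> reduces; \<open>k\<close> is
  adjusted on a null set accordingly.\<close>

proposition Sup_bounded_imp_S_bounded:
  assumes NX: "ri_banach NX" and NY: "ri_banach NY" and C: "0 < C"
    and dual: "\<And>k g. k \<in> dplus \<Longrightarrow> rearr unit_measure k = k \<Longrightarrow>
      (\<And>g. g \<in> mplus \<Longrightarrow> (\<integral>\<^sub>1s. ennreal (k s * g s)) \<le> NY g) \<Longrightarrow> g \<in> mplus \<Longrightarrow> NX g < \<infinity> \<Longrightarrow>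
      (\<integral>\<^sub>1v. ennreal (Sup_op k v * g v)) \<le> ennreal C * NX g"
    and f: "f \<in> dplus" "NX f < \<infinity>"
  shows "NY (S_op f) \<le> ennreal (2 * C) * NX f"
proof (rule ccontr)
  interpret NY: ri_banach NY by fact
  assume "\<not> ?thesis"
  then have "ennreal (2 * C) * NX f < NY (S_op f)" by simp
  then obtain k0 where k0: "k0 \<in> dplus" "\<And>g. g \<in> mplus \<Longrightarrow> (\<integral>\<^sub>1t. ennreal (k0 t * g t)) \<le> NY g"
      "ennreal (2 * C) * NX f < (\<integral>\<^sub>1t. ennreal (k0 t * S_op f t))"
    by (rule NY.separation[OF S_op_dplus[OF f(1)]]) (assumption | blast intro: that)+
  define k where "k = rearr unit_measure k0"
  have k: "k \<in> dplus" "rearr unit_measure k = k"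
    unfolding k_def using unit.rearr_dplus[OF mplus_norm_measurable[OF dplus_mplus[OF k0(1)]]]
      unit.rearr_rearr[OF mplus_norm_measurable[OF dplus_mplus[OF k0(1)]]] by auto
  have kk0: "AE t in unit_measure. k t = k0 t" unfolding k_def by (rule rearr_dplus_AE[OF k0(1)])
  have pair: "(\<integral>\<^sub>1t. ennreal (k t * g t)) = (\<integral>\<^sub>1t. ennreal (k0 t * g t))" for g
    using kk0 by (intro nn_integral_cong_AE) (auto elim: eventually_mono)
  have "(\<integral>\<^sub>1t. ennreal (k t * S_op f t)) = 2 * (\<integral>\<^sub>1v. ennreal (k (tau v) / w (tau v)) * ennreal (f v))"
    by (rule pairing_S_op[OF k(1) f(1)])
  also have "\<dots> \<le> 2 * (\<integral>\<^sub>1v. ennreal (Sup_op k v * f v))"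
  proof (intro mult_left_mono nn_integral_mono)
    fix v assume "v \<in> space unit_measure"
    then have v: "0 < v" "v < 1" by auto
    have "k (tau v) / w (tau v) \<le> Sup_op k v" using Sup_op_maj(2)[OF k(1) v(1) order_refl v(2)] .
    then have "k (tau v) / w (tau v) * f v \<le> Sup_op k v * f v" using dplus_nonneg[OF f(1) v] by (rule mult_right_mono)
    then show "ennreal (k (tau v) / w (tau v)) * ennreal (f v) \<le> ennreal (Sup_op k v * f v)"
      using dplus_nonneg[OF f(1) v] by (simp add: ennreal_leI flip: ennreal_mult'')
  qed simp
  also have "\<dots> \<le> 2 * (ennreal C * NX f)"
    using k0(2) by (intro mult_left_mono dual k dplus_mplus f) (auto simp: pair)
  also have "\<dots> = ennreal (2 * C) * NX f" using C by (simp add: ennreal_mult' mult.assoc)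
  finally show False using k0(3) by (simp add: pair)
qed

end

section \<open>The four statements\<close>

lemma lattice_norm_cong:
  assumes "fn_lattice N" "f \<in> mplus" "g \<in> mplus" "AE t in unit_measure. f t = g t"
  shows "N f = N g"
proof (rule antisym)
  have "AE t in unit_measure. f t \<le> g t" "AE t in unit_measure. g t \<le> f t"
    using assms(4) by (auto elim: eventually_mono)
  then show "N f \<le> N g" "N g \<le> N f"
    using assms(1-3) unfolding fn_lattice_def by blast+
qed

lemma root_norm_powr:
  assumes "fn_lattice N" "0 < p" and f: "f \<in> mplus"
  shows "root_norm p N (\<lambda>t. f t powr p) = epowr (N f) p"
proof -
  note [measurable] = mplus_measurable[OF f]
  have "N (\<lambda>t. (f t powr p) powr (1 / p)) = N f"
  proof (rule lattice_norm_cong[OF assms(1) _ f])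
    show "(\<lambda>t. (f t powr p) powr (1 / p)) \<in> mplus" by (intro mplusI) auto
    show "AE t in unit_measure. (f t powr p) powr (1 / p) = f t"
      using mplus_nonneg[OF f] assms(2) by (intro AE_unitI) (simp add: powr_powr)
  qed
  then show ?thesis by (simp add: root_norm_def)
qed

lemma associate_norm_le_iff:
  "associate_norm N f \<le> c \<longleftrightarrow> (\<forall>g\<in>mplus. N g \<le> 1 \<longrightarrow> (\<integral>\<^sub>1t. ennreal (f t * g t)) \<le> c)"
  unfolding associate_norm_def by (auto simp: SUP_le_iff)

lemma associate_norm_cong:
  assumes "AE t in unit_measure. f t = g t"
  shows "associate_norm N f = associate_norm N g"
  unfolding associate_norm_def using assms
  by (intro SUP_cong refl nn_integral_cong_AE) (auto elim: eventually_mono)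

lemma (in ri_banach) associate_norm_hoelder:
  assumes k: "k \<in> dplus" and g: "g \<in> mplus" "N g < \<infinity>"
  shows "(\<integral>\<^sub>1t. ennreal (k t * g t)) \<le> associate_norm N k * N g"
proof (cases "N g = 0")
  case True
  then have "AE t in unit_measure. g t = 0" using norm_zero_iff[OF g(1)] by simp
  then have "(\<integral>\<^sub>1t. ennreal (k t * g t)) = (\<integral>\<^sub>1t. 0)"
    by (intro nn_integral_cong_AE) (auto elim: eventually_mono)
  then show ?thesis by simp
next
  case False
  then obtain b where b: "N g = ennreal b" "0 < b" using g(2) by (cases "N g") (auto simp: less_le)
  note [measurable] = mplus_measurable[OF g(1)] mplus_measurable[OF dplus_mplus[OF k]]
  have bb: "ennreal b * ennreal (1 / b) = 1" using b(2) by (simp flip: ennreal_mult')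
  have "N (\<lambda>t. 1 / b * g t) = ennreal (1 / b) * ennreal b" using norm_scale[OF g(1), of "1 / b"] b by simp
  then have "N (\<lambda>t. 1 / b * g t) \<le> 1" using bb by (simp add: mult.commute)
  moreover have "(\<lambda>t. 1 / b * g t) \<in> mplus" using mplus_nonneg[OF g(1)] b(2) by (intro mplusI) auto
  ultimately have "(\<integral>\<^sub>1t. ennreal (k t * (1 / b * g t))) \<le> associate_norm N k"
    using associate_norm_le_iff[of N k "associate_norm N k"] by blast
  moreover have "(\<integral>\<^sub>1t. ennreal (k t * (1 / b * g t))) = (\<integral>\<^sub>1t. ennreal (1 / b) * ennreal (k t * g t))"
    using b(2) by (intro nn_integral_cong) (simp add: mult_ac flip: ennreal_mult')
  ultimately have "ennreal (1 / b) * (\<integral>\<^sub>1t. ennreal (k t * g t)) \<le> associate_norm N k"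
    by (simp add: nn_integral_cmult)
  then have "ennreal b * (ennreal (1 / b) * (\<integral>\<^sub>1t. ennreal (k t * g t))) \<le> ennreal b * associate_norm N k"
    by (intro mult_left_mono) auto
  then show ?thesis unfolding mult.assoc[symmetric] bb b(1) by (simp add: mult.commute)
qed

context gauss_weights
begin

abbreviation S_bounded :: "((real \<Rightarrow> real) \<Rightarrow> ennreal) \<Rightarrow> ((real \<Rightarrow> real) \<Rightarrow> ennreal) \<Rightarrow> bool" where
  "S_bounded NX NY \<equiv> \<exists>C>0. \<forall>f\<in>dplus. NX f < \<infinity> \<longrightarrow> NY (S_op f) \<le> ennreal C * NX f"

abbreviation Sup_bounded :: "((real \<Rightarrow> real) \<Rightarrow> ennreal) \<Rightarrow> ((real \<Rightarrow> real) \<Rightarrow> ennreal) \<Rightarrow> bool" where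
  "Sup_bounded Y' X' \<equiv> \<exists>C>0. \<forall>k\<in>dplus. rearr unit_measure k = k \<longrightarrow> Y' k < \<infinity> \<longrightarrow> X' (Sup_op k) \<le> ennreal C * Y' k"

lemma rearr_U_op:
  assumes f: "f \<in> borel_measurable unit_measure"
  shows "rearr unit_measure (U_op b1 b2 p f) =
    rearr unit_measure (\<lambda>t. rearr unit_measure f (Phi t) * ell t powr \<beta>)"
proof (rule rearr_cong_distr)
  fix s :: real
  have "U_op b1 b2 p f t = complex_of_real (rearr unit_measure f (Phi t) * ell t powr \<beta>)" if "0 < t" "t < 1" for t
    unfolding U_op_def quotient_b2 by (simp only: sigma_inv_Phi[OF that])
  then have "norm (U_op b1 b2 p f t) = norm (rearr unit_measure f (Phi t) * ell t powr \<beta>)" if "0 < t" "t < 1" for t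
    using that by (simp only: norm_of_real real_norm_def)
  then have "{t\<in>space unit_measure. s < norm (U_op b1 b2 p f t)} =
      {t\<in>space unit_measure. s < norm (rearr unit_measure f (Phi t) * ell t powr \<beta>)}"
    by (intro Collect_cong conj_cong refl) simp
  then show "emeasure unit_measure {t\<in>space unit_measure. s < norm (U_op b1 b2 p f t)} =
      emeasure unit_measure {t\<in>space unit_measure. s < norm (rearr unit_measure f (Phi t) * ell t powr \<beta>)}"
    by simp
qed

lemma rearr_T_op:
  "rearr unit_measure (T_op b1 b2 p f) = rearr unit_measure (Sup_op (rearr unit_measure f))"
proof (rule rearr_cong_distr)
  fix s :: real
  have "T_op b1 b2 p f t = complex_of_real (Sup_op (rearr unit_measure f) t)" if "0 < t" "t < 1" for t
    unfolding T_op_def Sup_op_def using that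
    by (intro arg_cong[of _ _ complex_of_real] SUP_cong refl) (simp add: sigma_tau b1_powr)
  then have "{t\<in>space unit_measure. s < norm (T_op b1 b2 p f t)} =
      {t\<in>space unit_measure. s < norm (Sup_op (rearr unit_measure f) t)}"
    by auto
  then show "emeasure unit_measure {t\<in>space unit_measure. s < norm (T_op b1 b2 p f t)} =
      emeasure unit_measure {t\<in>space unit_measure. s < norm (Sup_op (rearr unit_measure f) t)}"
    by simp
qed

lemma rearr_of_real: "rearr M (\<lambda>x. complex_of_real (f x)) = rearr M f"
  by (rule rearr_cong_distr) simp

context
  fixes X Y :: "(real \<Rightarrow> real) \<Rightarrow> ennreal"
  assumes X: "fn_lattice X" and Y: "fn_lattice Y"
    and NX: "ri_banach (root_norm p X)" and NY: "ri_banach (root_norm p Y)"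
begin

lemma norm_rearr_decreasing: "fn_lattice N \<Longrightarrow> d \<in> dplus \<Longrightarrow> N (rearr unit_measure d) = N d"
  by (intro lattice_norm_cong dplus_mplus unit.rearr_dplus rearr_dplus_AE mplus_norm_measurable)

lemma norm_U_powr:
  assumes r: "r \<in> dplus"
  shows "epowr (Y (rearr unit_measure (\<lambda>t. r (Phi t) * ell t powr \<beta>))) p = root_norm p Y (S_op (\<lambda>t. r t powr p))"
proof -
  interpret NY: ri_banach "root_norm p Y" by (rule NY)
  have d: "(\<lambda>t. r (Phi t) * ell t powr \<beta>) \<in> dplus" using r exponents by (intro dplus_compose_Phi) auto
  have "epowr (Y (rearr unit_measure (\<lambda>t. r (Phi t) * ell t powr \<beta>))) p = root_norm p Y (\<lambda>t. (r (Phi t) * ell t powr \<beta>) powr p)"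
    using norm_rearr_decreasing[OF Y d] root_norm_powr[OF Y p dplus_mplus[OF d]] by simp
  also have "\<dots> = root_norm p Y (S_op (\<lambda>t. r t powr p))"
    using p r d by (intro NY.norm_cong dplus_mplus S_op_dplus dplus_powr AE_unitI) (simp_all add: S_op_def powr_compose_Phi)
  finally show ?thesis .
qed

text \<open>Both sides speak about \<open>p\<close>-th powers of decreasing functions. A decreasing function agrees with its
  rearrangement only almost everywhere, and this survives \<open>S_op\<close> because \<open>Phi\<close> respects null sets.\<close>

lemma U_bounded_iff:
  "bounded_operator (fspace unit_measure (ri_norm X unit_measure)) (ri_norm X unit_measure) (ri_norm Y unit_measure) (U_op b1 b2 p)
    \<longleftrightarrow> S_bounded (root_norm p X) (root_norm p Y)"
proof
  interpret NX: ri_banach "root_norm p X" by (rule NX)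
  interpret NY: ri_banach "root_norm p Y" by (rule NY)
  assume "bounded_operator (fspace unit_measure (ri_norm X unit_measure)) (ri_norm X unit_measure) (ri_norm Y unit_measure) (U_op b1 b2 p)"
  then obtain C where C: "0 < C" and bd: "\<And>f. f \<in> fspace unit_measure (ri_norm X unit_measure) \<Longrightarrow>
      ri_norm Y unit_measure (U_op b1 b2 p f) \<le> ennreal C * ri_norm X unit_measure f"
    by (auto simp: bounded_operator_def)
  have "root_norm p Y (S_op f) \<le> ennreal (C powr p) * root_norm p X f" if f: "f \<in> dplus" and fin: "root_norm p X f < \<infinity>" for f
  proof -
    define h where "h t = f t powr (1 / p)" for t
    have h: "h \<in> dplus" unfolding h_def using f p by (intro dplus_powr) auto
    define r where "r = rearr unit_measure h"
    have r: "r \<in> dplus" unfolding r_def by (intro unit.rearr_dplus mplus_norm_measurable dplus_mplus h)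
    have rh: "AE t in unit_measure. r t = h t" unfolding r_def by (rule rearr_dplus_AE[OF h])
    define F where "F t = complex_of_real (h t)" for t
    have rF: "rearr unit_measure F = r" unfolding F_def[abs_def] r_def by (rule rearr_of_real)
    have [measurable]: "h \<in> borel_measurable unit_measure" by (rule mplus_measurable[OF dplus_mplus[OF h]])
    have Fm: "F \<in> borel_measurable unit_measure" unfolding F_def[abs_def] by measurable
    have hp: "h t powr p = f t" if "0 < t" "t < 1" for t
      using dplus_nonneg[OF f that] p by (simp add: h_def powr_powr)
    have Nr: "epowr (X r) p = root_norm p X f"
    proof -
      have "epowr (X r) p = root_norm p X (\<lambda>t. r t powr p)"
        by (rule root_norm_powr[OF X p dplus_mplus[OF r], symmetric])
      also have "\<dots> = root_norm p X f"
      proof (rule NX.norm_cong[OF dplus_mplus[OF dplus_powr[OF r p]] dplus_mplus[OF f]])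
        show "AE t in unit_measure. r t powr p = f t"
          using rh by (rule AE_mp, intro AE_unitI) (simp add: hp)
      qed
      finally show ?thesis .
    qed
    have "X r < \<infinity>" using fin unfolding Nr[symmetric] by simp
    then have "F \<in> fspace unit_measure (ri_norm X unit_measure)" using Fm by (simp add: fspace_def ri_norm_def rF)
    from bd[OF this] have "Y (rearr unit_measure (\<lambda>t. r (Phi t) * ell t powr \<beta>)) \<le> ennreal C * X r"
      by (simp add: ri_norm_def rearr_U_op[OF Fm] rF)
    then have "epowr (Y (rearr unit_measure (\<lambda>t. r (Phi t) * ell t powr \<beta>))) p \<le> epowr (ennreal C * X r) p"
      using p by (intro epowr_mono) auto
    then have "root_norm p Y (S_op (\<lambda>t. r t powr p)) \<le> ennreal (C powr p) * root_norm p X f"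
      using p C by (simp add: norm_U_powr[OF r] epowr_mult Nr)
    moreover have "root_norm p Y (S_op (\<lambda>t. r t powr p)) = root_norm p Y (S_op f)"
    proof (rule NY.norm_cong[OF dplus_mplus[OF S_op_dplus[OF dplus_powr[OF r p]]] dplus_mplus[OF S_op_dplus[OF f]]])
      have "{u\<in>space (restrict_space borel {0<..<1}). r u \<noteq> h u} \<in> sets (restrict_space borel {0<..<1})"
        using dplus_borel[OF r] dplus_borel[OF h] by measurable
      then have "{u\<in>{0<..<1}. \<not> r u = h u} \<in> sets borel"
        by (subst (asm) sets_restrict_space_iff) (auto simp: space_restrict_space)
      from AE_Phi[OF this rh] show "AE t in unit_measure. S_op (\<lambda>t. r t powr p) t = S_op f t"
      proof (rule AE_mp, intro AE_unitI impI)
        fix t :: real assume t: "0 < t" "t < 1" and "r (Phi t) = h (Phi t)"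
        then show "S_op (\<lambda>t. r t powr p) t = S_op f t" using hp[of "Phi t"] Phi_range[OF t] by (simp add: S_op_def)
      qed
    qed
    ultimately show ?thesis by simp
  qed
  then show "S_bounded (root_norm p X) (root_norm p Y)" using C by (intro exI[of _ "C powr p"]) auto
next
  assume "S_bounded (root_norm p X) (root_norm p Y)"
  then obtain C where C: "0 < C" and bd: "\<And>f. f \<in> dplus \<Longrightarrow> root_norm p X f < \<infinity> \<Longrightarrow>
      root_norm p Y (S_op f) \<le> ennreal C * root_norm p X f" by blast
  have "ri_norm Y unit_measure (U_op b1 b2 p f) \<le> ennreal (C powr (1 / p)) * ri_norm X unit_measure f"
    if "f \<in> fspace unit_measure (ri_norm X unit_measure)" for f
  proof -
    have fm[measurable]: "f \<in> borel_measurable unit_measure" and fin: "X (rearr unit_measure f) < \<infinity>"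
      using that by (auto simp: fspace_def ri_norm_def)
    let ?r = "rearr unit_measure f"
    have r: "?r \<in> dplus" by (rule unit.rearr_dplus) measurable
    have Nr: "root_norm p X (\<lambda>t. ?r t powr p) = epowr (X ?r) p" by (rule root_norm_powr[OF X p dplus_mplus[OF r]])
    have "root_norm p Y (S_op (\<lambda>t. ?r t powr p)) \<le> ennreal C * root_norm p X (\<lambda>t. ?r t powr p)"
      using fin by (intro bd dplus_powr r p) (simp add: Nr)
    then have "epowr (Y (rearr unit_measure (\<lambda>t. ?r (Phi t) * ell t powr \<beta>))) p \<le> ennreal C * epowr (X ?r) p"
      by (simp only: norm_U_powr[OF r] Nr)
    then show ?thesis
      using C by (simp add: ri_norm_def rearr_U_op[OF fm] epowr_le_multI[OF p])
  qed
  then show "bounded_operator (fspace unit_measure (ri_norm X unit_measure)) (ri_norm X unit_measure) (ri_norm Y unit_measure) (U_op b1 b2 p)"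
    using C unfolding bounded_operator_def by (intro exI[of _ "C powr (1 / p)"]) auto
qed

lemma T_bounded_iff:
  fixes X' Y' :: "(real \<Rightarrow> real) \<Rightarrow> ennreal"
  assumes X': "X' = associate_norm (root_norm p X)"
  shows "bounded_operator (fspace unit_measure (ri_norm Y' unit_measure)) (ri_norm Y' unit_measure) (ri_norm X' unit_measure) (T_op b1 b2 p)
    \<longleftrightarrow> Sup_bounded Y' X'"
proof -
  have T: "ri_norm X' unit_measure (T_op b1 b2 p f) = X' (Sup_op (rearr unit_measure f))"
    if "rearr unit_measure f \<in> dplus" for f :: "real \<Rightarrow> complex"
    unfolding ri_norm_def rearr_T_op X' by (rule associate_norm_cong[OF rearr_dplus_AE[OF Sup_op_dplus[OF that]]])
  show ?thesis
  proof
    assume "bounded_operator (fspace unit_measure (ri_norm Y' unit_measure)) (ri_norm Y' unit_measure) (ri_norm X' unit_measure) (T_op b1 b2 p)"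
    then obtain C where C: "0 < C" and bd: "\<And>f. f \<in> fspace unit_measure (ri_norm Y' unit_measure) \<Longrightarrow>
        ri_norm X' unit_measure (T_op b1 b2 p f) \<le> ennreal C * ri_norm Y' unit_measure f"
      by (auto simp: bounded_operator_def)
    have "X' (Sup_op k) \<le> ennreal C * Y' k" if k: "k \<in> dplus" "rearr unit_measure k = k" "Y' k < \<infinity>" for k
    proof -
      let ?f = "\<lambda>t. complex_of_real (k t)"
      have rf: "rearr unit_measure ?f = k" by (simp add: rearr_of_real k(2))
      have "k \<in> borel_measurable unit_measure" by (rule mplus_measurable[OF dplus_mplus[OF k(1)]])
      then have "?f \<in> fspace unit_measure (ri_norm Y' unit_measure)" using k(3) by (simp add: fspace_def ri_norm_def rf)
      from bd[OF this] show ?thesis using k(1) by (simp add: T rf ri_norm_def[of Y'])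
    qed
    then show "Sup_bounded Y' X'" using C by blast
  next
    assume "Sup_bounded Y' X'"
    then obtain C where C: "0 < C" and bd: "\<And>k. k \<in> dplus \<Longrightarrow> rearr unit_measure k = k \<Longrightarrow> Y' k < \<infinity> \<Longrightarrow>
        X' (Sup_op k) \<le> ennreal C * Y' k" by blast
    have "ri_norm X' unit_measure (T_op b1 b2 p f) \<le> ennreal C * ri_norm Y' unit_measure f"
      if "f \<in> fspace unit_measure (ri_norm Y' unit_measure)" for f
    proof -
      have [measurable]: "f \<in> borel_measurable unit_measure" and fin: "Y' (rearr unit_measure f) < \<infinity>"
        using that by (auto simp: fspace_def ri_norm_def)
      have m: "(\<lambda>t. norm (f t)) \<in> borel_measurable unit_measure" by measurable
      have "rearr unit_measure f \<in> dplus" by (rule unit.rearr_dplus[OF m])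
      then show ?thesis using bd[OF _ unit.rearr_rearr[OF m] fin] by (simp add: T ri_norm_def[of Y'])
    qed
    then show "bounded_operator (fspace unit_measure (ri_norm Y' unit_measure)) (ri_norm Y' unit_measure) (ri_norm X' unit_measure) (T_op b1 b2 p)"
      using C unfolding bounded_operator_def by blast
  qed
qed

text \<open>For the direction from left to right the associate norm of \<open>Sup_op k\<close> has to be tested on all
  functions; as \<open>Sup_op k\<close> is decreasing, the Hardy--Littlewood inequality reduces this to decreasing
  test functions.\<close>

lemma S_bounded_iff_Sup_bounded:
  "S_bounded (root_norm p X) (root_norm p Y) \<longleftrightarrow>
    Sup_bounded (associate_norm (root_norm p Y)) (associate_norm (root_norm p X))"
proof
  interpret NX: ri_banach "root_norm p X" by (rule NX)
  interpret NY: ri_banach "root_norm p Y" by (rule NY)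
  assume "S_bounded (root_norm p X) (root_norm p Y)"
  then obtain C where C: "0 < C" and bd: "\<And>f. f \<in> dplus \<Longrightarrow> root_norm p X f < \<infinity> \<Longrightarrow>
      root_norm p Y (S_op f) \<le> ennreal C * root_norm p X f" by blast
  have "associate_norm (root_norm p X) (Sup_op k) \<le> ennreal (6 * C) * associate_norm (root_norm p Y) k"
    if k: "k \<in> dplus" and fin: "associate_norm (root_norm p Y) k < \<infinity>" for k
    unfolding associate_norm_le_iff
  proof (intro ballI impI)
    obtain K where K: "associate_norm (root_norm p Y) k = ennreal K" "0 \<le> K"
      using fin by (cases "associate_norm (root_norm p Y) k") auto
    fix g assume g: "g \<in> mplus" "root_norm p X g \<le> 1"
    have g': "rearr unit_measure g \<in> dplus" by (rule unit.rearr_dplus[OF mplus_norm_measurable[OF g(1)]])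
    have Ng: "root_norm p X (rearr unit_measure g) = root_norm p X g" by (rule NX.norm_rearr[OF g(1)])
    have "(\<integral>\<^sub>1t. ennreal (Sup_op k t * g t)) \<le> (\<integral>\<^sub>1t. ennreal (Sup_op k t * rearr unit_measure g t))"
      by (rule hardy_littlewood_decreasing[OF g(1) Sup_op_dplus[OF k]])
    also have "\<dots> = (\<integral>\<^sub>1t. ennreal (Sup_op k t) * ennreal (rearr unit_measure g t))"
      using dplus_nonneg[OF Sup_op_dplus[OF k]] by (intro nn_integral_cong) (auto simp: ennreal_mult')
    also have "\<dots> \<le> ennreal (6 * K * C) * root_norm p X (rearr unit_measure g)"
    proof (rule S_bounded_imp_Sup_dual[OF NX NY C K(2) bd k _ g'])
      show "(\<integral>\<^sub>1s. ennreal (k s * g s)) \<le> ennreal K * root_norm p Y g"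
        if "g \<in> mplus" "root_norm p Y g < \<infinity>" for g
        using NY.associate_norm_hoelder[OF k that] by (simp only: K(1))
      show "root_norm p X (rearr unit_measure g) < \<infinity>" using g(2) unfolding Ng by (auto intro: le_less_trans)
    qed
    also have "\<dots> \<le> ennreal (6 * K * C) * 1" unfolding Ng by (intro mult_left_mono g(2)) auto
    also have "\<dots> = ennreal (6 * C) * associate_norm (root_norm p Y) k"
      using K C by (simp add: ennreal_mult' mult_ac flip: ennreal_mult')
    finally show "(\<integral>\<^sub>1t. ennreal (Sup_op k t * g t)) \<le> ennreal (6 * C) * associate_norm (root_norm p Y) k" .
  qed
  then show "Sup_bounded (associate_norm (root_norm p Y)) (associate_norm (root_norm p X))"
    using C by (intro exI[of _ "6 * C"]) auto
next
  interpret NX: ri_banach "root_norm p X" by (rule NX)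
  assume "Sup_bounded (associate_norm (root_norm p Y)) (associate_norm (root_norm p X))"
  then obtain C where C: "0 < C" and bd: "\<And>k. k \<in> dplus \<Longrightarrow> rearr unit_measure k = k \<Longrightarrow>
      associate_norm (root_norm p Y) k < \<infinity> \<Longrightarrow>
      associate_norm (root_norm p X) (Sup_op k) \<le> ennreal C * associate_norm (root_norm p Y) k" by blast
  have "root_norm p Y (S_op f) \<le> ennreal (2 * C) * root_norm p X f" if f: "f \<in> dplus" "root_norm p X f < \<infinity>" for f
  proof (rule Sup_bounded_imp_S_bounded[where NX="root_norm p X" and C=C])
    fix k g assume k: "k \<in> dplus" "rearr unit_measure k = k"
      and dual: "\<And>g. g \<in> mplus \<Longrightarrow> (\<integral>\<^sub>1s. ennreal (k s * g s)) \<le> root_norm p Y g"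
      and g: "g \<in> mplus" "root_norm p X g < \<infinity>"
    have k1: "associate_norm (root_norm p Y) k \<le> 1"
      unfolding associate_norm_le_iff using dual by (auto intro: order_trans)
    then have kfin: "associate_norm (root_norm p Y) k < \<infinity>" by (auto intro: le_less_trans)
    have "(\<integral>\<^sub>1v. ennreal (Sup_op k v * g v)) \<le> associate_norm (root_norm p X) (Sup_op k) * root_norm p X g"
      by (rule NX.associate_norm_hoelder[OF Sup_op_dplus[OF k(1)] g])
    also have "\<dots> \<le> (ennreal C * 1) * root_norm p X g"
      by (intro mult_right_mono order_trans[OF bd[OF k kfin]] mult_left_mono k1) auto
    finally show "(\<integral>\<^sub>1v. ennreal (Sup_op k v * g v)) \<le> ennreal C * root_norm p X g" by simp
  qed (rule NX NY C f)+
  then show "S_bounded (root_norm p X) (root_norm p Y)" using C by (intro exI[of _ "2 * C"]) auto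
qed

text \<open>The norm of \<open>X\<close> controls that of \<open>L\<^sup>p\<close>, so \<open>T\<close> is defined on all of \<open>X\<close>; after passing to \<open>p\<close>-th powers,
  gaussibility is a domination in the weighted mean.\<close>

lemma S_bounded_imp_gaussible_bounded:
  fixes M :: "'a measure" and M' :: "'b measure"
  assumes M: "prob_space M" and M': "prob_space M'"
    and S: "S_bounded (root_norm p X) (root_norm p Y)" and T: "gaussible p b1 b2 M M' T"
  shows "bounded_operator (fspace M (ri_norm X M)) (ri_norm X M) (ri_norm Y M') T"
proof -
  interpret M: prob_space M by fact
  interpret M': prob_space M' by fact
  interpret NX: ri_banach "root_norm p X" by (rule NX)
  obtain C where C: "0 < C" and bd: "\<And>f. f \<in> dplus \<Longrightarrow> root_norm p X f < \<infinity> \<Longrightarrow>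
      root_norm p Y (S_op f) \<le> ennreal C * root_norm p X f" using S by blast
  have op: "is_operator M (Lp M) M' T"
    using T unfolding gaussible_iff[OF M] by blast
  obtain D where D: "0 < D" and dom: "\<And>f t. f \<in> Lp M \<Longrightarrow> t \<in> {0<..<1} \<Longrightarrow>
      (\<integral>\<^sub>1s. ennreal ((rearr M' (T f) s * b1 s) powr p) * indicator {0<..<t} s) \<le>
      ennreal D * (\<integral>\<^sub>1s. ennreal (rearr M f s powr p) * indicator {0<..<Phi t} s)"
    using T unfolding gaussible_iff[OF M] by blast
  let ?E = "(C * (3 * D)) powr (1 / p)"
  have "ri_norm Y M' (T f) \<le> ennreal ?E * ri_norm X M f" if f: "f \<in> fspace M (ri_norm X M)" for f
  proof -
    have fm[measurable]: "f \<in> borel_measurable M" and fin: "X (rearr M f) < \<infinity>" using f by (auto simp: fspace_def ri_norm_def)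
    have r: "rearr M f \<in> dplus" by (rule M.rearr_dplus) measurable
    have Nr: "root_norm p X (\<lambda>t. rearr M f t powr p) = epowr (X (rearr M f)) p" by (rule root_norm_powr[OF X p dplus_mplus[OF r]])
    note rp = dplus_powr[OF r p]
    obtain c where c: "0 < c" "(\<integral>\<^sub>1s. ennreal (rearr M f s powr p)) \<le> ennreal c * root_norm p X (\<lambda>t. rearr M f t powr p)"
      using NX.norm_L1[of thesis] dplus_mplus[OF rp] by blast
    have "ennreal c * epowr (X (rearr M f)) p < \<infinity>" using fin by (simp add: ennreal_mult_less_top)
    then have "(\<integral>\<^sub>1s. ennreal (rearr M f s powr p)) < \<infinity>" using c(2) unfolding Nr by (rule le_less_trans[rotated])
    then have fLp: "f \<in> Lp M"
      using fm by (simp add: fspace_def Lq_norm_real[OF p] M.nn_integral_powr_rearr)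
    then have Tm: "T f \<in> borel_measurable M'" using op by (simp add: is_operator_def)
    have Tr: "rearr M' (T f) \<in> dplus" by (rule M'.rearr_dplus) (rule measurable_compose[OF Tm borel_measurable_norm])
    have "root_norm p Y (\<lambda>t. rearr M' (T f) t powr p) \<le> ennreal (C * (3 * D)) * root_norm p X (\<lambda>t. rearr M f t powr p)"
    proof (rule S_bounded_imp_dominated[OF NX NY C D bd dplus_powr[OF Tr p] rp])
      fix t :: real assume t: "0 < t" "t < 1"
      then show "(\<integral>\<^sub>1s. ennreal (rearr M' (T f) s powr p * w s) * indicator {0<..<t} s) \<le>
          ennreal D * (\<integral>\<^sub>1s. ennreal (rearr M f s powr p) * indicator {0<..<Phi t} s)"
        using dom[OF fLp, of t] by (simp add: powr_mult b1_powr)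
    qed
    then have "epowr (Y (rearr M' (T f))) p \<le> ennreal (C * (3 * D)) * epowr (X (rearr M f)) p"
      unfolding Nr root_norm_powr[OF Y p dplus_mplus[OF Tr]] .
    then show ?thesis unfolding ri_norm_def using C D by (intro epowr_le_multI[OF p]) auto
  qed
  then show ?thesis using C D unfolding bounded_operator_def by (intro exI[of _ ?E]) auto
qed

text \<open>A uniform variable on the target space copies \<open>U\<close> to an operator between the given spaces, to
  which the hypothesis applies; one on the source space realizes every rearrangement as a function
  there, so that the bound for the copy gives back the bound for \<open>U\<close>.\<close>

lemma K_bounded_imp_U_bounded:
  fixes M :: "'a measure" and M' :: "'b measure"
  assumes M: "nonatomic_prob M" and M': "nonatomic_prob M'"
    and ii: "\<And>T. is_operator M (Lp M) M' T \<Longrightarrow>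
      (\<exists>C>0. \<forall>f\<in>Lp M. \<forall>t\<in>{0<..<1}.
        K_weighted M' (T f) t
        \<le> ennreal C * K_unweighted M f t) \<Longrightarrow>
      bounded_operator (fspace M (ri_norm X M)) (ri_norm X M) (ri_norm Y M') T"
  shows "bounded_operator (fspace unit_measure (ri_norm X unit_measure)) (ri_norm X unit_measure) (ri_norm Y unit_measure) (U_op b1 b2 p)"
proof -
  interpret M: nonatomic_prob M by fact
  interpret M': nonatomic_prob M' by fact
  obtain V where V: "V \<in> borel_measurable M" "\<And>x. 0 < V x \<and> V x < 1"
    "\<And>A. A \<in> sets borel \<Longrightarrow> emeasure M {x\<in>space M. V x \<in> A} = emeasure unit_measure {t\<in>space unit_measure. t \<in> A}"
    by (rule M.uniform_variable) (assumption | blast intro: that)+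
  obtain V' where V': "V' \<in> borel_measurable M'" "\<And>x. 0 < V' x \<and> V' x < 1"
    "\<And>A. A \<in> sets borel \<Longrightarrow> emeasure M' {x\<in>space M'. V' x \<in> A} = emeasure unit_measure {t\<in>space unit_measure. t \<in> A}"
    by (rule M'.uniform_variable) (assumption | blast intro: that)+
  define T where "T f = (\<lambda>x. complex_of_real (rearr M f (Phi (V' x)) * ell (V' x) powr \<beta>))" for f :: "'a \<Rightarrow> complex"
  have d: "(\<lambda>t. rearr M f (Phi t) * ell t powr \<beta>) \<in> dplus" if [measurable]: "f \<in> borel_measurable M" for f :: "'a \<Rightarrow> complex"
  proof -
    have "rearr M f \<in> dplus" by (rule M.rearr_dplus) measurable
    then show ?thesis using exponents by (intro dplus_compose_Phi) auto
  qed
  have "is_operator M (Lp M) M' T"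
    unfolding is_operator_def
  proof (intro conjI ballI impI)
    fix f assume "f \<in> Lp M"
    then have f: "f \<in> borel_measurable M" by (simp add: fspace_def)
    then show "T f \<in> borel_measurable M'" unfolding T_def using M'.rearr_uniform(1)[OF V' d[OF f]] by simp
    fix g assume "g \<in> Lp M" and eq: "AE x in M. f x = g x"
    then have g: "g \<in> borel_measurable M" by (simp add: fspace_def)
    have "rearr M f = rearr M g"
      using eq by (intro rearr_cong_AE measurable_compose[OF f borel_measurable_norm] measurable_compose[OF g borel_measurable_norm]) (auto elim: eventually_mono)
    then show "AE y in M'. T f y = T g y" by (simp add: T_def)
  qed
  moreover have "\<forall>f\<in>Lp M. \<forall>t\<in>{0<..<1}.
      K_weighted M' (T f) t
      \<le> ennreal (2 powr (1 / p)) * K_unweighted M f t"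
    unfolding T_def using transplanted_operator_K_bounded[OF M.prob_space_axioms M' V'] by (auto simp: fspace_def)
  ultimately have "bounded_operator (fspace M (ri_norm X M)) (ri_norm X M) (ri_norm Y M') T"
    by (intro ii exI[of _ "2 powr (1 / p)"]) auto
  then obtain C where C: "0 < C" and bd: "\<And>f. f \<in> fspace M (ri_norm X M) \<Longrightarrow> ri_norm Y M' (T f) \<le> ennreal C * ri_norm X M f"
    by (auto simp: bounded_operator_def)
  have "ri_norm Y unit_measure (U_op b1 b2 p f) \<le> ennreal C * ri_norm X unit_measure f"
    if "f \<in> fspace unit_measure (ri_norm X unit_measure)" for f
  proof -
    have fm[measurable]: "f \<in> borel_measurable unit_measure" and fin: "X (rearr unit_measure f) < \<infinity>"
      using that by (auto simp: fspace_def ri_norm_def)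
    have m: "(\<lambda>t. norm (f t)) \<in> borel_measurable unit_measure" by measurable
    have r: "rearr unit_measure f \<in> dplus" by (rule unit.rearr_dplus[OF m])
    let ?F = "\<lambda>x. complex_of_real (rearr unit_measure f (V x))"
    have Fm: "?F \<in> borel_measurable M" and rF: "rearr M ?F = rearr unit_measure f"
      using M.rearr_uniform[OF V r] unit.rearr_rearr[OF m] by auto
    have "?F \<in> fspace M (ri_norm X M)" using Fm fin by (simp add: fspace_def ri_norm_def rF)
    from bd[OF this] have "Y (rearr M' (T ?F)) \<le> ennreal C * X (rearr unit_measure f)" by (simp add: ri_norm_def rF)
    moreover have "rearr M' (T ?F) = rearr unit_measure (U_op b1 b2 p f)"
      using M'.rearr_uniform(2)[OF V' d[OF Fm]] unfolding T_def rF rearr_U_op[OF fm] .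
    ultimately show ?thesis by (simp add: ri_norm_def)
  qed
  then show ?thesis using C unfolding bounded_operator_def by blast
qed

end

end

theorem theorem3p13:
  fixes M :: "'a measure" and M' :: "'b measure"
    and p \<alpha> \<beta> :: real
    and b1 b2 :: "real \<Rightarrow> real"
    and X Y :: "(real \<Rightarrow> real) \<Rightarrow> ennreal"
  assumes "prob_space M" and "nonatomic M"
    and "prob_space M'" and "nonatomic M'"
    and "0 < p" and "0 \<le> \<alpha>" and "\<alpha> < 1 / p"
    and "\<beta> = 1 / p - \<alpha>"
    and "b1 = (\<lambda>t. ell t powr \<alpha>)"
    and "b2 = (\<lambda>t. ell t powr (- \<beta>))"
    and "ri_quasi_banach_function_norm X" and "p_convex p X"
    and "ri_quasi_banach_function_norm Y" and "p_convex p Y"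
  shows
    "let Lp = fspace M (Lq_norm (ennreal p) M);
         bounded_XY = bounded_operator (fspace M (ri_norm X M)) (ri_norm X M) (ri_norm Y M');
         X' = associate_norm (root_norm p X);
         Y' = associate_norm (root_norm p Y);
         i = (\<forall>T. gaussible p b1 b2 M M' T \<longrightarrow> bounded_XY T);
         ii = (\<forall>T. is_operator M Lp M' T \<and>
                 (\<exists>C>0. \<forall>f\<in>Lp. \<forall>t\<in>{0<..<1}.
                    K_functional M' (weighted_norm (ennreal p) b1 M') (weighted_norm \<infinity> b2 M') (T f) t
                    \<le> ennreal C * K_functional M (Lq_norm (ennreal p) M) (Lq_norm \<infinity> M) f t)
                 \<longrightarrow> bounded_XY T);
         iii = bounded_operator (fspace unit_measure (ri_norm X unit_measure))
                 (ri_norm X unit_measure) (ri_norm Y unit_measure) (U_op b1 b2 p);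
         iv = bounded_operator (fspace unit_measure (ri_norm Y' unit_measure))
                 (ri_norm Y' unit_measure) (ri_norm X' unit_measure) (T_op b1 b2 p)
     in (i \<longleftrightarrow> ii) \<and> (ii \<longleftrightarrow> iii) \<and> (iii \<longleftrightarrow> iv)"
proof -
  interpret gauss_weights p \<alpha> \<beta> b1 b2
    using assms(5-10) by unfold_locales
  have M: "nonatomic_prob M" and M': "nonatomic_prob M'"
    using assms(1-4) by (auto simp: nonatomic_prob_def nonatomic_prob_axioms_def)
  have X: "fn_lattice X" and Y: "fn_lattice Y"
    using assms(11,13) by (auto simp: ri_quasi_banach_function_norm_def)
  have NX: "ri_banach (root_norm p X)" and NY: "ri_banach (root_norm p Y)"
    using assms(12,14) by (auto simp: p_convex_def ri_banach_def)
  define i where "i \<longleftrightarrow> (\<forall>T. gaussible p b1 b2 M M' T \<longrightarrow> bounded_operator (fspace M (ri_norm X M)) (ri_norm X M) (ri_norm Y M') T)"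
  define ii where "ii \<longleftrightarrow> (\<forall>T. is_operator M (fspace M (Lq_norm (ennreal p) M)) M' T \<and>
      (\<exists>C>0. \<forall>f\<in>fspace M (Lq_norm (ennreal p) M). \<forall>t\<in>{0<..<1}.
        K_functional M' (weighted_norm (ennreal p) b1 M') (weighted_norm \<infinity> b2 M') (T f) t
        \<le> ennreal C * K_functional M (Lq_norm (ennreal p) M) (Lq_norm \<infinity> M) f t)
      \<longrightarrow> bounded_operator (fspace M (ri_norm X M)) (ri_norm X M) (ri_norm Y M') T)"
  have "i \<Longrightarrow> ii"
  proof -
    assume i
    show ii unfolding ii_def
    proof (intro allI impI)
      fix T assume T: "is_operator M (fspace M (Lq_norm (ennreal p) M)) M' T \<and>
        (\<exists>C>0. \<forall>f\<in>fspace M (Lq_norm (ennreal p) M). \<forall>t\<in>{0<..<1}.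
          K_functional M' (weighted_norm (ennreal p) b1 M') (weighted_norm \<infinity> b2 M') (T f) t
          \<le> ennreal C * K_functional M (Lq_norm (ennreal p) M) (Lq_norm \<infinity> M) f t)"
      then obtain C where "0 < C" and K: "\<forall>f\<in>fspace M (Lq_norm (ennreal p) M). \<forall>t\<in>{0<..<1}.
          K_functional M' (weighted_norm (ennreal p) b1 M') (weighted_norm \<infinity> b2 M') (T f) t
          \<le> ennreal C * K_functional M (Lq_norm (ennreal p) M) (Lq_norm \<infinity> M) f t" by blast
      have "gaussible p b1 b2 M M' T"
        using T K by (intro K_bounded_imp_gaussible[OF assms(1,3) _ \<open>0 < C\<close>]) auto
      then show "bounded_operator (fspace M (ri_norm X M)) (ri_norm X M) (ri_norm Y M') T"
        using \<open>i\<close> by (simp add: i_def)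
    qed
  qed
  moreover have "ii \<Longrightarrow> S_bounded (root_norm p X) (root_norm p Y)"
    unfolding U_bounded_iff[OF X Y NX NY, symmetric] ii_def
    by (rule K_bounded_imp_U_bounded[OF X Y NX NY M M']) blast
  moreover have "S_bounded (root_norm p X) (root_norm p Y) \<Longrightarrow> i"
    unfolding i_def using S_bounded_imp_gaussible_bounded[OF X Y NX NY assms(1,3)] by blast
  ultimately have "(i \<longleftrightarrow> ii) \<and> (ii \<longleftrightarrow> S_bounded (root_norm p X) (root_norm p Y))"
    by blast
  then show ?thesis
    unfolding Let_def U_bounded_iff[OF X Y NX NY] T_bounded_iff[OF X Y NX NY refl]
      S_bounded_iff_Sup_bounded[OF X Y NX NY, symmetric] i_def ii_def
    by simp
qed

end
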